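(* If $n_\infty$ is a rational number with $1/2<n_\infty\le1$, then $$E_{4n_\infty,2}^{1}(\tau;-8n_\infty,16n_\infty)=2^{8n_\infty}\eta^{-8n_\infty}(\tau)\eta^{16n_\infty}(2\tau).$$ If $n_\infty$ is a rational number with $2/3<n_\infty\le1$, then $$E_{3n_\infty,3}^{1}(\tau;-3n_\infty,9n_\infty)=3^{9n_\infty/2}e\Big(-\frac{n_\infty}{4}\Big)\eta^{-3n_\infty}(\tau)\eta^{9n_\infty}(3\tau).$$
   Context: $e(x)=\exp(2\pi ix)$, $\tau\in\mathbb{H}$, $q=e(\tau)$; fractional powers are principal branches ($z^\alpha=\exp(\alpha\log z)$, $-\pi<\operatorname{Im}\log z\le\pi$); $3^{9n_\infty/2}$ is the positive real power. Dedekind sums: $s(h,c)=\sum_{r\bmod c}((r/c))((hr/c))$ with $((x))=x-\lfloor x\rfloor-1/2$ for $x\notin\mathbb{Z}$, $((x))=0$ for $x\in\mathbb{Z}$. For a prime $p$, rationals $r_1,r_p$ and rational $k>2$: $E_{k,p}^{1}(\tau;r_1,r_p)=\sum_{c>0,\ d\in\mathbb{Z},\ \gcd(c,d)=\gcd(p,c)=1}(c\tau+d)^{-k}e\big(-r_1(\frac{a+b+d}{24(a+c)}+\frac12 s(-b-d,a+c)-\frac18)-r_p(\frac{a+b+d}{24(a+c)/p}+\frac12 s(-b-d,(a+c)/p)-\frac18)\big)$, where for each $(c,d)$, $a,b$ are any integers with $ad-bc=1$, $p\mid a+c$, $a+c>0$. Eta powers: $\eta(\tau)=q^{1/24}\prod_{n\ge1}(1-q^n)$,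 $\log\eta(\tau)=\log\eta(i)+\int_i^\tau\eta'(z)/\eta(z)\,dz$ (real logarithm of $\eta(i)>0$), and $\eta^r(\tau)=\exp(r\log\eta(\tau))$ for $r\in\mathbb{Q}$. *)

theory Defs
  imports "HOL-Complex_Analysis.Complex_Analysis"
begin

definition e2pi :: "complex \<Rightarrow> complex" where
  "e2pi x = exp (2 * of_real pi * \<i> * x)"

definition sawtooth :: "real \<Rightarrow> real" where
  "sawtooth x = (if x \<in> \<int> then 0 else x - of_int \<lfloor>x\<rfloor> - 1 / 2)"

definition dedekind_sum :: "int \<Rightarrow> int \<Rightarrow> real" where
  "dedekind_sum h c =
     (\<Sum>r\<in>{0..<c}. sawtooth (of_int r / of_int c) * sawtooth (of_int (h * r) / of_int c))"

text \<open>
  The factor \<open>q^(1/24)\<close> is read as \<open>e2pi (\<tau> / 24)\<close>, not as a principal power of the number \<open>q\<close>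
  (which would not be continuous in \<open>\<tau>\<close>).
\<close>

definition dedekind_eta :: "complex \<Rightarrow> complex" where
  "dedekind_eta \<tau> = e2pi (\<tau> / 24) * (\<Prod>n. 1 - e2pi \<tau> ^ Suc n)"

text \<open>
  The integral is taken along the straight segment, which lies in the upper half-plane;
  the integrand is holomorphic there, so the path does not matter.
\<close>

definition log_eta :: "complex \<Rightarrow> complex" where
  "log_eta \<tau> = of_real (ln (Re (dedekind_eta \<i>)))
     + contour_integral (linepath \<i> \<tau>) (\<lambda>z. deriv dedekind_eta z / dedekind_eta z)"

definition eta_power :: "rat \<Rightarrow> complex \<Rightarrow> complex" where
  "eta_power r \<tau> = exp (of_rat r * log_eta \<tau>)"

definition E_index :: "nat \<Rightarrow> (int \<times> int) set" where
  "E_index p = {(c, d). c > 0 \<and> coprime c d \<and> coprime (int p) c}"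

text \<open>
  The auxiliary integers \<open>a, b\<close> attached to each \<open>(c, d)\<close> are arbitrary subject to the three
  conditions below. A choice of them is a pair of functions \<open>a, b\<close> of \<open>(c, d)\<close>, which the
  Eisenstein series takes as an explicit argument; statements about the series quantify over
  all admissible choices.
\<close>

definition admissible_choice ::
    "nat \<Rightarrow> (int \<times> int \<Rightarrow> int) \<Rightarrow> (int \<times> int \<Rightarrow> int) \<Rightarrow> bool" where
  "admissible_choice p a b \<longleftrightarrow>
     (\<forall>(c, d)\<in>E_index p.
        a (c, d) * d - b (c, d) * c = 1 \<and> int p dvd a (c, d) + c \<and> a (c, d) + c > 0)"

text \<open>
  The division by \<open>p\<close> in \<open>E_phase\<close> is exact in every term of the series, since \<open>p\<close> divides
  \<open>a + c\<close>. The series converges absolutely for \<open>k > 2\<close>, so it is an unordered sum.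
\<close>

definition E_phase ::
    "nat \<Rightarrow> rat \<Rightarrow> rat \<Rightarrow> int \<Rightarrow> int \<Rightarrow> int \<Rightarrow> int \<Rightarrow> real" where
  "E_phase p r1 rp a b c d =
     (let m = a + c; m' = (a + c) div int p in
      - of_rat r1 * (of_int (a + b + d) / (24 * of_int m) + dedekind_sum (- b - d) m / 2 - 1 / 8)
      - of_rat rp * (of_int (a + b + d) / (24 * of_int m') + dedekind_sum (- b - d) m' / 2 - 1 / 8))"

definition eisenstein_E1 ::
    "(int \<times> int \<Rightarrow> int) \<Rightarrow> (int \<times> int \<Rightarrow> int) \<Rightarrow>
     rat \<Rightarrow> nat \<Rightarrow> rat \<Rightarrow> rat \<Rightarrow> complex \<Rightarrow> complex" where
  "eisenstein_E1 a b k p r1 rp \<tau> =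
     (\<Sum>\<^sub>\<infinity>(c, d)\<in>E_index p.
        (of_int c * \<tau> + of_int d) powr (- of_rat k)
        * e2pi (of_real (E_phase p r1 rp (a (c, d)) (b (c, d)) c d)))"

lemma admissible_choice_exists:
  assumes "p > 0"
  shows "\<exists>a b. admissible_choice p a b"
proof -
  have "\<exists>x y. x * d - y * c = 1 \<and> int p dvd x + c \<and> x + c > 0"
    if "(c, d) \<in> E_index p" for c d :: int
  proof -
    from that have c: "c > 0" "coprime c d" "coprime (int p) c"
      by (auto simp: E_index_def)
    from c(2) obtain u v where uv: "u * d + v * c = 1"
      by (metis bezout_int coprime_iff_gcd_eq_1 gcd.commute)
    obtain s t where st: "s * c + t * int p = 1"
      by (metis c(3) bezout_int coprime_iff_gcd_eq_1 gcd.commute)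
    define n where "n = - u * s + int p * \<bar>u - u * s * c\<bar>"
    have "u + n * c = int p * (t * u + \<bar>u - u * s * c\<bar> * c)"
    proof -
      have "u + n * c = u * (1 - s * c) + int p * \<bar>u - u * s * c\<bar> * c"
        by (simp add: n_def algebra_simps)
      also have "1 - s * c = t * int p" using st by simp
      finally show ?thesis by (simp add: algebra_simps)
    qed
    hence "int p dvd u + n * c" by simp
    moreover have "u + n * c \<ge> 0"
    proof -
      have "1 * \<bar>u - u * s * c\<bar> \<le> (int p * c) * \<bar>u - u * s * c\<bar>"
        using assms c(1) by (intro mult_right_mono) (simp_all add: int_one_le_iff_zero_less)
      moreover have "u + n * c = (u - u * s * c) + (int p * c) * \<bar>u - u * s * c\<bar>"
        by (simp add: n_def algebra_simps)
      moreover have "- (u - u * s * c) \<le> \<bar>u - u * s * c\<bar>" by (rule abs_ge_minus_self)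
      ultimately show ?thesis by (smt (verit))
    qed
    moreover define x y where "x = u + (n + int p - 1) * c" and "y = - v + (n + int p - 1) * d"
    have "x + c = (u + n * c) + int p * c" by (simp add: x_def algebra_simps)
    moreover have "x * d - y * c = 1" using uv by (simp add: x_def y_def algebra_simps)
    moreover have "int p * c > 0" using assms c(1) by simp
    ultimately have "x * d - y * c = 1 \<and> int p dvd x + c \<and> x + c > 0" by simp
    thus ?thesis by blast
  qed
  hence "\<forall>z\<in>E_index p. \<exists>x y. x * snd z - y * fst z = 1 \<and> int p dvd x + fst z \<and> x + fst z > 0"
    by auto
  then obtain a b where "\<forall>z\<in>E_index p. a z * snd z - b z * fst z = 1
      \<and> int p dvd a z + fst z \<and> a z + fst z > 0"
    by metis
  thus ?thesis unfolding admissible_choice_def by fastforce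
qed

end

theory Submission
  imports Defs
begin

text \<open>
  Write \<open>r\<^sub>1 = -r\<close>, \<open>r\<^sub>p = p r\<close> and \<open>f(\<tau>) = \<eta>\<^sup>-\<^sup>r(\<tau>) \<eta>\<^sup>p\<^sup>r(p\<tau>)\<close>. By the transformation law of \<open>log \<eta>\<close>, the term
  with index \<open>(c, d)\<close> of the series is, up to a constant, \<open>f(\<tau>) / F(\<gamma>\<tau>)\<close>, where \<open>\<gamma> = (a b; c d)\<close>
  and \<open>F(w) = \<eta>\<^sup>-\<^sup>r(w) \<eta>\<^sup>p\<^sup>r((w + 1) / p)\<close> has period \<open>p\<close>. Hence \<open>h = E / f\<close> is a
  \<open>\<Gamma>\<^sub>0(p)\<close>-invariant holomorphic function. At the cusp \<open>0\<close> only the term \<open>(1, 0)\<close> survives, so \<open>h\<close>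
  has a computable limit there. At \<open>\<infinity>\<close> the order of \<open>f\<close> is \<open>r(p\<^sup>2 - 1) / 24 = n \<le> 1\<close> while \<open>E\<close>
  tends to \<open>0\<close>, so \<open>h\<close> has a removable singularity in \<open>q\<close>. The product of \<open>h\<close> minus its two cusp
  values vanishes at both cusps, so it is zero by the maximum principle, and \<open>h\<close> is constant.

  The transformation law of \<open>log \<eta>\<close> is proved by Euclidean descent on the lower row, using the reciprocity
  law of Dedekind sums and the inversion formula, which in turn is the quasi-modularity of \<open>E\<^sub>2\<close>.
\<close>

section \<open>Dedekind sums\<close>

text \<open>The phase attached to \<open>(c, d)\<close> is that of f under the matrix with rows
  \<open>(a, b)\<close> and \<open>(a + c, b + d)\<close>, which lies in Gamma_0(p) because p
  divides a + c. This matrix is \<gamma> followed by w -> w / (w + 1), which is why F is f expanded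
  at the cusp 1. The exponents -r and p r make the phases of a translation by p cancel in F. Hence
  neither the choice of a, b nor a multiplier system has to be tracked: the invariance of h is a
  permutation of its summands.

  In terms of r the hypotheses say that the weight k = (p - 1) r / 2 exceeds 2 and that r (p^2 - 1)
  / 24 <= 1, that is 4 / (p - 1) < r <= 24 / (p^2 - 1). Such r exist only if p + 1 < 6, hence for p
  = 2 and p = 3, and the bounds 1/2 < n and 2/3 < n are k > 2 for k = 4 n and k = 3 n.

  At infinity only the existence of a limit of h is known, not its value. Therefore the maximum
  principle is applied to a product of two factors, one for each cusp value, and the constant is
  read off at the cusp 0 afterwards.\<close>

lemma sum_int_atLeastLessThan:
  fixes k :: int assumes "k \<ge> 0"
  shows "2 * (\<Sum>r\<in>{0..<k}. r) = k * (k - 1)" and "6 * (\<Sum>r\<in>{0..<k}. r^2) = (k - 1) * k * (2 * k - 1)"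
proof -
  have "2 * (\<Sum>r\<in>{0..<k}. r) = k * (k - 1) \<and> 6 * (\<Sum>r\<in>{0..<k}. r^2) = (k - 1) * k * (2 * k - 1)"
    using assms
  proof (induction k rule: int_ge_induct)
    case (step i)
    have "{0..<i + 1} = insert i {0..<i}" using step(1) by auto
    then show ?case using step by (simp add: algebra_simps power2_eq_square)
  qed auto
  then show "2 * (\<Sum>r\<in>{0..<k}. r) = k * (k - 1)" "6 * (\<Sum>r\<in>{0..<k}. r^2) = (k - 1) * k * (2 * k - 1)"
    by auto
qed

lemma int_div_less_iff_less_mult:
  fixes m n q :: int assumes "q > 0"
  shows "m div q < n \<longleftrightarrow> m < n * q"
proof -
  have m: "m = q * (m div q) + m mod q" "0 \<le> m mod q" "m mod q < q" using assms by auto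
  show ?thesis
  proof
    assume "m div q < n"
    then have "q * (m div q + 1) \<le> q * n" using assms by simp
    then have "q * (m div q) + q \<le> n * q" by (simp add: algebra_simps)
    with m show "m < n * q" by linarith
  next
    assume "m < n * q"
    then have "q * (m div q) < q * n" using m mult.commute[of n q] by linarith
    then show "m div q < n" using assms by simp
  qed
qed

lemma bij_betw_mult_mod:
  fixes h k :: int assumes "k > 0" "coprime h k"
  shows "bij_betw (\<lambda>r. (h * r) mod k) {0..<k} {0..<k}"
proof -
  have "inj_on (\<lambda>r. (h * r) mod k) {0..<k}"
  proof (rule inj_onI)
    fix x y assume xy: "x \<in> {0..<k}" "y \<in> {0..<k}" "(h * x) mod k = (h * y) mod k"
    then have "k dvd h * x - h * y" by (simp add: mod_eq_dvd_iff)
    then have "k dvd h * (x - y)" by (simp add: algebra_simps)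
    then have "k dvd x - y" using assms(2) by (simp add: coprime_commute coprime_dvd_mult_right_iff)
    then have "x mod k = y mod k" by (simp add: mod_eq_dvd_iff)
    with xy show "x = y" by simp
  qed
  moreover have "(\<lambda>r. (h * r) mod k) ` {0..<k} \<subseteq> {0..<k}" using assms by auto
  ultimately show ?thesis
    by (simp add: bij_betw_def endo_inj_surj)
qed

text \<open>The residues \<open>h * r mod k\<close> run through all of \<open>{0..<k}\<close>, so
  their sum and their sum of squares are those of r. Writing each residue as
  \<open>h * r - k * (h * r div k)\<close> turns these two equalities into a linear and a quadratic
  relation between floor sums.\<close>

lemma sum_floor_quotients:
  fixes h k :: int assumes "k > 0" "coprime h k"
  shows "2 * (\<Sum>r\<in>{0..<k}. h * r div k) = (h - 1) * (k - 1)"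
    and "(h\<^sup>2 - 1) * (\<Sum>r\<in>{0..<k}. r^2) + k\<^sup>2 * (\<Sum>r\<in>{0..<k}. (h * r div k)^2)
       = 2 * h * k * (\<Sum>r\<in>{0..<k}. r * (h * r div k))"
proof -
  have m: "(h * r) mod k = h * r - k * (h * r div k)" for r
    by (simp add: minus_mult_div_eq_mod)
  have "(\<Sum>r\<in>{0..<k}. (h * r) mod k) = (\<Sum>r\<in>{0..<k}. r)"
    by (rule sum.reindex_bij_betw[OF bij_betw_mult_mod[OF assms]])
  moreover have "(\<Sum>r\<in>{0..<k}. (h * r) mod k) = h * (\<Sum>r\<in>{0..<k}. r) - k * (\<Sum>r\<in>{0..<k}. h * r div k)"
    by (simp only: m sum_subtractf sum_distrib_left)
  ultimately have "k * (2 * (\<Sum>r\<in>{0..<k}. h * r div k)) = (h - 1) * (2 * (\<Sum>r\<in>{0..<k}. r))"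
    by (simp add: algebra_simps)
  then have "k * (2 * (\<Sum>r\<in>{0..<k}. h * r div k)) = k * ((h - 1) * (k - 1))"
    using assms by (simp only: sum_int_atLeastLessThan) (simp add: sum_int_atLeastLessThan)
  then show "2 * (\<Sum>r\<in>{0..<k}. h * r div k) = (h - 1) * (k - 1)"
    using assms(1) by simp
  have "(\<Sum>r\<in>{0..<k}. ((h * r) mod k)^2) = (\<Sum>r\<in>{0..<k}. r^2)"
    by (rule sum.reindex_bij_betw[OF bij_betw_mult_mod[OF assms]])
  moreover have "(\<Sum>r\<in>{0..<k}. ((h * r) mod k)^2) = 
     h\<^sup>2 * (\<Sum>r\<in>{0..<k}. r\<^sup>2) - 2 * h * k * (\<Sum>r\<in>{0..<k}. r * (h * r div k))
       + k\<^sup>2 * (\<Sum>r\<in>{0..<k}. (h * r div k)\<^sup>2)"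
    unfolding sum_distrib_left sum_subtractf[symmetric] sum.distrib[symmetric]
    by (intro sum.cong refl, simp only: m) (simp add: power2_eq_square algebra_simps)
  ultimately show "(h\<^sup>2 - 1) * (\<Sum>r\<in>{0..<k}. r^2) + k\<^sup>2 * (\<Sum>r\<in>{0..<k}. (h * r div k)^2)
       = 2 * h * k * (\<Sum>r\<in>{0..<k}. r * (h * r div k))"
    by (simp add: algebra_simps)
qed

text \<open>Double counting of lattice points below the line of slope h / k. With
  \<open>q = h * r div k\<close>, the number \<open>q^2 + q\<close> is twice the sum of the v <= q.
  After exchanging the sums, a fixed v >= 1 is counted once for each r > k v / h, since coprimality
  keeps the points in question off the line.\<close>

lemma floor_quotient_reciprocity:
  fixes h k :: int assumes "h > 0" "k > 0" "coprime h k"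
  shows "(\<Sum>r\<in>{0..<k}. (h * r div k)^2) + (\<Sum>r\<in>{0..<k}. h * r div k)
     + 2 * (\<Sum>v\<in>{0..<h}. v * (k * v div h)) = h * (h - 1) * (k - 1)"
proof -
  have q: "(h * r div k)^2 + h * r div k = 2 * (\<Sum>v\<in>{0..<h}. if v \<le> h * r div k then v else 0)"
    if "r \<in> {0..<k}" for r
  proof -
    have "h * r < h * k" using that assms by simp
    then have "h * r div k < h"
      using assms(2) by (simp add: int_div_less_iff_less_mult)
    moreover have "h * r div k \<ge> 0" using that assms by (simp add: pos_imp_zdiv_nonneg_iff)
    ultimately have "{0..<h} \<inter> {v. v \<le> h * r div k} = {0..<h * r div k + 1}" by auto
    then have "(\<Sum>v\<in>{0..<h}. if v \<le> h * r div k then v else 0) = (\<Sum>v\<in>{0..<h * r div k + 1}. v)"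
      by (simp add: sum.If_cases)
    then show ?thesis using \<open>h * r div k \<ge> 0\<close>
      by (simp add: sum_int_atLeastLessThan(1)) (simp add: power2_eq_square algebra_simps)
  qed
  \<comment> \<open>For v = 0 every r satisfies the condition, one more than the formula counts, but
    the weight v is 0.\<close>
  have c: "(\<Sum>r\<in>{0..<k}. if v \<le> h * r div k then v else 0) = v * (k - 1 - k * v div h)"
    if "v \<in> {0..<h}" for v
  proof (cases "v = 0")
    case False
    with that have v: "0 < v" "v < h" by auto
    have iff: "v \<le> h * r div k \<longleftrightarrow> k * v div h < r" for r
    proof -
      have ne: "v * k \<noteq> r * h"
      proof
        assume "v * k = r * h"
        then have "h dvd v * k" by simp
        then have "h dvd v" using assms(3) by (simp add: coprime_dvd_mult_left_iff)
        with v show False by (simp add: zdvd_not_zless)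
      qed
      have "v \<le> h * r div k \<longleftrightarrow> v * k \<le> r * h"
        using int_div_less_iff_less_mult[OF assms(2), of "h * r" v] by (simp only: mult.commute[of r h] linorder_not_less[symmetric])
      also have "\<dots> \<longleftrightarrow> v * k < r * h" using ne by auto
      also have "\<dots> \<longleftrightarrow> k * v div h < r"
        using int_div_less_iff_less_mult[OF assms(1), of "k * v" r] by (simp only: mult.commute[of v k])
      finally show ?thesis .
    qed
    have "k * v < k * h" using assms v by simp
    then have "k * v div h < k" using assms(1) by (simp add: int_div_less_iff_less_mult)
    moreover have "0 \<le> k * v div h" using assms v by (simp add: pos_imp_zdiv_nonneg_iff)
    ultimately have "{0..<k} \<inter> {r. k * v div h < r} = {k * v div h + 1..<k}" "k * v div h + 1 \<le> k"
      by auto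
    then show ?thesis by (simp only: iff) (simp add: sum.If_cases algebra_simps)
  next
    case True
    then have "(if v \<le> h * r div k then v else 0) = 0" for r by simp
    with True show ?thesis by simp
  qed
  have "(\<Sum>r\<in>{0..<k}. (h * r div k)^2) + (\<Sum>r\<in>{0..<k}. h * r div k)
     = 2 * (\<Sum>r\<in>{0..<k}. \<Sum>v\<in>{0..<h}. if v \<le> h * r div k then v else 0)"
    by (simp add: q sum_distrib_left flip: sum.distrib)
  also have "(\<Sum>r\<in>{0..<k}. \<Sum>v\<in>{0..<h}. if v \<le> h * r div k then v else 0)
     = (\<Sum>v\<in>{0..<h}. v * (k - 1 - k * v div h))"
    by (subst sum.swap) (simp add: c)
  also have "\<dots> = (k - 1) * (\<Sum>v\<in>{0..<h}. v) - (\<Sum>v\<in>{0..<h}. v * (k * v div h))"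
    by (simp add: algebra_simps sum_subtractf sum.distrib sum_distrib_left)
  finally show ?thesis
    using sum_int_atLeastLessThan(1)[of h] assms(1) by (simp add: algebra_simps)
qed

lemma sawtooth_of_int_divide:
  fixes h k :: int assumes "k > 0" "\<not> k dvd h"
  shows "sawtooth (of_int h / of_int k) = of_int h / of_int k - of_int (h div k) - 1 / 2"
proof -
  have "real_of_int h / real_of_int k \<notin> \<int>"
  proof
    assume "real_of_int h / real_of_int k \<in> \<int>"
    then obtain m where "real_of_int h / real_of_int k = of_int m" by (auto elim: Ints_cases)
    then have "real_of_int h = of_int (m * k)" using assms by (simp add: field_simps)
    then have "h = m * k" by linarith
    with assms show False by simp
  qed
  then show ?thesis by (simp add: sawtooth_def floor_divide_of_int_eq)
qed

lemma sawtooth_of_int [simp]: "sawtooth (of_int m) = 0" "sawtooth 0 = 0"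
  by (simp_all add: sawtooth_def)

text \<open>Clearing denominators with 12 k^2 makes everything an integer combination of floor sums.
  Since ((0)) = 0 the summand r = 0 is absent, so the constant 1/4 occurs only k - 1 times.\<close>

lemma dedekind_sum_altdef:
  fixes h k :: int assumes "k > 0" "coprime h k"
  shows "12 * k\<^sup>2 * dedekind_sum h k = of_int (12 * h * (\<Sum>r\<in>{0..<k}. r^2) - 12 * k * (\<Sum>r\<in>{0..<k}. r * (h * r div k))
     - 6 * k * (h + 1) * (\<Sum>r\<in>{0..<k}. r) + 6 * k\<^sup>2 * (\<Sum>r\<in>{0..<k}. h * r div k) + 3 * k\<^sup>2 * (k - 1))"
proof -
  have "{0..<k} = insert 0 {1..<k}" using assms by auto
  then have split: "(\<Sum>r\<in>{0..<k}. f r) = f 0 + (\<Sum>r\<in>{1..<k}. f r)" for f :: "int \<Rightarrow> 'b::comm_monoid_add"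
    by simp
  have "dedekind_sum h k = (\<Sum>r\<in>{1..<k}. (r / k - 1/2) * (h * r / k - of_int (h * r div k) - 1/2))"
    unfolding dedekind_sum_def split
  proof (simp, intro sum.cong refl)
    fix r assume r: "r \<in> {1..<k}"
    then have nd: "\<not> k dvd r" by (auto simp: zdvd_not_zless)
    then have nd': "\<not> k dvd h * r"
      using assms by (simp add: coprime_commute coprime_dvd_mult_right_iff)
    show "sawtooth (real_of_int r / k) * sawtooth (real_of_int h * real_of_int r / k) =
       (real_of_int r / k - 1 / 2) * (real_of_int h * real_of_int r / k - real_of_int (h * r div k) - 1 / 2)"
      using sawtooth_of_int_divide[OF assms(1) nd] sawtooth_of_int_divide[OF assms(1) nd'] r
      by simp
  qed
  then have "12 * k\<^sup>2 * dedekind_sum h k = (\<Sum>r\<in>{1..<k}. 12 * k\<^sup>2 * ((r / k - 1/2) * (h * r / k - of_int (h * r div k) - 1/2)))"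
    by (simp add: sum_distrib_left)
  also have "\<dots> = (\<Sum>r\<in>{1..<k}. of_int (12 * h * r\<^sup>2 - 12 * k * (r * (h * r div k)) - 6 * k * (h + 1) * r
      + 6 * k\<^sup>2 * (h * r div k) + 3 * k\<^sup>2))"
    using assms by (intro sum.cong refl) (simp add: field_simps power2_eq_square)
  also have "\<dots> = of_int (12 * h * (\<Sum>r\<in>{1..<k}. r^2) - 12 * k * (\<Sum>r\<in>{1..<k}. r * (h * r div k))
     - 6 * k * (h + 1) * (\<Sum>r\<in>{1..<k}. r) + 6 * k\<^sup>2 * (\<Sum>r\<in>{1..<k}. h * r div k) + 3 * k\<^sup>2 * (k - 1))"
    using assms by (simp add: sum.distrib sum_subtractf sum_distrib_left)
  finally show ?thesis by (simp add: split)
qed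

text \<open>The mixed sums B and B' are not evaluated individually. Only \<open>h B + k B'\<close>
  enters the left side, and it is found by eliminating C between the quadratic floor relation and
  the lattice point count; what remains are power sums.\<close>

theorem dedekind_reciprocity:
  fixes h k :: int assumes "h > 0" "k > 0" "coprime h k"
  shows "dedekind_sum h k + dedekind_sum k h = - 1 / 4 + (h / k + k / h + 1 / (h * k)) / 12"
proof -
  have ck: "coprime k h" using assms(3) by (simp add: coprime_commute)
  define A B C A' B' C' S T S' T' where d:
    "A = real_of_int (\<Sum>r\<in>{0..<k}. h * r div k)" "B = real_of_int (\<Sum>r\<in>{0..<k}. r * (h * r div k))"
    "C = real_of_int (\<Sum>r\<in>{0..<k}. (h * r div k)\<^sup>2)"
    "A' = real_of_int (\<Sum>r\<in>{0..<h}. k * r div h)" "B' = real_of_int (\<Sum>r\<in>{0..<h}. r * (k * r div h))"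
    "C' = real_of_int (\<Sum>r\<in>{0..<h}. (k * r div h)\<^sup>2)"
    "S = real_of_int (\<Sum>r\<in>{0..<k}. r)" "T = real_of_int (\<Sum>r\<in>{0..<k}. r\<^sup>2)"
    "S' = real_of_int (\<Sum>r\<in>{0..<h}. r)" "T' = real_of_int (\<Sum>r\<in>{0..<h}. r\<^sup>2)"
  define x y where xy: "x = real_of_int h" "y = real_of_int k"
  have S: "2 * S = y * (y - 1)" "6 * T = (y - 1) * y * (2 * y - 1)" 
          "2 * S' = x * (x - 1)" "6 * T' = (x - 1) * x * (2 * x - 1)"
    using sum_int_atLeastLessThan[of h, THEN arg_cong, of real_of_int]
          sum_int_atLeastLessThan[of k, THEN arg_cong, of real_of_int] assms(1,2)
    unfolding d xy of_int_mult of_int_diff of_int_numeral of_int_1 by auto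
  have A: "2 * A = (x - 1) * (y - 1)" "2 * A' = (y - 1) * (x - 1)"
     "(x\<^sup>2 - 1) * T + y\<^sup>2 * C = 2 * x * y * B"
    using sum_floor_quotients[OF assms(2,3), THEN arg_cong, of real_of_int]
      sum_floor_quotients[OF assms(1) ck, THEN arg_cong, of real_of_int]
    unfolding d xy of_int_mult of_int_diff of_int_numeral of_int_1 of_int_add of_int_power by auto
  have R: "C + A + 2 * B' = x * (x - 1) * (y - 1)"
    using floor_quotient_reciprocity[OF assms, THEN arg_cong, of real_of_int]
    unfolding d xy of_int_mult of_int_diff of_int_numeral of_int_1 of_int_add by auto
  have s: "12 * y\<^sup>2 * dedekind_sum h k = 12 * x * T - 12 * y * B - 6 * y * (x + 1) * S + 6 * y\<^sup>2 * A + 3 * y\<^sup>2 * (y - 1)"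
    "12 * x\<^sup>2 * dedekind_sum k h = 12 * y * T' - 12 * x * B' - 6 * x * (y + 1) * S' + 6 * x\<^sup>2 * A' + 3 * x\<^sup>2 * (x - 1)"
    using dedekind_sum_altdef[OF assms(2,3)] dedekind_sum_altdef[OF assms(1) ck]
    unfolding d xy of_int_mult of_int_diff of_int_numeral of_int_1 of_int_add of_int_power by auto
  have pos: "x > 0" "y > 0" using assms by (auto simp: xy)
  have TT: "T = (y - 1) * y * (2 * y - 1) / 6" "T' = (x - 1) * x * (2 * x - 1) / 6" 
     "S = y * (y - 1) / 2" "S' = x * (x - 1) / 2" "A = (x - 1) * (y - 1) / 2" "A' = (x - 1) * (y - 1) / 2"
     using S A by (simp_all add: mult.commute)
  have CC: "C = x * (x - 1) * (y - 1) - A - 2 * B'" using R by linarith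
  have "12 * x * y * B + 12 * y\<^sup>2 * B' = 6 * (x\<^sup>2 - 1) * T + 6 * y\<^sup>2 * (x * (x - 1) * (y - 1) - A)"
    using A(3) unfolding CC by (simp add: algebra_simps)
  then have BB: "12 * x * B + 12 * y * B' = (x\<^sup>2 - 1) * (y - 1) * (2 * y - 1) + 6 * y * (x * (x - 1) * (y - 1)) - 3 * y * ((x - 1) * (y - 1))"
  proof -
    assume *: "12 * x * y * B + 12 * y\<^sup>2 * B' = 6 * (x\<^sup>2 - 1) * T + 6 * y\<^sup>2 * (x * (x - 1) * (y - 1) - A)"
    have "y * (12 * x * B + 12 * y * B') = y * ((x\<^sup>2 - 1) * (y - 1) * (2 * y - 1) + 6 * y * (x * (x - 1) * (y - 1)) - 3 * y * ((x - 1) * (y - 1)))"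
      using * unfolding TT by (simp add: field_simps power2_eq_square)
    then show ?thesis using pos by simp
  qed
  have s1: "12 * y * dedekind_sum h k = (2 * x * (y - 1) * (2 * y - 1) - 12 * B - 3 * y * (x + 1) * (y - 1) + 3 * y * (x - 1) * (y - 1) + 3 * y * (y - 1))"
  proof -
    have "y * (12 * y * dedekind_sum h k) = y * (2 * x * (y - 1) * (2 * y - 1) - 12 * B - 3 * y * (x + 1) * (y - 1) + 3 * y * (x - 1) * (y - 1) + 3 * y * (y - 1))"
      using s(1) unfolding TT by (simp add: field_simps power2_eq_square)
    then show ?thesis using pos by simp
  qed
  have s2: "12 * x * dedekind_sum k h = (2 * y * (x - 1) * (2 * x - 1) - 12 * B' - 3 * x * (y + 1) * (x - 1) + 3 * x * (x - 1) * (y - 1) + 3 * x * (x - 1))"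
  proof -
    have "x * (12 * x * dedekind_sum k h) = x * (2 * y * (x - 1) * (2 * x - 1) - 12 * B' - 3 * x * (y + 1) * (x - 1) + 3 * x * (x - 1) * (y - 1) + 3 * x * (x - 1))"
      using s(2) unfolding TT by (simp add: field_simps power2_eq_square)
    then show ?thesis using pos by simp
  qed
  have "12 * x * y * (dedekind_sum h k + dedekind_sum k h)
     = x * (12 * y * dedekind_sum h k) + y * (12 * x * dedekind_sum k h)"
    by (simp add: algebra_simps)
  also have "\<dots> = x^2 + y^2 + 1 - 3 * x * y"
    using BB unfolding s1 s2 by (simp add: algebra_simps power2_eq_square)
  finally show ?thesis using pos unfolding xy
    by (simp add: field_simps power2_eq_square)
qed

lemma sawtooth_minus: "sawtooth (- x) = - sawtooth x"
proof (cases "x \<in> \<int>")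
  case False
  then have "\<lceil>x\<rceil> = \<lfloor>x\<rfloor> + 1"
    by (metis Ints_of_int ceiling_altdef)
  with False show ?thesis by (simp add: sawtooth_def floor_minus)
qed (simp add: sawtooth_def)

lemma dedekind_sum_minus: "dedekind_sum (- h) k = - dedekind_sum h k"
  by (simp add: dedekind_sum_def sawtooth_minus sum_negf)

lemma sawtooth_add_int: "sawtooth (x + of_int m) = sawtooth x"
  by (simp add: sawtooth_def)

lemma dedekind_sum_periodic:
  assumes "k > 0" shows "dedekind_sum (h + j * k) k = dedekind_sum h k"
proof -
  have "sawtooth (of_int ((h + j * k) * r) / of_int k) = sawtooth (of_int (h * r) / of_int k)" for r
  proof -
    have "real_of_int ((h + j * k) * r) / of_int k = of_int (h * r) / of_int k + of_int (j * r)"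
      using assms by (simp add: field_simps)
    then show ?thesis by (simp only: sawtooth_add_int)
  qed
  then show ?thesis by (simp add: dedekind_sum_def)
qed

section \<open>The logarithm of the eta function\<close>

text \<open>For |q| < 1 each \<open>1 - q ^ Suc n\<close> lies in the disc of radius 1 around 1, so
  the principal logarithms of the factors add up to a holomorphic logarithm of the Euler product,
  with value 0 at q = 0.\<close>

definition log_euler :: "complex \<Rightarrow> complex" where
  "log_euler q = (\<Sum>n. Ln (1 - q ^ Suc n))"

lemma one_minus_power_notin_nonpos_Reals:
  fixes q :: complex assumes "norm q < 1" shows "1 - q ^ Suc n \<notin> \<real>\<^sub>\<le>\<^sub>0"
proof -
  have "norm (q ^ Suc n) < 1" using assms by (simp only: norm_power) (simp add: power_less_one_iff del: power_Suc)
  then have "Re (q ^ Suc n) < 1" using complex_Re_le_cmod[of "q ^ Suc n"] by linarith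
  then show ?thesis by (auto simp: complex_nonpos_Reals_iff)
qed

lemma log_euler_series:
  assumes "norm q < 1"
  shows "summable (\<lambda>n. Ln (1 - q ^ Suc n))"
    and "summable (\<lambda>n. of_nat (Suc n) * q ^ n / (1 - q ^ Suc n))"
    and "(log_euler has_field_derivative - (\<Sum>n. of_nat (Suc n) * q ^ n / (1 - q ^ Suc n))) (at q)"
proof -
  let ?f = "\<lambda>n q. Ln (1 - q ^ Suc n)" and ?f' = "\<lambda>n q :: complex. - (of_nat (Suc n) * q ^ n / (1 - q ^ Suc n))"
  have "\<exists>g g'. \<forall>q \<in> ball 0 1. ((\<lambda>n. ?f n q) sums g q) \<and> ((\<lambda>n. ?f' n q) sums g' q) \<and> (g has_field_derivative g' q) (at q)"
  proof (rule series_and_derivative_comparison_complex)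
    fix n and q :: complex assume "q \<in> ball 0 1"
    then have "1 - q ^ Suc n \<notin> \<real>\<^sub>\<le>\<^sub>0" by (intro one_minus_power_notin_nonpos_Reals) simp
    then show "((\<lambda>q. Ln (1 - q ^ Suc n)) has_field_derivative ?f' n q) (at q)"
      by (auto intro!: derivative_eq_intros simp del: power_Suc simp: divide_simps)
  next
    fix x :: complex assume x: "x \<in> ball 0 1"
    \<comment> \<open>Every point of the disc of radius (1 - |x|) / 2 around x has norm at most r <
      1. Once r^(n+1) < 1/2, the bound |Ln (1 + u)| <= 2 |u| gives a geometric majorant that is
      uniform on this disc.\<close>
    define r where "r = (1 + norm x) / 2"
    have r: "0 < r" "r < 1" using x by (auto simp: r_def add_pos_nonneg)
    have ev: "\<forall>\<^sub>F n in sequentially. r ^ Suc n < 1 / 2"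
      by (rule order_tendstoD(2)[OF LIMSEQ_power_zero[THEN LIMSEQ_Suc]]) (use r in auto)
    have "\<forall>\<^sub>F n in sequentially. \<forall>y\<in>ball x ((1 - norm x) / 2) \<inter> ball 0 1. cmod (?f n y) \<le> cmod (of_real (2 * r ^ Suc n))"
      using ev
    proof eventually_elim
      case (elim n)
      show ?case
      proof
        fix y assume "y \<in> ball x ((1 - norm x) / 2) \<inter> ball 0 1"
        then have "norm y \<le> r" 
          using norm_triangle_sub[of y x] by (simp add: r_def dist_norm norm_minus_commute field_simps)
        then have le: "norm (- (y ^ Suc n)) \<le> r ^ Suc n" 
          unfolding norm_minus_cancel norm_power by (intro power_mono) auto
        with elim have "norm (Ln (1 + - (y ^ Suc n))) \<le> 2 * norm (- (y ^ Suc n))"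
          by (intro norm_Ln_le) linarith
        also have "\<dots> \<le> 2 * r ^ Suc n" using le by simp
        finally show "cmod (?f n y) \<le> cmod (of_real (2 * r ^ Suc n))"
          using r by (simp add: norm_power del: power_Suc)
      qed
    qed
    moreover have "summable (\<lambda>n. complex_of_real (2 * r ^ Suc n))"
      unfolding summable_complex_of_real 
      using r by (intro summable_mult summable_Suc_iff[THEN iffD2] summable_geometric) auto
    moreover have "range (\<lambda>n. complex_of_real (2 * r ^ Suc n)) \<subseteq> \<real>\<^sub>\<ge>\<^sub>0"
      using r by auto
    moreover have "0 < (1 - norm x) / 2" using x by simp
    ultimately show "\<exists>d h. 0 < d \<and> summable h \<and> range h \<subseteq> \<real>\<^sub>\<ge>\<^sub>0 \<and>
      (\<forall>\<^sub>F n in sequentially. \<forall>y\<in>ball x d \<inter> ball 0 1. cmod (?f n y) \<le> cmod (h n))"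
      by blast
  qed auto
  then obtain g g' where gg: "\<forall>q \<in> ball 0 1. ((\<lambda>n. ?f n q) sums g q) \<and> ((\<lambda>n. ?f' n q) sums g' q)
      \<and> (g has_field_derivative g' q) (at q)"
    by blast
  have g: "(\<lambda>n. ?f n q) sums g q" "(\<lambda>n. ?f' n q) sums g' q" "(g has_field_derivative g' q) (at q)"
    if "norm q < 1" for q using gg[rule_format, of q] that by simp_all
  show "summable (\<lambda>n. Ln (1 - q ^ Suc n))" using g(1)[OF assms] by (rule sums_summable)
  have s: "(\<lambda>n. of_nat (Suc n) * q ^ n / (1 - q ^ Suc n)) sums (- g' q)"
    using sums_minus[OF g(2)[OF assms]] by (simp del: power_Suc of_nat_Suc)
  then show "summable (\<lambda>n. of_nat (Suc n) * q ^ n / (1 - q ^ Suc n))" by (rule sums_summable)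
  have "(log_euler has_field_derivative g' q) (at q)"
  proof (rule has_field_derivative_transform_within_open[OF g(3)[OF assms] open_ball])
    show "q \<in> ball 0 1" using assms by simp
    show "g z = log_euler z" if "z \<in> ball 0 1" for z
      using g(1)[of z] that by (simp add: log_euler_def sums_unique del: power_Suc)
  qed
  then show "(log_euler has_field_derivative - (\<Sum>n. of_nat (Suc n) * q ^ n / (1 - q ^ Suc n))) (at q)"
    using s by (simp add: sums_iff del: power_Suc of_nat_Suc)
qed

lemma log_euler_0 [simp]: "log_euler 0 = 0"
  by (simp add: log_euler_def)

lemma exp_log_euler:
  assumes "norm q < 1" shows "exp (log_euler q) = (\<Prod>n. 1 - q ^ Suc n)"
proof -
  have "(\<Prod>n. exp (Ln (1 - q ^ Suc n))) = exp (log_euler q)"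
    unfolding log_euler_def by (rule prodinf_exp[OF log_euler_series(1)[OF assms]])
  moreover have "exp (Ln (1 - q ^ Suc n)) = 1 - q ^ Suc n" for n
    using one_minus_power_notin_nonpos_Reals[OF assms, of n] by (intro exp_Ln) auto
  ultimately show ?thesis by (simp del: power_Suc)
qed

lemma norm_e2pi: "norm (e2pi z) = exp (- 2 * pi * Im z)"
  by (simp add: e2pi_def)

lemma norm_e2pi_less_1: "Im z > 0 \<Longrightarrow> norm (e2pi z) < 1"
  by (simp add: norm_e2pi)

lemma e2pi_add: "e2pi (x + y) = e2pi x * e2pi y"
  by (simp add: e2pi_def exp_add algebra_simps)

lemma e2pi_of_int [simp]: "e2pi (of_int n) = 1"
  by (auto simp: e2pi_def exp_eq_1)

lemma has_field_derivative_e2pi: "(e2pi has_field_derivative 2 * of_real pi * \<i> * e2pi z) (at z)"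
  unfolding e2pi_def by (auto intro!: derivative_eq_intros)

abbreviation upper_half :: "complex set" where "upper_half \<equiv> {z. Im z > 0}"

lemma dedekind_eta_conv_exp:
  assumes "Im z > 0" shows "dedekind_eta z = exp (of_real pi * \<i> * z / 12 + log_euler (e2pi z))"
  using exp_log_euler[OF norm_e2pi_less_1[OF assms]]
  by (simp add: dedekind_eta_def exp_add e2pi_def mult_ac)

text \<open>The derivative is \<pi> i / 12 times the Eisenstein series E_2 = 1 - 24 (sum of n q^n /
  (1 - q^n)); this is how E_2 governs the inversion formula.\<close>

lemma log_eta_primitive:
  assumes "Im z > 0"
  shows "((\<lambda>z. of_real pi * \<i> * z / 12 + log_euler (e2pi z)) has_field_derivative
     (of_real pi * \<i> / 12 - 2 * of_real pi * \<i> * (\<Sum>n. of_nat (Suc n) * e2pi z ^ Suc n / (1 - e2pi z ^ Suc n)))) (at z)"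
proof -
  have q: "norm (e2pi z) < 1" by (rule norm_e2pi_less_1[OF assms])
  have "((\<lambda>z. of_real pi * \<i> * z / 12 + log_euler (e2pi z)) has_field_derivative
    (of_real pi * \<i> / 12 + (2 * of_real pi * \<i> * e2pi z) * - (\<Sum>n. of_nat (Suc n) * e2pi z ^ n / (1 - e2pi z ^ Suc n)))) (at z)"
    using DERIV_chain2[OF log_euler_series(3)[OF q] has_field_derivative_e2pi]
    by (auto intro!: derivative_eq_intros simp: mult_ac simp del: power_Suc of_nat_Suc)
  also have "of_real pi * \<i> / 12 + (2 * of_real pi * \<i> * e2pi z) * - (\<Sum>n. of_nat (Suc n) * e2pi z ^ n / (1 - e2pi z ^ Suc n))
     = of_real pi * \<i> / 12 - 2 * of_real pi * \<i> * (\<Sum>n. e2pi z * (of_nat (Suc n) * e2pi z ^ n / (1 - e2pi z ^ Suc n)))"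
    by (simp only: suminf_mult[OF log_euler_series(2)[OF q]]) simp
  also have "(\<lambda>n. e2pi z * (of_nat (Suc n) * e2pi z ^ n / (1 - e2pi z ^ Suc n))) = 
    (\<lambda>n. of_nat (Suc n) * e2pi z ^ Suc n / (1 - e2pi z ^ Suc n))"
    by (simp add: fun_eq_iff)
  finally show ?thesis .
qed

text \<open>The right-hand side is a logarithm of eta, hence a primitive of eta' / eta along the
  segment. It agrees with \<open>log_eta\<close> at i because q = exp (-2 \<pi>) is there a positive
  real below 1, so every summand is real, as the normalisation by the real logarithm
  demands.\<close>

lemma log_eta_conv_log_euler:
  assumes "Im z > 0" shows "log_eta z = of_real pi * \<i> * z / 12 + log_euler (e2pi z)"
proof -
  define L where "L = (\<lambda>z. of_real pi * \<i> * z / 12 + log_euler (e2pi z))"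
  define L' where "L' z = of_real pi * \<i> / 12 - 2 * of_real pi * \<i> * (\<Sum>n. of_nat (Suc n) * e2pi z ^ Suc n / (1 - e2pi z ^ Suc n))" for z
  have der: "(L has_field_derivative L' z) (at z)" if "Im z > 0" for z
    unfolding L_def L'_def by (rule log_eta_primitive[OF that])
  have eta: "dedekind_eta z = exp (L z)" if "Im z > 0" for z
    using dedekind_eta_conv_exp[OF that] by (simp add: L_def)
  have logder: "deriv dedekind_eta z / dedekind_eta z = L' z" if "Im z > 0" for z
  proof -
    have "(dedekind_eta has_field_derivative (exp (L z) * L' z)) (at z)"
    proof (rule has_field_derivative_transform_within_open[of "\<lambda>z. exp (L z)" _ _ upper_half])
      show "open upper_half" by (rule open_halfspace_Im_gt)
    qed (use that in \<open>auto simp: eta intro!: derivative_eq_intros der\<close>)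
    then show ?thesis by (simp add: DERIV_imp_deriv eta[OF that])
  qed
  have seg: "w \<in> upper_half" if "w \<in> closed_segment \<i> z" for w
    using that convex_halfspace_Im_gt[of 0] assms closed_segment_subset[of \<i> upper_half z] by auto
  have "((\<lambda>z. L' z) has_contour_integral (L (pathfinish (linepath \<i> z)) - L (pathstart (linepath \<i> z)))) (linepath \<i> z)"
  proof (rule contour_integral_primitive)
    show "\<And>w. w \<in> upper_half \<Longrightarrow> (L has_field_derivative L' w) (at w within upper_half)"
      using der by (auto intro: has_field_derivative_at_within)
  qed (use seg in auto)
  then have "((\<lambda>z. deriv dedekind_eta z / dedekind_eta z) has_contour_integral (L z - L \<i>)) (linepath \<i> z)"
    unfolding pathstart_linepath pathfinish_linepath by (rule has_contour_integral_eq) (use seg in \<open>auto simp: logder\<close>)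
  then have int: "contour_integral (linepath \<i> z) (\<lambda>z. deriv dedekind_eta z / dedekind_eta z) = L z - L \<i>"
    by (rule contour_integral_unique)
  have q: "e2pi \<i> = of_real (exp (- 2 * pi))" 
    by (simp add: e2pi_def mult.assoc flip: exp_of_real)
  have "Ln (1 - of_real (exp (- 2 * pi)) ^ Suc n) = of_real (ln (1 - exp (- 2 * pi) ^ Suc n))" for n
  proof -
    have "exp (- 2 * pi) ^ Suc n < 1" by (simp add: power_less_one_iff del: power_Suc)
    then have "Ln (of_real (1 - exp (- 2 * pi) ^ Suc n)) = of_real (ln (1 - exp (- 2 * pi) ^ Suc n))"
      by (intro Ln_of_real) (simp del: power_Suc)
    then show ?thesis by (simp del: power_Suc)
  qed
  then have "log_euler (e2pi \<i>) = of_real (\<Sum>n. ln (1 - exp (- 2 * pi) ^ Suc n))"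
    using log_euler_series(1)[OF norm_e2pi_less_1, of \<i>]
    unfolding log_euler_def q by (simp add: suminf_of_real summable_complex_of_real del: power_Suc)
  then have "L \<i> = of_real (Re (L \<i>))" by (simp add: L_def complex_eq_iff)
  then have "of_real (ln (Re (dedekind_eta \<i>))) = L \<i>"
    using eta[of \<i>] by (metis Re_complex_of_real exp_of_real ln_exp zero_less_one imaginary_unit.simps(2))
  then show ?thesis
    by (simp add: log_eta_def int L_def)
qed

lemma log_eta_has_field_derivative:
  assumes "Im z > 0"
  shows "(log_eta has_field_derivative
     (of_real pi * \<i> / 12 - 2 * of_real pi * \<i> * (\<Sum>n. of_nat (Suc n) * e2pi z ^ Suc n / (1 - e2pi z ^ Suc n)))) (at z)"
  by (rule has_field_derivative_transform_within_open[OF log_eta_primitive[OF assms] open_halfspace_Im_gt[of 0]])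
     (use assms in \<open>auto simp: log_eta_conv_log_euler\<close>)

lemma log_eta_add_int:
  assumes "Im z > 0" shows "log_eta (z + of_int m) = log_eta z + of_real pi * \<i> * of_int m / 12"
  using assms by (simp add: log_eta_conv_log_euler e2pi_add algebra_simps add_divide_distrib)

section \<open>Lattice sums\<close>

lemma has_sum_int_split:
  fixes f :: "int \<Rightarrow> 'a :: {topological_comm_monoid_add,t2_space}"
  assumes "((\<lambda>n. f (int n)) has_sum A) UNIV" "((\<lambda>n. f (- int n - 1)) has_sum B) UNIV"
  shows "(f has_sum (A + B)) UNIV"
proof -
  have "bij_betw int UNIV {0..}" by (rule bij_betwI[of _ _ _ nat]) auto
  then have 1: "(f has_sum A) {0..}" using assms(1) by (simp add: has_sum_reindex_bij_betw)
  have "bij_betw (\<lambda>n. - int n - 1) UNIV {..<0}" by (rule bij_betwI[of _ _ _ "\<lambda>m. nat (- m - 1)"]) auto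
  then have 2: "(f has_sum B) {..<0}" using assms(2) has_sum_reindex_bij_betw[of "\<lambda>n. - int n - 1" UNIV "{..<0}" f B] by simp
  have "{0::int..} \<union> {..<0} = UNIV" by auto
  moreover have "(f has_sum (A + B)) ({0::int..} \<union> {..<0})"
    by (rule has_sum_Un_disjoint[OF 1 2]) auto
  ultimately show ?thesis by simp
qed

lemma has_sum_nonzero_int_split:
  fixes f :: "int \<Rightarrow> 'a :: {topological_comm_monoid_add,t2_space}"
  assumes "((\<lambda>n. f (int (Suc n))) has_sum A) UNIV" "((\<lambda>n. f (- int (Suc n))) has_sum B) UNIV"
  shows "(f has_sum (A + B)) (- {0})"
proof -
  have "bij_betw (\<lambda>n. int (Suc n)) UNIV {1..}" by (rule bij_betwI[of _ _ _ "\<lambda>m. nat (m - 1)"]) auto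
  then have 1: "(f has_sum A) {1..}" using assms(1) has_sum_reindex_bij_betw[of "\<lambda>n. int (Suc n)" UNIV "{1..}" f A] by simp
  have "bij_betw (\<lambda>n. - int (Suc n)) UNIV {..<0}" by (rule bij_betwI[of _ _ _ "\<lambda>m. nat (- m - 1)"]) auto
  then have 2: "(f has_sum B) {..<0}" using assms(2) has_sum_reindex_bij_betw[of "\<lambda>n. - int (Suc n)" UNIV "{..<0}" f B] by simp
  have "{1::int..} \<union> {..<0} = - {0}" by auto
  moreover have "(f has_sum (A + B)) ({1::int..} \<union> {..<0})"
    by (rule has_sum_Un_disjoint[OF 1 2]) auto
  ultimately show ?thesis by simp
qed

text \<open>The half-open windows are those on which \<open>sum_telescope_int\<close> leaves the
  symmetric boundary pair f (-N) - f N.\<close>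

lemma has_sum_int_imp_LIMSEQ:
  fixes f :: "int \<Rightarrow> 'a :: {topological_comm_monoid_add,t2_space}"
  assumes "(f has_sum S) UNIV"
  shows "(\<lambda>N. \<Sum>n\<in>{- int N<..int N}. f n) \<longlonglongrightarrow> S"
proof -
  have "filterlim (\<lambda>N. {- int N<..int N}) (finite_subsets_at_top UNIV) sequentially"
    unfolding filterlim_finite_subsets_at_top
  proof (intro allI impI, elim conjE)
    fix X :: "int set" assume "finite X"
    then have "\<bar>x\<bar> < Max (abs ` X) + 1" if "x \<in> X" for x
      using that Max_ge[of "abs ` X" "\<bar>x\<bar>"] \<open>finite X\<close> by simp
    then obtain B where B: "\<forall>x\<in>X. \<bar>x\<bar> < B" by blast
    have "X \<subseteq> {- int N<..int N}" if "N \<ge> nat B" for N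
    proof
      fix x assume "x \<in> X"
      then have "\<bar>x\<bar> < B" using B by blast
      then show "x \<in> {- int N<..int N}" using that by auto
    qed
    then show "\<forall>\<^sub>F N in sequentially. finite {- int N<..int N} \<and> X \<subseteq> {- int N<..int N} \<and> {- int N<..int N} \<subseteq> UNIV"
      by (auto intro!: eventually_sequentiallyI[of "nat B"])
  qed
  from filterlim_compose[OF assms[unfolded has_sum_def] this] show ?thesis .
qed

lemma summable_on_nat_powr:
  assumes "s > 1" shows "(\<lambda>n::nat. (1 + real n) powr (- s)) summable_on UNIV"
proof (subst summable_on_UNIV_nonneg_real_iff)
  have "summable (\<lambda>n. real (Suc n) powr (- s))"
    by (subst summable_Suc_iff[of "\<lambda>n. real n powr (- s)"]) (use assms in \<open>simp add: summable_real_powr_iff\<close>)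
  then show "summable (\<lambda>n. (1 + real n) powr (- s))" by (simp add: add_ac)
qed auto

lemma summable_on_int_powr:
  assumes "s > 1" shows "(\<lambda>n::int. (1 + \<bar>real_of_int n\<bar>) powr (- s)) summable_on UNIV"
proof -
  obtain A where A: "((\<lambda>n::nat. (1 + real n) powr (- s)) has_sum A) UNIV"
    using summable_on_nat_powr[OF assms] by (auto simp: summable_on_def)
  have 1: "(\<lambda>n::nat. (1 + \<bar>real_of_int (- int n - 1)\<bar>) powr (- s)) summable_on UNIV"
    by (rule summable_on_comparison_test[OF summable_on_nat_powr[OF assms]])
       (use assms in \<open>auto intro!: powr_mono2'\<close>)
  obtain B where B: "((\<lambda>n::nat. (1 + \<bar>real_of_int (- int n - 1)\<bar>) powr (- s)) has_sum B) UNIV"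
    using 1 by (auto simp: summable_on_def)
  show ?thesis unfolding summable_on_def
    by (rule exI[of _ "A + B"], rule has_sum_int_split) (use A B in simp_all)
qed

text \<open>With M = max |c| |d|, both 1 + |c| and 1 + |d| are at most 2 M unless M = 0. So M^-s is
  at most 2^s times a product of two one-dimensional terms of exponent s / 2 > 1.\<close>

lemma summable_on_lattice_powr:
  assumes "s > 2"
  shows "(\<lambda>(c::int, d::int). real_of_int (max \<bar>c\<bar> \<bar>d\<bar>) powr (- s)) summable_on UNIV"
proof -
  let ?u = "\<lambda>n::int. (1 + \<bar>real_of_int n\<bar>) powr (- (s / 2))"
  obtain A where A: "(?u has_sum A) UNIV"
    using summable_on_int_powr[of "s / 2"] assms by (auto simp: summable_on_def)
  have "(\<lambda>(c, d). ?u c * ?u d) summable_on (UNIV \<times> UNIV)"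
  proof (rule summable_on_SigmaI)
    show "((\<lambda>y. case (x, y) of (c, d) \<Rightarrow> ?u c * ?u d) has_sum (?u x * A)) UNIV" for x
      using has_sum_cmult_right[OF A, of "?u x"] by simp
    show "(\<lambda>x. ?u x * A) summable_on UNIV"
      using A by (intro summable_on_cmult_left) (auto simp: summable_on_def)
  qed auto
  then have "(\<lambda>x. 2 powr s * (case x of (c, d) \<Rightarrow> ?u c * ?u d)) summable_on UNIV"
    by (intro summable_on_cmult_right) simp
  then show ?thesis
  proof (rule summable_on_comparison_test)
    fix x :: "int \<times> int" obtain c d where x: "x = (c, d)" by (cases x)
    let ?M = "real_of_int (max \<bar>c\<bar> \<bar>d\<bar>)"
    have "?M powr (- s) \<le> 2 powr s * (?u c * ?u d)"
    proof (cases "max \<bar>c\<bar> \<bar>d\<bar> = 0")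
      case False
      then have M: "?M \<ge> 1" by linarith
      have "?M powr (- s) = 2 powr s * ((2 * ?M) powr (- (s / 2)) * (2 * ?M) powr (- (s / 2)))"
        using M by (simp add: powr_mult powr_minus field_simps flip: powr_add)
      also have "\<dots> \<le> 2 powr s * (?u c * ?u d)"
        using M assms by (intro mult_left_mono mult_mono powr_mono2') auto
      finally show ?thesis .
    next
      \<comment> \<open>\<open>0 powr (- s)\<close> is 0, so the origin can remain in the index
        set.\<close>
      case True
      then show ?thesis by (simp only: of_int_0 powr_0 simp_thms) simp
    qed
    then show "(case x of (c, d) \<Rightarrow> real_of_int (max \<bar>c\<bar> \<bar>d\<bar>) powr (- s)) \<le> 2 powr s * (case x of (c, d) \<Rightarrow> ?u c * ?u d)"
      by (simp add: x)
  qed (auto split: prod.splits)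
qed

text \<open>For |d| >= K |c| the real part is at least |d| / 2 in absolute value, because K >= 2 R;
  otherwise max |c| |d| <= K |c| and the imaginary part is at least y0 |c|. The constant depends
  only on the half-strip, which later makes convergence locally uniform.\<close>

lemma lattice_lower_bound:
  assumes "y0 > 0" "R \<ge> 0"
  obtains \<delta> where "\<delta> > 0"
    "\<And>\<tau> (c::int) (d::int). y0 \<le> Im \<tau> \<Longrightarrow> \<bar>Re \<tau>\<bar> \<le> R \<Longrightarrow> \<delta> * of_int (max \<bar>c\<bar> \<bar>d\<bar>) \<le> norm (of_int c * \<tau> + of_int d)"
proof
  define K where "K = 2 * R + 1"
  have K: "K \<ge> 1" "R \<le> K / 2" using assms by (auto simp: K_def)
  show "min (1 / 2) (y0 / K) > 0" using assms K by auto
  fix \<tau> and c d :: int assume t: "y0 \<le> Im \<tau>" "\<bar>Re \<tau>\<bar> \<le> R"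
  let ?M = "real_of_int (max \<bar>c\<bar> \<bar>d\<bar>)"
  have M: "?M \<ge> 0" "?M = max \<bar>real_of_int c\<bar> \<bar>real_of_int d\<bar>" by auto
  show "min (1 / 2) (y0 / K) * ?M \<le> norm (of_int c * \<tau> + of_int d)"
  proof (cases "\<bar>real_of_int d\<bar> \<ge> K * \<bar>real_of_int c\<bar>")
    case True
    have "1 * \<bar>real_of_int c\<bar> \<le> K * \<bar>real_of_int c\<bar>" using K by (intro mult_right_mono) auto
    with True have "?M = \<bar>real_of_int d\<bar>" unfolding M(2) by linarith
    have "\<bar>real_of_int c * Re \<tau>\<bar> \<le> \<bar>real_of_int c\<bar> * (K / 2)"
      unfolding abs_mult using t K by (intro mult_left_mono) linarith+
    moreover have "\<bar>real_of_int c\<bar> * (K / 2) = K * \<bar>real_of_int c\<bar> / 2" by simp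
    ultimately have "\<bar>real_of_int d\<bar> / 2 \<le> \<bar>real_of_int c * Re \<tau> + of_int d\<bar>"
      using True by linarith
    also have "\<dots> \<le> norm (of_int c * \<tau> + of_int d)"
      using abs_Re_le_cmod[of "of_int c * \<tau> + of_int d"] by simp
    finally have "(1 / 2) * ?M \<le> norm (of_int c * \<tau> + of_int d)"
      using \<open>?M = \<bar>real_of_int d\<bar>\<close> by simp
    moreover have "min (1 / 2) (y0 / K) * ?M \<le> (1 / 2) * ?M" by (intro mult_right_mono min.cobounded1 M(1))
    ultimately show ?thesis by linarith
  next
    case False
    have "1 * \<bar>real_of_int c\<bar> \<le> K * \<bar>real_of_int c\<bar>" using K by (intro mult_right_mono) auto
    with False have "?M \<le> K * \<bar>real_of_int c\<bar>" unfolding M(2) by linarith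
    then have "(y0 / K) * ?M \<le> (y0 / K) * (K * \<bar>real_of_int c\<bar>)"
      using assms K by (intro mult_left_mono) auto
    also have "\<dots> = y0 * \<bar>real_of_int c\<bar>" using K by simp
    also have "\<dots> \<le> \<bar>real_of_int c * Im \<tau>\<bar>"
      using t assms by (simp add: abs_mult mult.commute mult_right_mono)
    also have "\<dots> \<le> norm (of_int c * \<tau> + of_int d)"
      using abs_Im_le_cmod[of "of_int c * \<tau> + of_int d"] by simp
    finally have "(y0 / K) * ?M \<le> norm (of_int c * \<tau> + of_int d)" .
    moreover have "min (1 / 2) (y0 / K) * ?M \<le> (y0 / K) * ?M" by (intro mult_right_mono min.cobounded2 M(1))
    ultimately show ?thesis by linarith
  qed
qed

section \<open>The Lipschitz formula for inverse squares\<close>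

lemma Digamma_reflection:
  fixes z :: complex assumes "z \<notin> \<int>"
  shows "Digamma (1 - z) - Digamma z = of_real pi * cot (of_real pi * z)"
proof -
  have nz: "z \<notin> \<int>\<^sub>\<le>\<^sub>0" "1 - z \<notin> \<int>\<^sub>\<le>\<^sub>0"
    using assms Ints_diff[of 1 "1 - z"] by (auto dest!: nonpos_Ints_Int)
  \<comment> \<open>The reflection formula for the entire function \<open>rGamma\<close> is
    differentiated on both sides; dividing by sin (\<pi> z) / \<pi> then produces the
    cotangent.\<close>
  have "((\<lambda>z. rGamma z * rGamma (1 - z)) has_field_derivative
     (- rGamma z * Digamma z * rGamma (1 - z) + rGamma (1 - z) * Digamma (1 - z) * rGamma z)) (at z)"
    by (rule derivative_eq_intros has_field_derivative_rGamma_no_nonpos_int nz refl)+ simp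
  moreover have "(\<lambda>z. rGamma z * rGamma (1 - z)) = (\<lambda>z. sin (of_real pi * z) / of_real pi :: complex)"
    by (simp add: rGamma_reflection_complex fun_eq_iff)
  moreover have "((\<lambda>z. sin (of_real pi * z) / of_real pi :: complex) has_field_derivative cos (of_real pi * z)) (at z)"
    by (auto intro!: derivative_eq_intros)
  ultimately have "- rGamma z * Digamma z * rGamma (1 - z) + rGamma (1 - z) * Digamma (1 - z) * rGamma z = cos (of_real pi * z)"
    using DERIV_unique by metis
  then have "(rGamma z * rGamma (1 - z)) * (Digamma (1 - z) - Digamma z) = cos (of_real pi * z)"
    by (simp add: algebra_simps)
  then have "sin (of_real pi * z) / of_real pi * (Digamma (1 - z) - Digamma z) = cos (of_real pi * z)"
    by (simp only: rGamma_reflection_complex)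
  moreover have "sin (of_real pi * z) \<noteq> 0"
  proof
    assume "sin (of_real pi * z) = 0"
    then obtain n where "of_real pi * z = of_real (of_int n * pi)" by (auto simp: sin_eq_0)
    then have "of_real pi * z = of_real pi * of_int n" by (simp add: mult.commute)
    then have "z = of_int n" by simp
    with assms show False by simp
  qed
  ultimately show ?thesis by (simp add: cot_def field_simps)
qed

lemma sin_squared_conv_e2pi: "(sin (of_real pi * z))\<^sup>2 = - ((1 - e2pi z)\<^sup>2 / (4 * e2pi z))"
proof -
  have q: "e2pi z = exp (\<i> * (of_real pi * z)) ^ 2"
    by (simp add: e2pi_def mult_ac flip: exp_of_nat_mult exp_double)
  show ?thesis
    unfolding sin_exp_eq q exp_minus
    by (simp add: field_simps power2_eq_square)
qed

lemma one_minus_e2pi_nonzero: "Im z > 0 \<Longrightarrow> 1 - e2pi z \<noteq> 0"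
  using norm_e2pi_less_1[of z] by auto

lemma Im_pos_notin_Ints: "Im z \<noteq> 0 \<Longrightarrow> z \<notin> \<int>"
  by (auto elim!: Ints_cases)

lemma summable_norm_inverse_squares:
  assumes "Im w \<noteq> 0" shows "summable (\<lambda>k. norm (1 / (w + of_nat k)\<^sup>2))"
proof -
  \<comment> \<open>The sign e covers both half-planes: for Im w < 0 the squares are those of -w
    moved in steps of -1.\<close>
  have *: "summable (\<lambda>k. norm (1 / (w + of_int (e * int k))\<^sup>2))" if w: "Im w > 0" and e: "e \<in> {1, -1}" for w e
  proof -
    obtain \<delta> where \<delta>: "\<delta> > 0" "\<And>\<tau> (c::int) (d::int). Im w \<le> Im \<tau> \<Longrightarrow> \<bar>Re \<tau>\<bar> \<le> \<bar>Re w\<bar> \<Longrightarrow> \<delta> * of_int (max \<bar>c\<bar> \<bar>d\<bar>) \<le> norm (of_int c * \<tau> + of_int d)"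
      using lattice_lower_bound[OF w abs_ge_zero] by blast
    have "summable (\<lambda>k::nat. (2 / \<delta>)\<^sup>2 * (1 + real k) powr (- 2))"
      by (intro summable_mult summable_on_imp_summable summable_on_nat_powr) simp
    then show ?thesis
    proof (rule summable_comparison_test'[of _ 0])
      fix k :: nat
      have "\<delta> / 2 * (1 + real k) \<le> \<delta> * of_int (max \<bar>1::int\<bar> \<bar>e * int k\<bar>)"
      proof -
        have "\<bar>e\<bar> = 1" using e by auto
        then have "1 + real k \<le> 2 * of_int (max \<bar>1::int\<bar> \<bar>e * int k\<bar>)" by (auto simp: abs_mult)
        from mult_left_mono[OF this, of "\<delta> / 2"] \<delta>(1) show ?thesis by simp
      qed
      also have "\<dots> \<le> norm (w + of_int (e * int k))" using \<delta>(2)[of w 1 "e * int k"] by simp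
      finally have "(\<delta> / 2 * (1 + real k))\<^sup>2 \<le> (norm (w + of_int (e * int k)))\<^sup>2"
        using \<delta>(1) by (intro power_mono) auto
      moreover have "(\<delta> / 2 * (1 + real k))\<^sup>2 > 0" using \<delta>(1) by (intro zero_less_power mult_pos_pos) auto
      ultimately have "1 / (norm (w + of_int (e * int k)))\<^sup>2 \<le> 1 / (\<delta> / 2 * (1 + real k))\<^sup>2"
        by (intro divide_left_mono mult_pos_pos) linarith+
      also have "\<dots> = (2 / \<delta>)\<^sup>2 * (1 + real k) powr (- 2)"
        using \<delta>(1) by (simp add: powr_minus powr_numeral field_simps power2_eq_square)
      finally show "norm (norm (1 / (w + of_int (e * int k))\<^sup>2)) \<le> (2 / \<delta>)\<^sup>2 * (1 + real k) powr (- 2)"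
        by (simp add: norm_divide norm_power)
    qed
  qed
  show ?thesis
  proof (cases "Im w > 0")
    case True
    then show ?thesis using *[of w 1] by simp
  next
    case False
    have "(- w - of_nat k)\<^sup>2 = (w + of_nat k)\<^sup>2" for k by (simp add: power2_eq_square algebra_simps)
    with False show ?thesis using *[of "- w" "- 1"] assms by simp
  qed
qed

text \<open>The terms with d >= 0 and with d < 0 are the trigamma series at z and at 1 - z.
  Differentiating the Digamma reflection formula evaluates their sum as (\<pi> / sin (\<pi> z))^2,
  which is then written in q = e(z).\<close>

lemma lipschitz_formula_pos:
  assumes "Im z > 0"
  shows "((\<lambda>d::int. 1 / (z + of_int d)\<^sup>2) has_sum (- 4 * (of_real pi)\<^sup>2 * (e2pi z / (1 - e2pi z)\<^sup>2))) UNIV"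
proof -
  have ints: "z \<notin> \<int>" "1 - z \<notin> \<int>" using Im_pos_notin_Ints[of z] Im_pos_notin_Ints[of "1 - z"] assms by auto
  have nz: "w \<notin> \<int>\<^sub>\<le>\<^sub>0" "w \<noteq> 0" if "w \<notin> \<int>" for w :: complex using that nonpos_Ints_Int by auto
  have poly: "((\<lambda>k. 1 / (w + of_nat k)\<^sup>2) has_sum Polygamma 1 w) UNIV" if w: "Im w \<noteq> 0" for w :: complex
  proof (rule norm_summable_imp_has_sum)
    show "(\<lambda>k. 1 / (w + of_nat k)\<^sup>2) sums Polygamma 1 w"
      using Polygamma_LIMSEQ[of w 1] nz[OF Im_pos_notin_Ints[OF w]] by (simp add: inverse_eq_divide power2_eq_square)
    show "summable (\<lambda>k. norm (1 / (w + of_nat k)\<^sup>2))"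
      by (rule summable_norm_inverse_squares[OF w])
  qed
  have "((\<lambda>d::int. 1 / (z + of_int d)\<^sup>2) has_sum (Polygamma 1 z + Polygamma 1 (1 - z))) UNIV"
  proof (rule has_sum_int_split)
    show "((\<lambda>n. 1 / (z + of_int (int n))\<^sup>2) has_sum Polygamma 1 z) UNIV" using poly[of z] assms by simp
    have "(z + of_int (- int n - 1))\<^sup>2 = ((1 - z) + of_nat n)\<^sup>2" for n
      by (simp add: power2_eq_square algebra_simps)
    then show "((\<lambda>n. 1 / (z + of_int (- int n - 1))\<^sup>2) has_sum Polygamma 1 (1 - z)) UNIV"
      using poly[of "1 - z"] assms by (simp del: of_int_diff of_int_minus)
  qed
  also have "Polygamma 1 z + Polygamma 1 (1 - z) = (of_real pi / sin (of_real pi * z))\<^sup>2"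
  proof -
    have sin0: "sin (of_real pi * z) \<noteq> 0"
      using sin_squared_conv_e2pi[of z] one_minus_e2pi_nonzero[OF assms] by (auto simp: e2pi_def)
    have "((\<lambda>z. Digamma (1 - z) - Digamma z) has_field_derivative (- Polygamma 1 (1 - z) - Polygamma 1 z)) (at z)"
      using nz ints by (auto intro!: derivative_eq_intros simp: One_nat_def)
    moreover have "((\<lambda>z. Digamma (1 - z) - Digamma z) has_field_derivative - ((of_real pi / sin (of_real pi * z))\<^sup>2)) (at z)"
    proof (rule has_field_derivative_transform_within_open[of "\<lambda>z. of_real pi * cot (of_real pi * z)" _ _ upper_half])
      show "((\<lambda>z. of_real pi * cot (of_real pi * z)) has_field_derivative - ((of_real pi / sin (of_real pi * z))\<^sup>2)) (at z)"
        by (rule derivative_eq_intros DERIV_chain2[where f = cot and g = "\<lambda>z. of_real pi * z", OF DERIV_cot[OF sin0]] refl)+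
           (use sin0 in \<open>simp add: field_simps power2_eq_square\<close>)
      show "of_real pi * cot (of_real pi * w) = Digamma (1 - w) - Digamma w" if "w \<in> upper_half" for w
        using Digamma_reflection[OF Im_pos_notin_Ints, of w] that by simp
    qed (use assms open_halfspace_Im_gt[of 0] in auto)
    ultimately have "- Polygamma 1 (1 - z) - Polygamma 1 z = - ((of_real pi / sin (of_real pi * z))\<^sup>2)"
      by (rule DERIV_unique)
    then show ?thesis by (simp add: algebra_simps)
  qed
  also have "\<dots> = - 4 * (of_real pi)\<^sup>2 * (e2pi z / (1 - e2pi z)\<^sup>2)"
    unfolding power_divide sin_squared_conv_e2pi by (simp add: of_real_power)
  finally show ?thesis .
qed

lemma lipschitz_formula_neg:
  assumes "Im z < 0"
  shows "((\<lambda>d::int. 1 / (z + of_int d)\<^sup>2) has_sum (- 4 * (of_real pi)\<^sup>2 * (e2pi (- z) / (1 - e2pi (- z))\<^sup>2))) UNIV"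
proof -
  have "((\<lambda>d::int. 1 / (- z + of_int d)\<^sup>2) has_sum (- 4 * (of_real pi)\<^sup>2 * (e2pi (- z) / (1 - e2pi (- z))\<^sup>2))) UNIV"
    using lipschitz_formula_pos[of "- z"] assms by simp
  moreover have "bij_betw uminus (UNIV :: int set) UNIV" by (rule bij_betwI[of _ _ _ uminus]) auto
  ultimately have "((\<lambda>d::int. 1 / (- z + of_int (- d))\<^sup>2) has_sum (- 4 * (of_real pi)\<^sup>2 * (e2pi (- z) / (1 - e2pi (- z))\<^sup>2))) UNIV"
    by (subst has_sum_reindex_bij_betw)
  then show ?thesis by (simp add: power2_eq_square algebra_simps)
qed

section \<open>Lambert series and Eisenstein sums over rows\<close>

definition lambert_sigma :: "complex \<Rightarrow> complex" where
  "lambert_sigma \<tau> = (\<Sum>n. of_nat (Suc n) * e2pi \<tau> ^ Suc n / (1 - e2pi \<tau> ^ Suc n))"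

lemma norm_power_Suc_less_1: "norm (q :: complex) < 1 \<Longrightarrow> norm (q ^ Suc n) < 1"
  by (simp only: norm_power) (simp add: power_less_one_iff del: power_Suc)

lemma power_series_geometric_deriv:
  fixes x :: complex assumes "norm x < 1"
  shows "((\<lambda>n. of_nat (Suc n) * x ^ Suc n) has_sum (x / (1 - x)\<^sup>2)) UNIV"
proof (rule norm_summable_imp_has_sum)
  show "(\<lambda>n. of_nat (Suc n) * x ^ Suc n) sums (x / (1 - x)\<^sup>2)"
    using sums_mult[OF geometric_deriv_sums[OF assms], of x] by (simp add: mult_ac)
  have "summable (\<lambda>n. norm x * (of_nat (Suc n) * norm x ^ n))"
    using geometric_deriv_sums[of "norm x"] assms by (intro summable_mult) (auto intro: sums_summable)
  then show "summable (\<lambda>n. norm (of_nat (Suc n) * x ^ Suc n))"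
    by (simp add: norm_mult norm_power mult_ac del: of_nat_Suc)
qed

lemma geometric_has_sum:
  fixes x :: complex assumes "norm x < 1"
  shows "((\<lambda>n. x ^ Suc n) has_sum (x / (1 - x))) UNIV"
proof (rule norm_summable_imp_has_sum)
  show "(\<lambda>n. x ^ Suc n) sums (x / (1 - x))"
    using sums_mult[OF geometric_sums[OF assms], of x] by simp
  show "summable (\<lambda>n. norm (x ^ Suc n))"
    unfolding norm_power using assms by (subst summable_Suc_iff) simp
qed

text \<open>Both sides are iterated sums of the absolutely convergent double series of n q^(n m)
  over n, m >= 1. Summing over m first gives \<open>lambert_sigma\<close>; summing over n first
  gives x / (1 - x)^2 at x = q^m.\<close>

lemma lambert_double_series:
  assumes "Im \<tau> > 0"
  shows "((\<lambda>m. e2pi \<tau> ^ Suc m / (1 - e2pi \<tau> ^ Suc m)\<^sup>2) has_sum lambert_sigma \<tau>) UNIV"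
proof -
  define q where "q = e2pi \<tau>"
  have q: "norm q < 1" using norm_e2pi_less_1[OF assms] by (simp add: q_def)
  have qn: "norm (q ^ Suc n) < 1" for n using q by (rule norm_power_Suc_less_1)
  define f where "f = (\<lambda>(n, m). of_nat (Suc n) * (q ^ Suc n) ^ Suc m)"
  have inner: "((\<lambda>m. f (n, m)) has_sum of_nat (Suc n) * (q ^ Suc n / (1 - q ^ Suc n))) UNIV" for n
    unfolding f_def prod.case by (rule has_sum_cmult_right[OF geometric_has_sum[OF qn]])
  have abs: "(\<lambda>x. norm (f x)) summable_on (UNIV \<times> UNIV)"
  proof (rule summable_on_SigmaI)
    \<comment> \<open>The row sums of the norms form the same Lambert series at the real point |q|,
      whose convergence is known from the derivative of \<open>log_euler\<close>.\<close>
    have r: "norm (of_real (norm q) :: complex) < 1" using q by simp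
    have eq: "of_real (real (Suc n) * (norm q ^ Suc n / (1 - norm q ^ Suc n)))
        = of_real (norm q) * (of_nat (Suc n) * of_real (norm q) ^ n / (1 - of_real (norm q) ^ Suc n :: complex))" for n
      by simp
    have "summable (\<lambda>n. complex_of_real (real (Suc n) * (norm q ^ Suc n / (1 - norm q ^ Suc n))))"
      unfolding eq by (intro summable_mult log_euler_series(2)[OF r])
    then have s: "summable (\<lambda>n. real (Suc n) * (norm q ^ Suc n / (1 - norm q ^ Suc n)))"
      by (simp only: summable_complex_of_real)
    have lt: "norm q ^ Suc n < 1" for n using qn[of n] by (simp only: norm_power)
    then show "(\<lambda>n. real (Suc n) * (norm q ^ Suc n / (1 - norm q ^ Suc n))) summable_on UNIV"
      by (subst summable_on_UNIV_nonneg_real_iff[OF _]) (use s in \<open>auto simp: less_imp_le simp del: power_Suc\<close>)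
    fix n
    have "((\<lambda>m. (norm q ^ Suc n) ^ Suc m) has_sum (norm q ^ Suc n / (1 - norm q ^ Suc n))) UNIV"
    proof (rule norm_summable_imp_has_sum)
      show "(\<lambda>m. (norm q ^ Suc n) ^ Suc m) sums (norm q ^ Suc n / (1 - norm q ^ Suc n))"
        using sums_mult[OF geometric_sums[of "norm q ^ Suc n"], of "norm q ^ Suc n"] lt[of n] by simp
      show "summable (\<lambda>m. norm ((norm q ^ Suc n) ^ Suc m))"
        unfolding norm_power using lt[of n] by (subst summable_Suc_iff) (simp del: power_Suc)
    qed
    from has_sum_cmult_right[OF this, of "real (Suc n)"]
    show "((\<lambda>m. norm (f (n, m))) has_sum real (Suc n) * (norm q ^ Suc n / (1 - norm q ^ Suc n))) UNIV"
      unfolding f_def prod.case norm_mult norm_power norm_of_nat .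
  qed auto
  then have sm: "f summable_on (UNIV \<times> UNIV)" by (rule abs_summable_summable)
  define S where "S = infsum f (UNIV \<times> UNIV)"
  have S: "(f has_sum S) (UNIV \<times> UNIV)" unfolding S_def using sm by (rule has_sum_infsum)
  have "((\<lambda>n. of_nat (Suc n) * (q ^ Suc n / (1 - q ^ Suc n))) has_sum S) UNIV"
    using has_sum_SigmaD[OF S inner] .
  then have "(\<lambda>n. of_nat (Suc n) * (q ^ Suc n / (1 - q ^ Suc n))) sums S" by (rule has_sum_imp_sums)
  then have "S = lambert_sigma \<tau>" by (simp add: lambert_sigma_def sums_iff q_def)
  moreover have "((\<lambda>(m, n). f (n, m)) has_sum S) (UNIV \<times> UNIV)"
    using S has_sum_swap[of f] by blast
  then have "((\<lambda>m. q ^ Suc m / (1 - q ^ Suc m)\<^sup>2) has_sum S) UNIV"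
  proof (rule has_sum_SigmaD)
    fix m :: nat
    have "(q ^ Suc n) ^ Suc m = (q ^ Suc m) ^ Suc n" for n
      by (simp only: power_mult[symmetric] mult.commute)
    then show "((\<lambda>n. case (m, n) of (m, n) \<Rightarrow> f (n, m)) has_sum q ^ Suc m / (1 - q ^ Suc m)\<^sup>2) UNIV"
      using power_series_geometric_deriv[OF qn, of m] unfolding f_def prod.case by (simp only:)
  qed
  ultimately show ?thesis by (simp add: q_def)
qed

lemma e2pi_of_nat_mult: "e2pi (of_nat n * z) = e2pi z ^ n"
  by (simp add: e2pi_def mult_ac flip: exp_of_nat_mult)

text \<open>Eisenstein's function eps_2; for non-real z it is (\<pi> / sin (\<pi> z))^2.\<close>

definition lattice_eps :: "complex \<Rightarrow> complex" where
  "lattice_eps z = (\<Sum>\<^sub>\<infinity>d::int. 1 / (z + of_int d)\<^sup>2)"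

lemma lattice_eps_has_sum:
  assumes "Im z \<noteq> 0" shows "((\<lambda>d::int. 1 / (z + of_int d)\<^sup>2) has_sum lattice_eps z) UNIV"
  unfolding lattice_eps_def
  using lipschitz_formula_pos[of z] lipschitz_formula_neg[of z] assms
  by (intro has_sum_infsum) (cases "Im z > 0"; auto simp: summable_on_def)

lemma lattice_eps_multiples_has_sum:
  assumes "Im \<tau> > 0"
  shows "((\<lambda>m::int. lattice_eps (of_int m * \<tau>)) has_sum (- 8 * (of_real pi)\<^sup>2 * lambert_sigma \<tau>)) (- {0})"
proof -
  let ?c = "- 4 * (of_real pi)\<^sup>2 :: complex"
  have *: "((\<lambda>n. ?c * (e2pi \<tau> ^ Suc n / (1 - e2pi \<tau> ^ Suc n)\<^sup>2)) has_sum ?c * lambert_sigma \<tau>) UNIV"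
    by (rule has_sum_cmult_right[OF lambert_double_series[OF assms]])
  have p: "lattice_eps (of_int (int (Suc n)) * \<tau>) = ?c * (e2pi \<tau> ^ Suc n / (1 - e2pi \<tau> ^ Suc n)\<^sup>2)" for n
    unfolding lattice_eps_def
    by (rule infsumI) (use lipschitz_formula_pos[of "of_nat (Suc n) * \<tau>"] assms in \<open>simp add: e2pi_of_nat_mult add_pos_nonneg del: power_Suc of_nat_Suc\<close>)
  have m: "lattice_eps (of_int (- int (Suc n)) * \<tau>) = ?c * (e2pi \<tau> ^ Suc n / (1 - e2pi \<tau> ^ Suc n)\<^sup>2)" for n
    unfolding lattice_eps_def
    by (rule infsumI) (use lipschitz_formula_neg[of "- (of_nat (Suc n) * \<tau>)"] assms in \<open>simp add: e2pi_of_nat_mult add_pos_nonneg del: power_Suc of_nat_Suc\<close>)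
  have "((\<lambda>m::int. lattice_eps (of_int m * \<tau>)) has_sum (?c * lambert_sigma \<tau> + ?c * lambert_sigma \<tau>)) (- {0})"
    by (rule has_sum_nonzero_int_split) (unfold p m, rule *, rule *)
  then show ?thesis by (simp add: algebra_simps)
qed

section \<open>The inversion formula for the logarithm of eta\<close>

lemma inverse_squares_nonzero_has_sum:
  "((\<lambda>n::int. 1 / (of_int n)\<^sup>2 :: complex) has_sum ((of_real pi)\<^sup>2 / 3)) (- {0})"
proof -
  have "((\<lambda>n::nat. 1 / (real n + 1)\<^sup>2) has_sum (pi\<^sup>2 / 6)) UNIV"
  proof (rule norm_summable_imp_has_sum)
    show s: "(\<lambda>n::nat. 1 / (real n + 1)\<^sup>2) sums (pi\<^sup>2 / 6)"
      using inverse_squares_sums by (simp add: add.commute)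
    from sums_summable[OF s] show "summable (\<lambda>n::nat. norm (1 / (real n + 1)\<^sup>2))" by simp
  qed
  then have "((\<lambda>n::nat. complex_of_real (1 / (real n + 1)\<^sup>2)) has_sum complex_of_real (pi\<^sup>2 / 6)) UNIV"
    by (rule has_sum_of_real)
  then have *: "((\<lambda>n::nat. 1 / (of_nat n + 1)\<^sup>2 :: complex) has_sum ((of_real pi)\<^sup>2 / 6)) UNIV" by simp
  have "((\<lambda>n::int. 1 / (of_int n)\<^sup>2 :: complex) has_sum ((of_real pi)\<^sup>2 / 6 + (of_real pi)\<^sup>2 / 6)) (- {0})"
  proof (rule has_sum_nonzero_int_split)
    have "(of_int (- int (Suc n)) :: complex)\<^sup>2 = (of_nat n + 1)\<^sup>2" for n by (simp add: power2_eq_square algebra_simps)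
    then show "((\<lambda>n. 1 / (of_int (- int (Suc n)) :: complex)\<^sup>2) has_sum ((of_real pi)\<^sup>2 / 6)) UNIV"
      using * by (simp only:)
    show "((\<lambda>n. 1 / (of_int (int (Suc n)) :: complex)\<^sup>2) has_sum ((of_real pi)\<^sup>2 / 6)) UNIV"
      using * by (simp add: add.commute)
  qed
  then show ?thesis by simp
qed

lemma shift_to_0_sequence:
  fixes z :: complex
  shows "(\<lambda>N. 1 / (z - of_nat N) - 1 / (z + of_nat N)) \<longlonglongrightarrow> 0"
proof -
  have "filterlim (\<lambda>N. (of_nat N :: complex)) at_infinity sequentially" by (rule tendsto_of_nat)
  then have "(\<lambda>N. inverse (z - of_nat N)) \<longlonglongrightarrow> 0" "(\<lambda>N. inverse (z + of_nat N)) \<longlonglongrightarrow> 0"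
    by (auto intro!: filterlim_compose[OF tendsto_inverse_0] tendsto_add_filterlim_at_infinity[OF tendsto_const]
        simp: filterlim_at_infinity_conv_norm_at_top diff_conv_add_uminus simp del: add_uminus_conv_diff)
  from tendsto_diff[OF this] show ?thesis by (simp add: inverse_eq_divide)
qed

lemma sum_telescope_int:
  fixes f :: "int \<Rightarrow> 'a :: ab_group_add"
  shows "(\<Sum>n\<in>{- int N<..int N}. f (n - 1) - f n) = f (- int N) - f (int N)"
proof (induction N)
  case (Suc N)
  have "{- int (Suc N)<..int (Suc N)} = insert (- int N) (insert (int (Suc N)) {- int N<..int N})" by auto
  then have eq: "(\<Sum>n\<in>{- int (Suc N)<..int (Suc N)}. f (n - 1) - f n) 
    = (f (- int N - 1) - f (- int N)) + ((f (int (Suc N) - 1) - f (int (Suc N))) + (\<Sum>n\<in>{- int N<..int N}. f (n - 1) - f n))"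
    by simp
  have e: "- int (Suc N) = - int N - 1" "int (Suc N) - 1 = int N" by auto
  show ?case by (subst eq, subst Suc, subst e(2), subst e(1)) simp
qed simp

text \<open>
  Eisenstein's comparison: subtracting the telescoping terms \<open>1 / ((m\<tau> + n)(m\<tau> + n - 1))\<close> from
  \<open>1 / (m\<tau> + n)\<^sup>2\<close> makes the double series absolutely convergent.
\<close>
definition eisenstein_diff :: "complex \<Rightarrow> int \<Rightarrow> int \<Rightarrow> complex" where
  "eisenstein_diff \<tau> m n = 1 / (of_int m * \<tau> + of_int (n - 1)) - 1 / (of_int m * \<tau> + of_int n) - 1 / (of_int m * \<tau> + of_int n)\<^sup>2"

lemma lattice_point_nonzero: "Im \<tau> > 0 \<Longrightarrow> m \<noteq> 0 \<Longrightarrow> of_int m * \<tau> + of_int n \<noteq> 0"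
  by (auto simp: complex_eq_iff)

text \<open>With u = m \<tau> + n the three fractions combine to 1 / (u^2 (u - 1)), which decays
  cubically, and the exponent 3 exceeds the dimension 2 of the lattice.\<close>

lemma eisenstein_diff_summable:
  assumes "Im \<tau> > 0"
  shows "(\<lambda>(m, n). eisenstein_diff \<tau> m n) summable_on ((- {0}) \<times> UNIV)"
proof -
  obtain \<delta> where \<delta>: "\<delta> > 0" "\<And>\<tau>' (c::int) (d::int). Im \<tau> \<le> Im \<tau>' \<Longrightarrow> \<bar>Re \<tau>'\<bar> \<le> \<bar>Re \<tau>\<bar> \<Longrightarrow> \<delta> * of_int (max \<bar>c\<bar> \<bar>d\<bar>) \<le> norm (of_int c * \<tau>' + of_int d)"
    using lattice_lower_bound[OF assms abs_ge_zero] by blast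
  have "(\<lambda>x. 2 / \<delta> ^ 3 * (case x of (c, d) \<Rightarrow> real_of_int (max \<bar>c\<bar> \<bar>d\<bar>) powr (- 3))) summable_on ((- {0}) \<times> UNIV)"
    by (intro summable_on_cmult_right summable_on_subset[OF summable_on_lattice_powr]) auto
  then have "(\<lambda>x. norm (case x of (m, n) \<Rightarrow> eisenstein_diff \<tau> m n)) summable_on ((- {0}) \<times> UNIV)"
  proof (rule summable_on_comparison_test)
    fix x :: "int \<times> int" assume "x \<in> (- {0}) \<times> UNIV"
    then obtain m n where x: "x = (m, n)" "m \<noteq> 0" by auto
    define M where "M = real_of_int (max \<bar>m\<bar> \<bar>n\<bar>)"
    define u where "u = of_int m * \<tau> + of_int n"
    define v where "v = of_int m * \<tau> + of_int (n - 1)"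
    have nz: "u \<noteq> 0" "v \<noteq> 0" unfolding u_def v_def using assms x by (intro lattice_point_nonzero; simp)+
    have uv: "u = v + 1" by (simp add: u_def v_def)
    have "eisenstein_diff \<tau> m n = 1 / v - 1 / u - 1 / u\<^sup>2" by (simp add: eisenstein_diff_def u_def v_def)
    also have "\<dots> = 1 / (u\<^sup>2 * v)" using nz unfolding uv by (simp add: divide_simps) (simp add: algebra_simps power2_eq_square)
    finally have e: "eisenstein_diff \<tau> m n = 1 / (u\<^sup>2 * v)" .
    have "max \<bar>m\<bar> \<bar>n\<bar> \<ge> 1" using x by linarith
    then have M: "M \<ge> 1" unfolding M_def by linarith
    have 1: "\<delta> * M \<le> norm u" using \<delta>(2)[of \<tau> m n] by (simp add: M_def u_def)
    have "max \<bar>m\<bar> \<bar>n\<bar> \<le> 2 * max \<bar>m\<bar> \<bar>n - 1\<bar>"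
    proof -
      define K where "K = max \<bar>m\<bar> \<bar>n - 1\<bar>"
      have "\<bar>m\<bar> \<le> K" "\<bar>n - 1\<bar> \<le> K" by (simp_all add: K_def)
      then have "\<bar>m\<bar> \<le> 2 * K" "\<bar>n\<bar> \<le> 2 * K" using x(2) by linarith+
      then show ?thesis by (simp add: K_def)
    qed
    then have "M \<le> 2 * real_of_int (max \<bar>m\<bar> \<bar>n - 1\<bar>)" unfolding M_def by linarith
    then have "\<delta> * M / 2 \<le> \<delta> * real_of_int (max \<bar>m\<bar> \<bar>n - 1\<bar>)" 
      using mult_left_mono[of M _ "\<delta> / 2"] \<delta>(1) by fastforce
    also have "\<dots> \<le> norm v" using \<delta>(2)[of \<tau> m "n - 1"] by (simp add: v_def)
    finally have 2: "\<delta> * M / 2 \<le> norm v" .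
    have pos: "\<delta> * M > 0" using \<delta>(1) M by simp
    have "(\<delta> * M)\<^sup>2 * (\<delta> * M / 2) \<le> (norm u)\<^sup>2 * norm v"
      using 1 2 pos by (intro mult_mono power_mono) auto
    then have "1 / ((norm u)\<^sup>2 * norm v) \<le> 1 / ((\<delta> * M)\<^sup>2 * (\<delta> * M / 2))"
      using pos nz by (intro divide_left_mono mult_pos_pos) auto
    also have "\<dots> = 2 / \<delta> ^ 3 * M powr (- 3)"
      using M by (simp add: powr_minus powr_numeral field_simps power2_eq_square power3_eq_cube)
    finally show "norm (case x of (m, n) \<Rightarrow> eisenstein_diff \<tau> m n)
        \<le> 2 / \<delta> ^ 3 * (case x of (c, d) \<Rightarrow> real_of_int (max \<bar>c\<bar> \<bar>d\<bar>) powr (- 3))"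
      by (simp add: x e norm_divide norm_mult norm_power M_def)
  qed auto
  then show ?thesis by (rule abs_summable_summable)
qed

text \<open>The telescoping part of a row contributes the limit of 1 / (m \<tau> - N) - 1 / (m
  \<tau> + N), which is 0.\<close>

lemma eisenstein_diff_sum_n:
  assumes "Im \<tau> > 0" "m \<noteq> 0"
  shows "((\<lambda>n. eisenstein_diff \<tau> m n) has_sum (- lattice_eps (of_int m * \<tau>))) UNIV"
proof -
  have im: "Im (of_int m * \<tau>) \<noteq> 0" using assms by simp
  have "(\<lambda>n. eisenstein_diff \<tau> m n) summable_on UNIV"
    using summable_on_SigmaD1[OF eisenstein_diff_summable[OF assms(1)], of m] assms(2) by simp
  then obtain S where S: "((\<lambda>n. eisenstein_diff \<tau> m n) has_sum S) UNIV" by (auto simp: summable_on_def)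
  let ?u = "\<lambda>n::int. 1 / (of_int m * \<tau> + of_int n)"
  have "((\<lambda>n. ?u (n - 1) - ?u n) has_sum (S + lattice_eps (of_int m * \<tau>))) UNIV"
    using has_sum_add[OF S lattice_eps_has_sum[OF im]] by (simp add: eisenstein_diff_def)
  from has_sum_int_imp_LIMSEQ[OF this]
  have "(\<lambda>N. ?u (- int N) - ?u (int N)) \<longlonglongrightarrow> S + lattice_eps (of_int m * \<tau>)"
    by (simp only: sum_telescope_int[of ?u])
  moreover have "(\<lambda>N. ?u (- int N) - ?u (int N)) \<longlonglongrightarrow> 0"
    using shift_to_0_sequence[of "of_int m * \<tau>"] by simp
  ultimately have "S + lattice_eps (of_int m * \<tau>) = 0" by (rule LIMSEQ_unique)
  then have "S = - lattice_eps (of_int m * \<tau>)" by (simp add: eq_neg_iff_add_eq_0)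
  with S show ?thesis by simp
qed

text \<open>Factoring out \<tau>^2 turns the full column into \<open>lattice_eps\<close> at n /
  \<tau>, from which the term m = 0 has to be removed; for n = 0 the value is 2 zeta(2) /
  \<tau>^2.\<close>

lemma column_squares_has_sum:
  assumes "Im \<tau> > 0"
  shows "((\<lambda>m::int. 1 / (of_int m * \<tau> + of_int n)\<^sup>2) has_sum
     (if n = 0 then (of_real pi)\<^sup>2 / 3 / \<tau>\<^sup>2 else lattice_eps (of_int n / \<tau>) / \<tau>\<^sup>2 - 1 / (of_int n)\<^sup>2)) (- {0})"
proof (cases "n = 0")
  case True
  have "((\<lambda>m::int. 1 / (of_int m)\<^sup>2 * (1 / \<tau>\<^sup>2)) has_sum ((of_real pi)\<^sup>2 / 3 * (1 / \<tau>\<^sup>2))) (- {0})"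
    by (rule has_sum_cmult_left[OF inverse_squares_nonzero_has_sum])
  then show ?thesis using True by (simp add: power_mult_distrib)
next
  case False
  have tau: "\<tau> \<noteq> 0" using assms by auto
  have im: "Im (of_int n / \<tau>) \<noteq> 0" using assms False tau by (auto simp: Im_divide complex_eq_iff sum_power2_eq_zero_iff)
  have "((\<lambda>m::int. 1 / (of_int m * \<tau> + of_int n)\<^sup>2) has_sum lattice_eps (of_int n / \<tau>) / \<tau>\<^sup>2) UNIV"
  proof -
    have "1 / (of_int n / \<tau> + of_int m)\<^sup>2 * (1 / \<tau>\<^sup>2) = 1 / (of_int m * \<tau> + of_int n)\<^sup>2" for m
    proof -
      have "of_int n / \<tau> + of_int m = (of_int m * \<tau> + of_int n) / \<tau>" using tau by (simp add: field_simps)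
      then show ?thesis using tau by (simp add: power_divide)
    qed
    then show ?thesis
      using has_sum_cmult_left[OF lattice_eps_has_sum[OF im], of "1 / \<tau>\<^sup>2"] by simp
  qed
  moreover have "((\<lambda>m::int. 1 / (of_int m * \<tau> + of_int n)\<^sup>2) has_sum 1 / (of_int n)\<^sup>2) {0}"
    by (rule has_sum_finiteI) auto
  ultimately have "((\<lambda>m::int. 1 / (of_int m * \<tau> + of_int n)\<^sup>2) has_sum
      (lattice_eps (of_int n / \<tau>) / \<tau>\<^sup>2 - 1 / (of_int n)\<^sup>2)) (UNIV - {0})"
    by (rule has_sum_Diff) simp
  then show ?thesis using False by (simp add: Compl_eq_Diff_UNIV)
qed

lemma cot_conv_e2pi:
  assumes "Im w < 0" shows "cot (of_real pi * w) = \<i> * (1 + e2pi (- w)) / (1 - e2pi (- w))"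
proof -
  define x where "x = exp (- (\<i> * (of_real pi * w)))"
  have x: "x \<noteq> 0" by (simp add: x_def)
  have e: "exp (\<i> * (of_real pi * w)) = 1 / x" by (simp add: x_def exp_minus field_simps)
  have q: "e2pi (- w) = x\<^sup>2"
    by (simp add: e2pi_def x_def mult_ac flip: exp_of_nat_mult exp_double)
  have "1 - x\<^sup>2 \<noteq> 0" using one_minus_e2pi_nonzero[of "- w"] assms q by simp
  then show ?thesis
    unfolding cot_def sin_exp_eq cos_exp_eq e q x_def[symmetric] using x
    by (simp add: field_simps power2_eq_square)
qed

text \<open>Partial fractions of the cotangent at w = N / \<tau>, obtained from the Digamma series
  at 1 + w and 1 - w; m and -m contribute equally. These are the boundary terms that the telescoping
  windows in n leave behind when the columns are summed over m.\<close>

lemma row_difference_has_sum: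
  assumes "Im \<tau> > 0" "N > 0"
  shows "((\<lambda>m::int. 1 / (of_int m * \<tau> - of_nat N) - 1 / (of_int m * \<tau> + of_nat N)) has_sum
     (2 / \<tau> * (\<tau> / of_nat N - of_real pi * cot (of_real pi * (of_nat N / \<tau>))))) (- {0})"
proof -
  have tau: "\<tau> \<noteq> 0" using assms by auto
  define w where "w = of_nat N / \<tau>"
  have w: "Im w \<noteq> 0" unfolding w_def using assms tau by (auto simp: Im_divide complex_eq_iff sum_power2_eq_zero_iff)
  have wi: "w \<notin> \<int>" using w by (rule Im_pos_notin_Ints)
  have nz: "1 + w \<noteq> 0" "1 - w \<noteq> 0" "w \<noteq> 0" using w by (auto simp: complex_eq_iff)
  let ?f = "\<lambda>k::nat. 1 / (of_nat (Suc k) - w) - 1 / (of_nat (Suc k) + w)"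
  have Dg: "(\<lambda>k. inverse (of_nat (Suc k)) - inverse (z + of_nat k)) sums (Digamma z + euler_mascheroni)" if "z \<noteq> 0" for z :: complex
    using summable_sums[OF summable_Digamma[OF that]] by (simp add: Digamma_def)
  have sums: "?f sums (1 / w - of_real pi * cot (of_real pi * w))"
  proof -
    have "(\<lambda>k. (inverse (of_nat (Suc k)) - inverse ((1 + w) + of_nat k)) - (inverse (of_nat (Suc k)) - inverse ((1 - w) + of_nat k)))
        sums ((Digamma (1 + w) + euler_mascheroni) - (Digamma (1 - w) + euler_mascheroni))"
      by (rule sums_diff[OF Dg[OF nz(1)] Dg[OF nz(2)]])
    also have "(\<lambda>k. (inverse (of_nat (Suc k)) - inverse ((1 + w) + of_nat k)) - (inverse (of_nat (Suc k)) - inverse ((1 - w) + of_nat k))) = ?f"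
      by (simp add: fun_eq_iff inverse_eq_divide algebra_simps)
    also have "(Digamma (1 + w) + euler_mascheroni) - (Digamma (1 - w) + euler_mascheroni) = 1 / w - of_real pi * cot (of_real pi * w)"
      using Digamma_reflection[OF wi] Digamma_plus1[OF nz(3)] by (simp add: algebra_simps)
    finally show ?thesis .
  qed
  have wnz: "of_nat (Suc k) - w \<noteq> 0" "of_nat (Suc k) + w \<noteq> 0" for k using w by (auto simp: complex_eq_iff)
  have "summable (\<lambda>k. norm (?f k))"
  proof -
    have 1: "summable (\<lambda>k. (norm (1 / (w + of_nat k)\<^sup>2) + norm (1 / (- w + of_nat k)\<^sup>2)))"
      using w by (intro summable_add summable_norm_inverse_squares) auto
    have 2: "summable (\<lambda>k. norm w * (norm (1 / (w + of_nat (Suc k))\<^sup>2) + norm (1 / (- w + of_nat (Suc k))\<^sup>2)))"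
      by (intro summable_mult) (use 1 in \<open>subst summable_Suc_iff[of "\<lambda>k. norm (1 / (w + of_nat k)\<^sup>2) + norm (1 / (- w + of_nat k)\<^sup>2)"]\<close>)
    then show ?thesis
    proof (rule summable_comparison_test'[of _ 0])
      fix k :: nat
      \<comment> \<open>The inequality 2 / (a b) <= 1 / a^2 + 1 / b^2 reduces the differences to
        inverse squares.\<close>
      define a b where ab: "a = norm (of_nat (Suc k) - w)" "b = norm (of_nat (Suc k) + w)"
      have pos: "a > 0" "b > 0" using wnz by (auto simp: ab simp del: of_nat_Suc)
      have "?f k = 2 * w / ((of_nat (Suc k) - w) * (of_nat (Suc k) + w))"
        using wnz[of k] by (simp add: divide_simps del: of_nat_Suc)
      then have "norm (?f k) = 2 * norm w / (a * b)" by (simp add: norm_divide norm_mult ab del: of_nat_Suc)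
      also have "\<dots> = norm w * (2 * (1 / a) * (1 / b))" using pos by simp
      also have "\<dots> \<le> norm w * ((1 / a)\<^sup>2 + (1 / b)\<^sup>2)"
        by (intro mult_left_mono sum_squares_bound norm_ge_zero)
      also have "\<dots> = norm w * (norm (1 / (w + of_nat (Suc k))\<^sup>2) + norm (1 / (- w + of_nat (Suc k))\<^sup>2))"
        by (simp add: ab norm_divide norm_power power_divide add.commute del: of_nat_Suc)
      finally show "norm (norm (?f k)) \<le> norm w * (norm (1 / (w + of_nat (Suc k))\<^sup>2) + norm (1 / (- w + of_nat (Suc k))\<^sup>2))"
        by simp
    qed
  qed
  from has_sum_cmult_left[OF norm_summable_imp_has_sum[OF this sums], of "1 / \<tau>"]
  have *: "((\<lambda>k. ?f k * (1 / \<tau>)) has_sum ((1 / w - of_real pi * cot (of_real pi * w)) * (1 / \<tau>))) UNIV" .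
  have f: "?f k * (1 / \<tau>) = 1 / (of_nat (Suc k) * \<tau> - of_nat N) - 1 / (of_nat (Suc k) * \<tau> + of_nat N)" for k
  proof -
    have eqs: "1 / (of_nat (Suc k) - w) * (1 / \<tau>) = 1 / (of_nat (Suc k) * \<tau> - of_nat N)"
      "1 / (of_nat (Suc k) + w) * (1 / \<tau>) = 1 / (of_nat (Suc k) * \<tau> + of_nat N)"
      unfolding w_def using tau by (simp_all add: field_simps del: of_nat_Suc)
    show ?thesis unfolding left_diff_distrib[of _ _ "1 / \<tau>"] eqs ..
  qed
  have "((\<lambda>m::int. 1 / (of_int m * \<tau> - of_nat N) - 1 / (of_int m * \<tau> + of_nat N)) has_sum
     ((1 / w - of_real pi * cot (of_real pi * w)) * (1 / \<tau>) + (1 / w - of_real pi * cot (of_real pi * w)) * (1 / \<tau>))) (- {0})"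
  proof (rule has_sum_nonzero_int_split)
    show "((\<lambda>n. 1 / (of_int (int (Suc n)) * \<tau> - of_nat N) - 1 / (of_int (int (Suc n)) * \<tau> + of_nat N)) has_sum
      ((1 / w - of_real pi * cot (of_real pi * w)) * (1 / \<tau>))) UNIV"
      using * unfolding f by (simp del: of_nat_Suc)
    have "1 / (of_int (- int (Suc k)) * \<tau> - of_nat N) - 1 / (of_int (- int (Suc k)) * \<tau> + of_nat N) = 
      1 / (of_nat (Suc k) * \<tau> - of_nat N) - 1 / (of_nat (Suc k) * \<tau> + of_nat N)" for k
    proof -
      have "of_int (- int (Suc k)) * \<tau> - of_nat N = - (of_nat (Suc k) * \<tau> + of_nat N)"
        "of_int (- int (Suc k)) * \<tau> + of_nat N = - (of_nat (Suc k) * \<tau> - of_nat N)" by (simp_all add: algebra_simps)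
      then show ?thesis by (simp only: minus_divide_right[symmetric] minus_divide_left) simp
    qed
    then show "((\<lambda>n. 1 / (of_int (- int (Suc n)) * \<tau> - of_nat N) - 1 / (of_int (- int (Suc n)) * \<tau> + of_nat N)) has_sum
      ((1 / w - of_real pi * cot (of_real pi * w)) * (1 / \<tau>))) UNIV"
      using * unfolding f by (simp only:)
  qed
  then show ?thesis using tau by (simp add: w_def algebra_simps)
qed

lemma has_sum_finite_sum:
  fixes f :: "'a \<Rightarrow> 'b \<Rightarrow> 'c :: topological_comm_monoid_add"
  assumes "finite I" "\<And>i. i \<in> I \<Longrightarrow> (f i has_sum S i) A"
  shows "((\<lambda>x. \<Sum>i\<in>I. f i x) has_sum (\<Sum>i\<in>I. S i)) A"
  using assms by (induction I rule: finite_induct) (auto intro: has_sum_add)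

lemma has_sum_minus:
  fixes f g :: "'a \<Rightarrow> 'b :: topological_ab_group_add"
  assumes "(f has_sum a) A" "(g has_sum b) A"
  shows "((\<lambda>x. f x - g x) has_sum (a - b)) A"
  using has_sum_add[OF assms(1) has_sum_uminus[THEN iffD2], of g "- b"] assms(2) by simp

lemma Im_minus_inverse_pos: "Im \<tau> > 0 \<Longrightarrow> Im (- 1 / \<tau>) > 0"
  by (auto simp: Im_divide intro!: divide_pos_pos add_nonneg_pos)

text \<open>In terms of E_2 = 1 - 24 \<open>lambert_sigma\<close> this is E_2(-1/\<tau>) = \<tau>^2
  E_2(\<tau>) - 6 i \<tau> / \<pi>. Summing \<open>eisenstein_diff\<close> by rows or by columns
  gives the same S. Adding the column sums of 1 / (m \<tau> + n)^2 leaves pure differences, which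
  telescope in n; their boundary terms do not vanish when m is summed first, and this is the defect
  of modularity.\<close>

lemma lambert_sigma_S:
  assumes t: "Im \<tau> > 0"
  shows "8 * (of_real pi)\<^sup>2 * lambert_sigma \<tau> + ((of_real pi)\<^sup>2 / 3 - 8 * (of_real pi)\<^sup>2 * lambert_sigma (- 1 / \<tau>)) / \<tau>\<^sup>2
     - (of_real pi)\<^sup>2 / 3 = - 2 * of_real pi * \<i> / \<tau>"
proof -
  have tau: "\<tau> \<noteq> 0" using t by auto
  let ?T = "- {0 :: int}"
  let ?f = "\<lambda>(m, n). eisenstein_diff \<tau> m n"
  have sm: "?f summable_on (?T \<times> UNIV)" by (rule eisenstein_diff_summable[OF t])
  then obtain S where S: "(?f has_sum S) (?T \<times> UNIV)" by (auto simp: summable_on_def)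
  have "((\<lambda>m. - lattice_eps (of_int m * \<tau>)) has_sum S) ?T"
    by (rule has_sum_SigmaD[OF S]) (use eisenstein_diff_sum_n[OF t] in auto)
  moreover have "((\<lambda>m. - lattice_eps (of_int m * \<tau>)) has_sum - (- 8 * (of_real pi)\<^sup>2 * lambert_sigma \<tau>)) ?T"
    by (subst has_sum_uminus, simp, rule lattice_eps_multiples_has_sum[OF t, simplified])
  ultimately have Sval: "S = 8 * (of_real pi)\<^sup>2 * lambert_sigma \<tau>"
    using has_sum_unique by fastforce
  have S': "((\<lambda>(n, m). eisenstein_diff \<tau> m n) has_sum S) (UNIV \<times> ?T)"
    using S[unfolded has_sum_swap[of ?f]] by simp
  have "(\<lambda>m. eisenstein_diff \<tau> m n) summable_on ?T" for n
    using summable_on_SigmaD1[of "\<lambda>n m. eisenstein_diff \<tau> m n" UNIV "\<lambda>_. ?T" n] S' by (auto simp: summable_on_def)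
  then have "\<exists>D. \<forall>n. ((\<lambda>m. eisenstein_diff \<tau> m n) has_sum D n) ?T"
    unfolding summable_on_def by metis
  then obtain D where D: "\<And>n. ((\<lambda>m. eisenstein_diff \<tau> m n) has_sum D n) ?T" by blast
  have Dsum: "(D has_sum S) UNIV"
    by (rule has_sum_SigmaD[OF S']) (use D in auto)
  define C where "C n = (if n = 0 then (of_real pi)\<^sup>2 / 3 / \<tau>\<^sup>2 else lattice_eps (of_int n / \<tau>) / \<tau>\<^sup>2 - 1 / (of_int n)\<^sup>2)" for n :: int
  have C: "((\<lambda>m::int. 1 / (of_int m * \<tau> + of_int n)\<^sup>2) has_sum C n) ?T" for n
    unfolding C_def by (rule column_squares_has_sum[OF t])
  \<comment> \<open>The total of all columns: \<open>lattice_eps\<close> at the points n / \<tau>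
    together with the column n = 0, less the entries with m = 0, which add up to \<pi>^2 / 3 over n
    \<noteq> 0.\<close>
  define W where "W = ((of_real pi)\<^sup>2 / 3 - 8 * (of_real pi)\<^sup>2 * lambert_sigma (- 1 / \<tau>)) / \<tau>\<^sup>2 - (of_real pi)\<^sup>2 / 3"
  have Csum: "(C has_sum W) UNIV"
  proof -
    have bij: "bij_betw uminus ?T ?T" by (rule bij_betwI[of _ _ _ uminus]) auto
    have "((\<lambda>m. lattice_eps (of_int (- m) * (- 1 / \<tau>))) has_sum (- 8 * (of_real pi)\<^sup>2 * lambert_sigma (- 1 / \<tau>))) ?T"
      using lattice_eps_multiples_has_sum[OF Im_minus_inverse_pos[OF t]]
      by (subst has_sum_reindex_bij_betw[OF bij, of "\<lambda>m. lattice_eps (of_int m * (- 1 / \<tau>))"])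
    then have "((\<lambda>m. lattice_eps (of_int m / \<tau>)) has_sum (- 8 * (of_real pi)\<^sup>2 * lambert_sigma (- 1 / \<tau>))) ?T" by simp
    from has_sum_minus[OF has_sum_cmult_left[OF this, of "1 / \<tau>\<^sup>2"] inverse_squares_nonzero_has_sum]
    have "((\<lambda>n. lattice_eps (of_int n / \<tau>) * (1 / \<tau>\<^sup>2) - 1 / (of_int n)\<^sup>2) has_sum (W - C 0)) ?T"
      by (simp add: W_def C_def diff_divide_distrib)
    then have "(C has_sum (W - C 0)) ?T"
      by (rule has_sum_cong[THEN iffD1, rotated]) (auto simp: C_def)
    moreover have "(C has_sum C 0) {0}" by (rule has_sum_finiteI) auto
    ultimately have "(C has_sum (W - C 0 + C 0)) (?T \<union> {0})" by (intro has_sum_Un_disjoint) auto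
    moreover have "?T \<union> {0} = UNIV" by auto
    ultimately show ?thesis by simp
  qed
  let ?u = "\<lambda>m n. 1 / (of_int m * \<tau> + of_int n)"
  have B: "((\<lambda>m. ?u m (n - 1) - ?u m n) has_sum (D n + C n)) ?T" for n
    using has_sum_add[OF D C, of n n] by (simp add: eisenstein_diff_def)
  have "(\<lambda>N. \<Sum>n\<in>{- int N<..int N}. D n + C n) \<longlonglongrightarrow> S + W"
    by (rule has_sum_int_imp_LIMSEQ[OF has_sum_add[OF Dsum Csum]])
  moreover have "(\<Sum>n\<in>{- int N<..int N}. D n + C n) = 2 / \<tau> * (\<tau> / of_nat N - of_real pi * cot (of_real pi * (of_nat N / \<tau>)))"
    if "N > 0" for N
  proof -
    have "((\<lambda>m. \<Sum>n\<in>{- int N<..int N}. ?u m (n - 1) - ?u m n) has_sum (\<Sum>n\<in>{- int N<..int N}. D n + C n)) ?T"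
      by (rule has_sum_finite_sum) (use B in auto)
    then have "((\<lambda>m. ?u m (- int N) - ?u m (int N)) has_sum (\<Sum>n\<in>{- int N<..int N}. D n + C n)) ?T"
      by (simp only: sum_telescope_int[of "?u _"])
    then have "((\<lambda>m. 1 / (of_int m * \<tau> - of_nat N) - 1 / (of_int m * \<tau> + of_nat N)) has_sum (\<Sum>n\<in>{- int N<..int N}. D n + C n)) ?T"
      by simp
    then show ?thesis using row_difference_has_sum[OF t that] has_sum_unique by blast
  qed
  \<comment> \<open>N / \<tau> moves to infinity in the lower half-plane, where the cotangent tends
    to i; with p = e(-1/\<tau>) it depends on N through p^N only.\<close>
  moreover have "(\<lambda>N. 2 / \<tau> * (\<tau> / of_nat N - of_real pi * cot (of_real pi * (of_nat N / \<tau>)))) \<longlonglongrightarrow> 2 / \<tau> * (0 - of_real pi * (\<i> * (1 + 0) / (1 - 0)))"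
  proof -
    define p where "p = e2pi (- 1 / \<tau>)"
    have p: "norm p < 1" unfolding p_def by (rule norm_e2pi_less_1[OF Im_minus_inverse_pos[OF t]])
    have "(\<lambda>N. \<i> * (1 + p ^ N) / (1 - p ^ N)) \<longlonglongrightarrow> \<i> * (1 + 0) / (1 - 0)"
      by (intro tendsto_intros LIMSEQ_power_zero p) auto
    moreover have "\<forall>\<^sub>F N in sequentially. \<i> * (1 + p ^ N) / (1 - p ^ N) = cot (of_real pi * (of_nat N / \<tau>))"
      using eventually_gt_at_top[of 0]
    proof eventually_elim
      case (elim N)
      have e: "- (of_nat N / \<tau>) = of_nat N * (- 1 / \<tau>)" by simp
      have "Im (- (of_nat N / \<tau>)) > 0"
      proof -
        have "Im (of_nat N * (- 1 / \<tau>)) = real N * Im (- 1 / \<tau>)"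
          by (simp only: times_complex.sel complex_Re_of_nat complex_Im_of_nat)
        then show ?thesis unfolding e using Im_minus_inverse_pos[OF t] elim by (simp only: mult_pos_pos of_nat_0_less_iff)
      qed
      then have "Im (of_nat N / \<tau>) < 0" by simp
      from cot_conv_e2pi[OF this] show ?case unfolding e e2pi_of_nat_mult p_def by simp
    qed
    ultimately have "(\<lambda>N. cot (of_real pi * (of_nat N / \<tau>))) \<longlonglongrightarrow> \<i> * (1 + 0) / (1 - 0)"
      by (rule Lim_transform_eventually)
    moreover have "(\<lambda>N. \<tau> / of_nat N) \<longlonglongrightarrow> 0"
      by (rule tendsto_divide_0[OF tendsto_const tendsto_of_nat])
    ultimately show ?thesis by (intro tendsto_intros)
  qed
  ultimately have "S + W = 2 / \<tau> * (0 - of_real pi * (\<i> * (1 + 0) / (1 - 0)))"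
    by (intro LIMSEQ_unique[OF _ Lim_transform_eventually])
       (auto intro!: eventually_mono[OF eventually_gt_at_top[of 0]])
  then show ?thesis unfolding Sval W_def by (simp add: algebra_simps)
qed

text \<open>Both sides have the same derivative by the transformation of E_2, whose defect
  integrates to the logarithm. The constant is found at \<tau> = i, which inversion fixes and where
  \<open>- \<i> * \<tau>\<close> is 1.\<close>

theorem log_eta_S:
  assumes "Im \<tau> > 0"
  shows "log_eta (- 1 / \<tau>) = log_eta \<tau> + Ln (- \<i> * \<tau>) / 2"
proof -
  define F where "F \<tau> = log_eta (- 1 / \<tau>) - log_eta \<tau> - Ln (- \<i> * \<tau>) / 2" for \<tau>
  have "(F has_field_derivative 0) (at z within upper_half)" if "z \<in> upper_half" for z
  proof -
    have z: "Im z > 0" "z \<noteq> 0" using that by auto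
    have ln: "- \<i> * z \<notin> \<real>\<^sub>\<le>\<^sub>0" using z by (auto simp: complex_nonpos_Reals_iff)
    let ?d = "\<lambda>z. of_real pi * \<i> / 12 - 2 * of_real pi * \<i> * lambert_sigma z"
    have d: "(log_eta has_field_derivative ?d z) (at z)" if "Im z > 0" for z
      using log_eta_has_field_derivative[OF that] by (simp add: lambert_sigma_def)
    have inv: "((\<lambda>z. - 1 / z) has_field_derivative 1 / z\<^sup>2) (at z)"
      using z by (auto intro!: derivative_eq_intros simp: power2_eq_square)
    have ln': "((\<lambda>z. Ln (- \<i> * z)) has_field_derivative 1 / z) (at z)"
      using ln z by (auto intro!: derivative_eq_intros simp: field_simps)
    have "(F has_field_derivative (?d (- 1 / z) * (1 / z\<^sup>2) - ?d z - 1 / z / 2)) (at z)"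
      unfolding F_def
      by (intro DERIV_diff DERIV_cdivide ln' d z(1) DERIV_chain2[OF d inv] Im_minus_inverse_pos)
    also have "?d (- 1 / z) * (1 / z\<^sup>2) - ?d z - 1 / z / 2 = 
        \<i> / (4 * of_real pi) * (8 * (of_real pi)\<^sup>2 * lambert_sigma z + ((of_real pi)\<^sup>2 / 3 - 8 * (of_real pi)\<^sup>2 * lambert_sigma (- 1 / z)) / z\<^sup>2
         - (of_real pi)\<^sup>2 / 3) - 1 / z / 2"
      using z by (simp add: field_simps power2_eq_square)
    also have "\<dots> = 0"
      unfolding lambert_sigma_S[OF z(1)] using z by (simp add: field_simps)
    finally show ?thesis by (auto intro: has_field_derivative_at_within)
  qed
  then obtain c where c: "\<And>z. z \<in> upper_half \<Longrightarrow> F z = c"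
    using has_field_derivative_zero_constant[OF convex_halfspace_Im_gt] by blast
  have "F \<i> = 0" by (simp add: F_def)
  with c[of \<i>] c[of \<tau>] assms have "F \<tau> = 0" by simp
  then show ?thesis by (simp add: F_def algebra_simps)
qed

section \<open>Modular transformations\<close>

lemma Ln_times_Re_pos:
  assumes "Re x > 0" "Re y > 0" shows "Ln (x * y) = Ln x + Ln y"
  using Re_Ln_pos_lt_imp[OF assms(1)] Re_Ln_pos_lt_imp[OF assms(2)] assms
  by (intro Ln_times_simple) auto

lemma Im_moebius:
  assumes "a * d - b * c = (1 :: int)" "Im z > 0"
  shows "Im ((of_int a * z + of_int b) / (of_int c * z + of_int d)) = Im z / (norm (of_int c * z + of_int d))\<^sup>2"
proof -
  have "Im ((of_int a * z + of_int b) / (of_int c * z + of_int d)) = 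
    (of_int a * of_int d - of_int b * of_int c) * Im z / (norm (of_int c * z + of_int d))\<^sup>2"
    unfolding Im_divide cmod_power2 by (simp add: algebra_simps)
  also have "(of_int a * of_int d - of_int b * of_int c :: real) = of_int (a * d - b * c)" by simp
  finally show ?thesis using assms by simp
qed

lemma moebius_denom_nonzero:
  assumes "a * d - b * c = (1 :: int)" "Im z > 0"
  shows "of_int c * z + of_int d \<noteq> 0"
proof
  assume "of_int c * z + of_int d = 0"
  then have "real_of_int c * Im z = 0" "real_of_int c * Re z + real_of_int d = 0" by (auto simp: complex_eq_iff)
  with assms(2) have "c = 0" "d = 0" by auto
  with assms(1) show False by simp
qed

lemma Im_moebius_pos:
  assumes "a * d - b * c = (1 :: int)" "Im z > 0"
  shows "Im ((of_int a * z + of_int b) / (of_int c * z + of_int d)) > 0"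
  using moebius_denom_nonzero[OF assms] assms(2) by (simp add: Im_moebius[OF assms])

text \<open>Shifting z by d div c replaces d by its residue d0; inverting then exchanges the roles
  of c and d0, so the lower left entry drops to d0 < c. The factor -i keeps the automorphy factors
  in the right half-plane, where the logarithms of two factors add without a correction by 2 \<pi>
  i.\<close>

lemma log_eta_transform_aux:
  fixes a b c d :: int
  assumes "c > 0" "a * d - b * c = 1" "Im z > 0"
  shows "log_eta ((of_int a * z + of_int b) / (of_int c * z + of_int d)) =
     log_eta z + Ln (- \<i> * (of_int c * z + of_int d)) / 2
      + of_real pi * \<i> * of_real ((a + d) / (12 * c) - dedekind_sum d c)"
  using assms
proof (induction "nat c" arbitrary: a b c d z rule: less_induct)
  case less
  note c = less.prems(1) and det = less.prems(2) and z = less.prems(3)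
  define j where "j = d div c"
  define d0 where "d0 = d mod c"
  define b0 where "b0 = b - j * a"
  define w where "w = z + of_int j"
  have d: "d = d0 + j * c" by (simp add: d0_def j_def)
  have d0: "0 \<le> d0" "d0 < c" using c by (auto simp: d0_def)
  have det0: "a * d0 - b0 * c = 1" using det unfolding b0_def d by (simp add: algebra_simps)
  have w: "Im w > 0" "w \<noteq> 0" using z by (auto simp: w_def complex_eq_iff)
  have num: "of_int a * z + of_int b = of_int a * w + of_int b0" by (simp add: w_def b0_def algebra_simps)
  have den: "of_int c * z + of_int d = of_int c * w + of_int d0" by (simp add: w_def d algebra_simps)
  have main: "log_eta ((of_int a * w + of_int b0) / (of_int c * w + of_int d0)) =
     log_eta w + Ln (- \<i> * (of_int c * w + of_int d0)) / 2
      + of_real pi * \<i> * of_real ((a + d0) / (12 * c) - dedekind_sum d0 c)"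
  proof (cases "d0 = 0")
    case True
    then have "c * (- b0) = 1" using det0 by (simp add: algebra_simps)
    then have cb: "c = 1" "b0 = - 1" using c pos_zmult_eq_1_iff[of c "- b0"] by auto
    have "(of_int a * w + of_int b0) / (of_int c * w + of_int d0) = - 1 / w + of_int a"
      using w True by (simp add: cb field_simps)
    then show ?thesis
      using log_eta_add_int[OF Im_minus_inverse_pos[OF w(1)], of a] log_eta_S[OF w(1)] True
      by (simp add: cb dedekind_sum_def)
  next
    case False
    with d0 have d0': "d0 > 0" by simp
    define v where "v = - 1 / w"
    have v: "Im v > 0" unfolding v_def by (rule Im_minus_inverse_pos[OF w(1)])
    have "nat d0 < nat c" using d0 by simp
    \<comment> \<open>Substituting w = -1 / v gives the matrix with rows (b0, -a) and (d0,
      -c).\<close>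
    have "b0 * (- c) - (- a) * d0 = 1" using det0 by simp
    from less.hyps[OF \<open>nat d0 < nat c\<close> d0' this v]
    have IH: "log_eta ((of_int b0 * v + of_int (- a)) / (of_int d0 * v + of_int (- c))) =
       log_eta v + Ln (- \<i> * (of_int d0 * v + of_int (- c))) / 2 +
       of_real pi * \<i> * of_real ((b0 + - c) / (12 * d0) - dedekind_sum (- c) d0)" by simp
    have vw: "(of_int b0 * v + of_int (- a)) = - (of_int a * w + of_int b0) / w"
      "(of_int d0 * v + of_int (- c)) = - (of_int c * w + of_int d0) / w"
      using w by (simp_all add: v_def field_simps)
    have frac: "(of_int b0 * v + of_int (- a)) / (of_int d0 * v + of_int (- c)) =
      (of_int a * w + of_int b0) / (of_int c * w + of_int d0)"
    proof -
      have "- X / w / (- Y / w) = X / Y" for X Y using w by simp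
      then show ?thesis unfolding vw .
    qed
    define u where "u = of_int c * w + of_int d0"
    have u: "Im u > 0" "u \<noteq> 0" using c w by (auto simp: u_def complex_eq_iff)
    have "Ln (- \<i> * w) + Ln (- \<i> * (of_int d0 * v + of_int (- c))) = Ln ((- \<i> * w) * (- \<i> * (of_int d0 * v + of_int (- c))))"
      by (rule Ln_times_Re_pos[symmetric]) (use w v d0' in auto)
    also have "(- \<i> * w) * (- \<i> * (of_int d0 * v + of_int (- c))) = \<i> * (- \<i> * u)"
      unfolding vw u_def using w by (simp add: field_simps)
    also have "Ln \<dots> = Ln (- \<i> * u) + \<i> * of_real pi / 2"
      using u by (subst Ln_times_ii) auto
    finally have Lns: "Ln (- \<i> * w) + Ln (- \<i> * (of_int d0 * v + of_int (- c))) = Ln (- \<i> * u) + \<i> * of_real pi / 2" .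
    have "coprime c d0" using det0 by (intro coprimeI) (metis dvd_diff dvd_mult dvd_mult2 mult.commute)
    \<comment> \<open>In units of \<pi> i, the 1/4 is half of the quarter turn produced above; it
      cancels the -1/4 in the reciprocity law.\<close>
    have rec: "1 / 4 + ((b0 + - c) / (12 * d0) - dedekind_sum (- c) d0) = (a + d0) / (12 * c) - dedekind_sum d0 c"
    proof -
      have "real_of_int (a * d0) = b0 * c + 1" using det0 by (metis diff_eq_eq of_int_1 of_int_add of_int_mult add.commute)
      then have "(b0 - c) / (12 * d0) + (c / d0 + d0 / c + 1 / (c * d0)) / 12 = (a + d0) / (12 * c)"
      proof -
        have a: "real_of_int a = (b0 * c + 1) / d0"
          using \<open>real_of_int (a * d0) = b0 * c + 1\<close> d0' by (simp add: field_simps)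
        show ?thesis unfolding of_int_add a using c d0' by (simp add: field_simps)
      qed
      then show ?thesis
        using dedekind_reciprocity[OF c d0' \<open>coprime c d0\<close>] by (simp add: dedekind_sum_minus)
    qed
    have "log_eta ((of_int a * w + of_int b0) / (of_int c * w + of_int d0)) = 
       log_eta w + (Ln (- \<i> * w) + Ln (- \<i> * (of_int d0 * v + of_int (- c)))) / 2 +
       of_real pi * \<i> * of_real ((b0 + - c) / (12 * d0) - dedekind_sum (- c) d0)"
      using IH log_eta_S[OF w(1)] unfolding frac v_def[symmetric] by (simp add: add_divide_distrib)
    also have "\<dots> = log_eta w + Ln (- \<i> * u) / 2 + of_real pi * \<i> * of_real (1 / 4 + ((b0 + - c) / (12 * d0) - dedekind_sum (- c) d0))"
      unfolding Lns by (simp add: algebra_simps add_divide_distrib)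
    finally show ?thesis unfolding rec u_def .
  qed
  have "dedekind_sum d c = dedekind_sum d0 c" unfolding d by (rule dedekind_sum_periodic[OF c])
  moreover have "(a + d) / (12 * c) = j / 12 + (a + d0) / (12 * c)" using c by (simp add: d field_simps)
  moreover have "log_eta w = log_eta z + of_real pi * \<i> * of_int j / 12"
    unfolding w_def by (rule log_eta_add_int[OF z])
  ultimately show ?case using main unfolding num den by (simp add: algebra_simps add_divide_distrib)
qed

text \<open>The bracket in the phase of the series. The trace t is a separate argument because the
  matrices acting on \<tau> and on p \<tau> share it; the -1/8 comes from passing from Ln (-i u) to
  Ln u.\<close>

definition eta_phase :: "int \<Rightarrow> int \<Rightarrow> int \<Rightarrow> real" where
  "eta_phase t d c = t / (24 * c) + dedekind_sum (- d) c / 2 - 1 / 8"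

theorem log_eta_transform:
  fixes a b c d :: int
  assumes "c > 0" "a * d - b * c = 1" "Im z > 0"
  shows "log_eta ((of_int a * z + of_int b) / (of_int c * z + of_int d)) =
     log_eta z + Ln (of_int c * z + of_int d) / 2 + 2 * of_real pi * \<i> * of_real (eta_phase (a + d) d c)"
proof -
  define u where "u = of_int c * z + of_int d"
  have u: "Im u > 0" "u \<noteq> 0" using assms by (auto simp: u_def complex_eq_iff)
  have "Ln (\<i> * (- \<i> * u)) = Ln (- \<i> * u) + \<i> * of_real pi / 2"
    using u by (subst Ln_times_ii) auto
  then have Ln: "Ln (- \<i> * u) = Ln u - \<i> * of_real pi / 2" by simp
  define X where "X = (a + d) / (12 * c) - dedekind_sum d c"
  have ph: "eta_phase (a + d) d c = X / 2 - 1 / 8"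
    using assms(1) by (simp add: eta_phase_def dedekind_sum_minus X_def field_simps)
  show ?thesis
    using log_eta_transform_aux[OF assms] unfolding u_def[symmetric] X_def[symmetric] ph Ln
    by (simp add: algebra_simps add_divide_distrib diff_divide_distrib)
qed

text \<open>Choose (c, d) minimising |c z + d| over the nonzero integer pairs; minimality forces
  coprimality. After a translation has brought the real part into [-1/2, 1/2], comparison with the
  upper row (a, b) gives |\<tau>| >= 1, hence Im \<tau> >= 1/2. This is cruder than sqrt 3 / 2 but
  enough for compactness.\<close>

lemma modular_reduction:
  assumes z: "Im z > 0"
  obtains a b c d :: int and \<tau> where "a * d - b * c = 1" "\<bar>Re \<tau>\<bar> \<le> 1 / 2" "Im \<tau> \<ge> 1 / 2"
    "z = (of_int a * \<tau> + of_int b) / (of_int c * \<tau> + of_int d)"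
proof -
  obtain \<delta> where \<delta>: "\<delta> > 0" "\<And>\<tau> (c::int) (d::int). Im z \<le> Im \<tau> \<Longrightarrow> \<bar>Re \<tau>\<bar> \<le> \<bar>Re z\<bar> \<Longrightarrow> \<delta> * of_int (max \<bar>c\<bar> \<bar>d\<bar>) \<le> norm (of_int c * \<tau> + of_int d)"
    using lattice_lower_bound[OF z abs_ge_zero] by blast
  \<comment> \<open>Outside the box |c z + d| is at least 1, the value at (0, 1), so the minimum
    over the finite box is global.\<close>
  define n where "n = max 1 \<lceil>1 / \<delta>\<rceil>"
  define S where "S = {-n..n} \<times> {-n..n} - {(0, 0)}"
  let ?g = "\<lambda>x. norm (of_int (fst x) * z + of_int (snd x) :: complex)"
  have "(0, 1) \<in> S" by (auto simp: S_def n_def)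
  have fin: "finite S" by (simp add: S_def)
  define s where "s = arg_min_on ?g S"
  have s: "s \<in> S" unfolding s_def by (rule arg_min_if_finite(1)[OF fin]) (use \<open>(0, 1) \<in> S\<close> in auto)
  have smin: "?g s \<le> ?g x" if "x \<in> S" for x
    using arg_min_least[OF fin _ that, of ?g] that unfolding s_def by auto
  have smin': "?g s \<le> ?g x" if "x \<noteq> (0, 0)" for x
  proof (cases "x \<in> S")
    case False
    with that have "max \<bar>fst x\<bar> \<bar>snd x\<bar> > n" by (cases x) (auto simp: S_def)
    moreover have "1 / \<delta> \<le> n" unfolding n_def by linarith
    ultimately have "1 / \<delta> \<le> of_int (max \<bar>fst x\<bar> \<bar>snd x\<bar>)" by linarith
    then have "1 \<le> \<delta> * of_int (max \<bar>fst x\<bar> \<bar>snd x\<bar>)" using \<delta>(1) by (simp add: field_simps del: of_int_max)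
    also have "\<dots> \<le> ?g x" using \<delta>(2)[of z "fst x" "snd x"] by simp
    finally show ?thesis using smin[OF \<open>(0, 1) \<in> S\<close>] by simp
  qed (rule smin)
  obtain c d where cd: "s = (c, d)" by (cases s)
  have nz: "of_int x * z + of_int y \<noteq> 0" if "(x, y) \<noteq> (0, 0)" for x y :: int
    using that z by (auto simp: complex_eq_iff)
  have cd0: "(c, d) \<noteq> (0, 0)" using s cd by (auto simp: S_def)
  have "coprime c d"
  proof -
    define e where "e = gcd c d"
    have e: "e > 0" using cd0 by (simp add: e_def)
    obtain c' d' where c'd': "c = e * c'" "d = e * d'" unfolding e_def by (meson dvdE gcd_dvd1 gcd_dvd2)
    have "(c', d') \<noteq> (0, 0)" using cd0 c'd' by auto
    from smin'[OF this] have "?g (c, d) \<le> ?g (c', d')" by (simp add: cd)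
    moreover have "?g (c, d) = of_int e * ?g (c', d')"
    proof -
      have "of_int c * z + of_int d = of_int e * (of_int c' * z + of_int d')" by (simp add: c'd' algebra_simps)
      then show ?thesis using e by (simp add: norm_mult)
    qed
    moreover have "?g (c', d') > 0" using nz[OF \<open>(c', d') \<noteq> (0, 0)\<close>] by simp
    ultimately have "of_int e \<le> (1 :: real)" by simp
    with e have "e = 1" by linarith
    then show ?thesis by (simp add: e_def coprime_iff_gcd_eq_1)
  qed
  then obtain u v where "u * c + v * d = 1" using bezout_int[of c d] by auto
  define a0 where "a0 = v"
  define b0 where "b0 = - u"
  have det0: "a0 * d - b0 * c = 1" using \<open>u * c + v * d = 1\<close> by (simp add: a0_def b0_def algebra_simps)
  define w where "w = (of_int a0 * z + of_int b0) / (of_int c * z + of_int d)"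
  define j where "j = - round (Re w)"
  define \<tau> where "\<tau> = w + of_int j"
  define a where "a = a0 + j * c"
  define b where "b = b0 + j * d"
  have det: "a * d - b * c = 1" using det0 by (simp add: a_def b_def algebra_simps)
  have den: "of_int c * z + of_int d \<noteq> 0" by (rule moebius_denom_nonzero[OF det z])
  have \<tau>: "\<tau> = (of_int a * z + of_int b) / (of_int c * z + of_int d)"
    using den by (simp add: \<tau>_def w_def a_def b_def field_simps)
  have re: "\<bar>Re \<tau>\<bar> \<le> 1 / 2"
    using of_int_round_abs_le[of "Re w"] by (simp add: \<tau>_def j_def abs_minus_commute)
  have "(a, b) \<noteq> (0, 0)" using det by auto
  from smin'[OF this] have "norm (of_int c * z + of_int d) \<le> norm (of_int a * z + of_int b)" by (simp add: cd)
  then have "norm \<tau> \<ge> 1" using den unfolding \<tau> norm_divide by simp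
  then have "1 \<le> (Re \<tau>)\<^sup>2 + (Im \<tau>)\<^sup>2" using power_mono[of 1 "norm \<tau>" 2] by (simp add: cmod_power2)
  moreover have "(Re \<tau>)\<^sup>2 \<le> (1 / 2)\<^sup>2" using re by (intro abs_le_square_iff[THEN iffD1]) simp
  ultimately have "(1 / 2)\<^sup>2 \<le> (Im \<tau>)\<^sup>2" by (simp add: power2_eq_square)
  moreover have "Im \<tau> > 0" unfolding \<tau> by (rule Im_moebius_pos[OF det z])
  ultimately have im: "Im \<tau> \<ge> 1 / 2" using power2_le_imp_le[of "1 / 2" "Im \<tau>"] by fastforce
  have "z = (of_int d * \<tau> + of_int (- b)) / (of_int (- c) * \<tau> + of_int a)"
  proof -
    have dt: "of_int a * of_int d - of_int b * of_int c = (1 :: complex)"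
      using det by (metis of_int_1 of_int_diff of_int_mult)
    let ?u = "of_int c * z + of_int d"
    have "of_int d * \<tau> + of_int (- b) = (of_int a * of_int d - of_int b * of_int c) * z / ?u"
      "of_int (- c) * \<tau> + of_int a = (of_int a * of_int d - of_int b * of_int c) / ?u"
      unfolding \<tau> using den by (simp_all add: field_simps)
    then show ?thesis using den unfolding dt by simp
  qed
  moreover have "d * a - (- b) * (- c) = 1" using det by (simp add: mult.commute)
  ultimately show ?thesis using that re im by blast
qed

text \<open>The exponent is split as k = (k - 2) / 2 + (k + 2) / 2. The second part still exceeds 2
  and secures summability; the first, by |c \<tau> + d| >= Im \<tau> for c \<noteq> 0, yields decay
  at the cusp.\<close>

lemma lattice_decay:
  fixes k R :: real
  assumes "k > 2" "R \<ge> 0"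
  obtains K where "K > 0" "\<And>\<tau> (c::int) (d::int). 1 \<le> Im \<tau> \<Longrightarrow> \<bar>Re \<tau>\<bar> \<le> R \<Longrightarrow> c \<noteq> 0 \<Longrightarrow>
     norm (of_int c * \<tau> + of_int d) powr (- k) \<le> K * Im \<tau> powr (- ((k - 2) / 2)) * of_int (max \<bar>c\<bar> \<bar>d\<bar>) powr (- ((k + 2) / 2))"
proof -
  obtain \<delta> where \<delta>: "\<delta> > 0" "\<And>\<tau> (c::int) (d::int). 1 \<le> Im \<tau> \<Longrightarrow> \<bar>Re \<tau>\<bar> \<le> R \<Longrightarrow> \<delta> * of_int (max \<bar>c\<bar> \<bar>d\<bar>) \<le> norm (of_int c * \<tau> + of_int d)"
    using lattice_lower_bound[OF zero_less_one assms(2)] by blast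
  show ?thesis
  proof (rule that[of "\<delta> powr (- ((k + 2) / 2))"])
    show "\<delta> powr (- ((k + 2) / 2)) > 0" using \<delta> by simp
    fix \<tau> and c d :: int assume t: "1 \<le> Im \<tau>" "\<bar>Re \<tau>\<bar> \<le> R" "c \<noteq> 0"
    define N where "N = norm (of_int c * \<tau> + of_int d)"
    define M where "M = real_of_int (max \<bar>c\<bar> \<bar>d\<bar>)"
    have "max \<bar>c\<bar> \<bar>d\<bar> \<ge> 1" using t(3) by linarith
    then have M: "M \<ge> 1" unfolding M_def by linarith
    have "1 * Im \<tau> \<le> \<bar>real_of_int c\<bar> * Im \<tau>" using t by (intro mult_right_mono) linarith+
    also have "\<dots> \<le> N" using abs_Im_le_cmod[of "of_int c * \<tau> + of_int d"] t by (simp add: N_def abs_mult)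
    finally have N1: "Im \<tau> \<le> N" by simp
    have N2: "\<delta> * M \<le> N" using \<delta>(2)[OF t(1,2)] by (simp add: N_def M_def)
    have "N powr (- k) = N powr (- ((k - 2) / 2)) * N powr (- ((k + 2) / 2))"
      by (simp add: field_simps flip: powr_add)
    also have "\<dots> \<le> Im \<tau> powr (- ((k - 2) / 2)) * (\<delta> * M) powr (- ((k + 2) / 2))"
      using N1 N2 t M \<delta>(1) assms by (intro mult_mono powr_mono2') auto
    also have "\<dots> = \<delta> powr (- ((k + 2) / 2)) * Im \<tau> powr (- ((k - 2) / 2)) * M powr (- ((k + 2) / 2))"
      using M \<delta>(1) by (simp add: powr_mult)
    finally show "norm (of_int c * \<tau> + of_int d) powr (- k) \<le> \<delta> powr (- ((k + 2) / 2)) * Im \<tau> powr (- ((k - 2) / 2)) * of_int (max \<bar>c\<bar> \<bar>d\<bar>) powr (- ((k + 2) / 2))"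
      by (simp add: N_def M_def)
  qed
qed

section \<open>Eisenstein series attached to eta quotients\<close>

locale eta_eisenstein =
  fixes p :: nat and r :: real and a b :: "int \<times> int \<Rightarrow> int"
  assumes prime_p: "prime p" and admissible: "admissible_choice p a b"
begin

definition weight :: real where "weight = (real p - 1) * r / 2"

definition eta_quot :: "complex \<Rightarrow> complex" where
  "eta_quot \<tau> = exp (of_real r * (of_nat p * log_eta (of_nat p * \<tau>) - log_eta \<tau>))"

text \<open>
  The expansion of \<^const>\<open>eta_quot\<close> at the cusp \<open>1\<close>: up to the constant \<open>exp log_const\<close>, it is
  \<open>(w + 1)\<^bsup>-k\<^esup> eta_quot (w / (w + 1))\<close>.
\<close>
definition eta_quot_cusp :: "complex \<Rightarrow> complex" where
  "eta_quot_cusp w = exp (of_real r * (of_nat p * log_eta ((w + 1) / of_nat p) - log_eta w))"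

text \<open>The summand 1/24 stems from w / (w + 1), and p/24 - 1/8 from p w / (w + 1) = p - 1 / v
  with v = (w + 1) / p; the real part comes from Ln v = Ln (w + 1) - ln p.\<close>

definition log_const :: complex where
  "log_const = 2 * of_real pi * \<i> * of_real (r * (1 / 24 + real p * (real p / 24 - 1 / 8))) - of_real (real p * r / 2 * ln (real p))"

definition phase :: "int \<Rightarrow> int \<Rightarrow> real" where
  "phase c d = r * eta_phase (a (c, d) + b (c, d) + d) (b (c, d) + d) (a (c, d) + c)
     - real p * r * eta_phase (a (c, d) + b (c, d) + d) (b (c, d) + d) ((a (c, d) + c) div int p)"

definition eis_term :: "int \<Rightarrow> int \<Rightarrow> complex \<Rightarrow> complex" where
  "eis_term c d \<tau> = (of_int c * \<tau> + of_int d) powr (- of_real weight) * e2pi (of_real (phase c d))"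

definition act :: "int \<Rightarrow> int \<Rightarrow> complex \<Rightarrow> complex" where
  "act c d \<tau> = (of_int (a (c, d)) * \<tau> + of_int (b (c, d))) / (of_int c * \<tau> + of_int d)"

definition ratio_series :: "complex \<Rightarrow> complex" where
  "ratio_series \<tau> = (\<Sum>\<^sub>\<infinity>(c, d)\<in>E_index p. 1 / eta_quot_cusp (act c d \<tau>))"

lemma p_pos: "p > 0" "p > 1" using prime_p prime_gt_0_nat prime_gt_1_nat by auto

lemma E_index_iff: "(c, d) \<in> E_index p \<longleftrightarrow> c > 0 \<and> coprime c d \<and> \<not> int p dvd c"
  using prime_p by (auto simp: E_index_def prime_imp_coprime dest: coprime_absorb_left)

lemma choice:
  assumes "(c, d) \<in> E_index p"
  shows "a (c, d) * d - b (c, d) * c = 1" "int p dvd a (c, d) + c" "a (c, d) + c > 0"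
  using admissible assms by (auto simp: admissible_choice_def)

lemma Im_act_pos: "(c, d) \<in> E_index p \<Longrightarrow> Im \<tau> > 0 \<Longrightarrow> Im (act c d \<tau>) > 0"
  unfolding act_def by (rule Im_moebius_pos[OF choice(1)])

text \<open>With w = \<gamma> \<tau>, the values of \<open>log_eta\<close> at w / (w + 1) and at p w
  / (w + 1) are computed twice: from \<tau> and p \<tau>, which gives the phases of the series, and
  from w and (w + 1) / p by fixed matrices, which gives \<open>log_const\<close>.\<close>

lemma eta_quot_eq_eis_term:
  assumes cd: "(c, d) \<in> E_index p" and t: "Im \<tau> > 0"
  shows "eta_quot \<tau> = exp log_const * eta_quot_cusp (act c d \<tau>) * eis_term c d \<tau>"
proof -
  define A B where AB: "A = a (c, d)" "B = b (c, d)"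
  define m d' q where m: "m = A + c" "d' = B + d" "q = m div int p"
  note ch = choice[OF cd, folded AB]
  have c: "c > 0" using cd by (simp add: E_index_def)
  have det: "A * d' - B * m = 1" using ch(1) by (simp add: m algebra_simps)
  have mq: "m = int p * q" using ch(2) by (simp add: m)
  have mpos: "m > 0" using ch(3) by (simp add: m)
  then have qpos: "q > 0" using mq p_pos by (simp add: zero_less_mult_iff)
  define w where "w = act c d \<tau>"
  have w: "Im w > 0" unfolding w_def by (rule Im_act_pos[OF cd t])
  have wdef: "w = (of_int A * \<tau> + of_int B) / (of_int c * \<tau> + of_int d)" by (simp add: w_def act_def AB)
  define v where "v = (w + 1) / of_nat p"
  have pc: "(of_nat p :: complex) \<noteq> 0" using p_pos by simp
  have v: "Im v > 0" using w p_pos by (simp add: v_def)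
  have nz: "of_int c * \<tau> + of_int d \<noteq> 0" by (rule moebius_denom_nonzero[OF ch(1) t])
  have nz': "of_int m * \<tau> + of_int d' \<noteq> 0" by (rule moebius_denom_nonzero[OF det t])
  have w1: "w + 1 = (of_int m * \<tau> + of_int d') / (of_int c * \<tau> + of_int d)"
    using nz by (simp add: wdef m field_simps)
  have w1': "w / (w + 1) = (of_int A * \<tau> + of_int B) / (of_int m * \<tau> + of_int d')"
    unfolding w1 unfolding wdef using nz by simp
  have pt: "Im (of_nat p * \<tau>) > 0" using t p_pos by simp
  define D W where DW: "D = Ln (of_int c * \<tau> + of_int d)" "W = Ln (w + 1)"
  have im: "Im (of_int c * \<tau> + of_int d) > 0" "Im (w + 1) > 0" "Im (of_int m * \<tau> + of_int d') > 0"
    using c w t mpos by auto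
  \<comment> \<open>All three numbers lie in the upper half-plane, so their arguments are in (0,
    \<pi>); a correction by 2 \<pi> i would push the sum out of that range.\<close>
  have WD: "Ln (of_int m * \<tau> + of_int d') = W + D"
  proof -
    have prod: "(w + 1) * (of_int c * \<tau> + of_int d) = of_int m * \<tau> + of_int d'"
      unfolding w1 using nz by simp
    have "w + 1 \<noteq> 0" using w by (auto simp: complex_eq_iff)
    from Ln_times[OF this nz] show ?thesis
      using Im_Ln_pos_lt_imp[OF im(1)] Im_Ln_pos_lt_imp[OF im(2)] Im_Ln_pos_lt_imp[OF im(3)]
      unfolding prod DW by (auto split: if_splits)
  qed
  have LV: "Ln v = W - of_real (ln (real p))"
  proof -
    have "w + 1 \<noteq> 0" using w by (auto simp: complex_eq_iff)
    from Ln_divide_of_real[OF _ this, of "real p"] p_pos show ?thesis by (simp add: v_def DW)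
  qed
  define \<phi>1 where "\<phi>1 = eta_phase (A + d') d' m"
  define \<phi>2 where "\<phi>2 = eta_phase (A + d') d' q"
  have L1: "log_eta (w / (w + 1)) = log_eta \<tau> + (W + D) / 2 + 2 * of_real pi * \<i> * of_real \<phi>1"
    using log_eta_transform[OF mpos det t] unfolding WD w1' by (simp add: \<phi>1_def)
  have L2: "log_eta (of_nat p * (w / (w + 1))) = log_eta (of_nat p * \<tau>) + (W + D) / 2 + 2 * of_real pi * \<i> * of_real \<phi>2"
  proof -
    \<comment> \<open>Conjugation by diag(p, 1) gives the matrix acting on p \<tau>: the lower left
      entry is q = m / p, the upper right entry is p B, and the trace is unchanged.\<close>
    have det': "A * d' - (int p * B) * q = 1" using det by (simp add: mq mult_ac)
    have e1: "of_int q * (of_nat p * \<tau>) + of_int d' = of_int m * \<tau> + of_int d'" by (simp add: mq mult_ac)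
    have e2: "(of_int A * (of_nat p * \<tau>) + of_int (int p * B)) / (of_int m * \<tau> + of_int d') = of_nat p * (w / (w + 1))"
      unfolding w1' by (simp add: algebra_simps add_divide_distrib)
    show ?thesis
      using log_eta_transform[OF qpos det' pt] unfolding e1 e2 WD \<phi>2_def .
  qed
  have L3: "log_eta (w / (w + 1)) = log_eta w + W / 2 - 2 * of_real pi * \<i> / 24"
  proof -
    have "dedekind_sum (- 1) 1 = 0" by (simp add: dedekind_sum_def)
    then show ?thesis using log_eta_transform[of 1 1 1 0 w] w by (simp add: eta_phase_def DW)
  qed
  have L4: "log_eta (of_nat p * (w / (w + 1))) = log_eta v + (W - of_real (ln (real p))) / 2 + 2 * of_real pi * \<i> * of_real (real p / 24 - 1 / 8)"
  proof -
    have "(of_int (int p) * v + of_int (- 1)) / (of_int 1 * v + of_int 0) = of_nat p * (w / (w + 1))"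
      using pc im by (auto simp: v_def)
    then show ?thesis using log_eta_transform[of 1 "int p" 0 "- 1" v] v LV
      by (simp add: eta_phase_def dedekind_sum_def)
  qed
  have ph: "phase c d = r * \<phi>1 - real p * r * \<phi>2"
    unfolding phase_def \<phi>1_def \<phi>2_def m AB by (simp add: algebra_simps)
  have e1: "log_eta \<tau> = log_eta w - D / 2 - 2 * of_real pi * \<i> / 24 - 2 * of_real pi * \<i> * of_real \<phi>1"
    using L1 L3 by (simp add: algebra_simps add_divide_distrib)
  have e2: "log_eta (of_nat p * \<tau>) = log_eta v - D / 2 - of_real (ln (real p)) / 2 
     + 2 * of_real pi * \<i> * of_real (real p / 24 - 1 / 8) - 2 * of_real pi * \<i> * of_real \<phi>2"
    using L2 L4 by (simp add: algebra_simps add_divide_distrib diff_divide_distrib)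
  have "of_real r * (of_nat p * log_eta (of_nat p * \<tau>) - log_eta \<tau>) = 
     log_const + of_real r * (of_nat p * log_eta v - log_eta w) + (- of_real weight * D + 2 * of_real pi * \<i> * of_real (phase c d))"
    unfolding e1 e2 log_const_def weight_def ph by (simp add: field_simps)
  moreover have "eis_term c d \<tau> = exp (- of_real weight * D + 2 * of_real pi * \<i> * of_real (phase c d))"
    using nz by (simp add: eis_term_def powr_def e2pi_def DW flip: exp_add)
  ultimately show ?thesis
    unfolding eta_quot_def eta_quot_cusp_def w_def[symmetric] v_def[symmetric] by (simp only: exp_add)
qed

lemma eta_quot_nonzero: "eta_quot \<tau> \<noteq> 0" "eta_quot_cusp \<tau> \<noteq> 0"
  by (simp_all add: eta_quot_def eta_quot_cusp_def)

lemma inverse_cusp_eq: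
  assumes "(c, d) \<in> E_index p" "Im \<tau> > 0"
  shows "1 / eta_quot_cusp (act c d \<tau>) = exp log_const / eta_quot \<tau> * eis_term c d \<tau>"
proof -
  have "eis_term c d \<tau> \<noteq> 0" using eta_quot_eq_eis_term[OF assms] eta_quot_nonzero(1)[of \<tau>] by auto
  then show ?thesis using eta_quot_nonzero unfolding eta_quot_eq_eis_term[OF assms] by simp
qed

lemma eis_sum_eq:
  assumes "Im \<tau> > 0"
  shows "(\<Sum>\<^sub>\<infinity>(c, d)\<in>E_index p. eis_term c d \<tau>) = exp (- log_const) * eta_quot \<tau> * ratio_series \<tau>"
proof -
  have "ratio_series \<tau> = (\<Sum>\<^sub>\<infinity>x\<in>E_index p. exp log_const / eta_quot \<tau> * (case x of (c, d) \<Rightarrow> eis_term c d \<tau>))"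
    unfolding ratio_series_def by (intro infsum_cong) (auto simp: inverse_cusp_eq[OF _ assms])
  also have "\<dots> = exp log_const / eta_quot \<tau> * (\<Sum>\<^sub>\<infinity>(c, d)\<in>E_index p. eis_term c d \<tau>)"
    by (rule infsum_cmult_right')
  finally show ?thesis using eta_quot_nonzero by (simp add: exp_minus field_simps)
qed

text \<open>Translating w by p j changes \<open>log_eta w\<close> by \<pi> i p j / 12, while (w + 1)
  / p moves by j and p times its \<open>log_eta\<close> changes by the same amount.\<close>

lemma eta_quot_cusp_periodic:
  assumes "Im w > 0" shows "eta_quot_cusp (w + of_int (int p * j)) = eta_quot_cusp w"
proof -
  have v: "Im ((w + 1) / of_nat p) > 0" using assms p_pos by simp
  have "(w + of_int (int p * j) + 1) / of_nat p = (w + 1) / of_nat p + of_int j"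
    using p_pos by (simp add: field_simps)
  then show ?thesis
    unfolding eta_quot_cusp_def log_eta_add_int[OF assms] using log_eta_add_int[OF v, of j]
    by (simp add: algebra_simps)
qed

text \<open>Two matrices of determinant 1 with the same lower row differ by a translation by some j
  on the left. Both satisfy the congruence, so p divides j c and hence j, and the period p applies.
  This makes the series independent of the chosen a and b.\<close>

lemma eta_quot_cusp_cong:
  assumes "A * d - B * c = 1" "A' * d - B' * c = 1" "int p dvd A + c" "int p dvd A' + c" "\<not> int p dvd c"
    and t: "Im \<tau> > 0"
  shows "eta_quot_cusp ((of_int A * \<tau> + of_int B) / (of_int c * \<tau> + of_int d))
    = eta_quot_cusp ((of_int A' * \<tau> + of_int B') / (of_int c * \<tau> + of_int d))"
proof -
  have c0: "c \<noteq> 0" using assms(5) by auto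
  have "(A - A') * d = (B - B') * c" using assms(1,2) by (simp add: algebra_simps)
  moreover have "coprime c d" using assms(1) by (intro coprimeI) (metis dvd_diff dvd_mult)
  ultimately have "c dvd A - A'" by (metis coprime_dvd_mult_left_iff dvd_triv_right)
  then obtain j where j: "A = A' + j * c" by (metis dvdE mult.commute diff_add_cancel add.commute)
  with \<open>(A - A') * d = (B - B') * c\<close> have "c * (j * d) = c * (B - B')" by (simp add: algebra_simps)
  then have B: "B = B' + j * d" using c0 by (simp only: mult_cancel_left) auto
  have "int p dvd (A + c) - (A' + c)" using assms(3,4) by (rule dvd_diff)
  then have "int p dvd j * c" by (simp add: j)
  then have "int p dvd j" using assms(5) prime_p by (simp add: prime_dvd_mult_iff)
  then obtain i where i: "j = int p * i" by (elim dvdE)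
  have nz: "of_int c * \<tau> + of_int d \<noteq> 0" by (rule moebius_denom_nonzero[OF assms(1) t])
  have "(of_int A * \<tau> + of_int B) / (of_int c * \<tau> + of_int d) = 
     (of_int A' * \<tau> + of_int B') / (of_int c * \<tau> + of_int d) + of_int (int p * i)"
    using nz by (simp add: j B i field_simps)
  then show ?thesis
    using eta_quot_cusp_periodic[OF Im_moebius_pos[OF assms(2) t]] by simp
qed

section \<open>Invariance under Gamma_0(p)\<close>

definition index_act :: "int \<Rightarrow> int \<Rightarrow> int \<Rightarrow> int \<Rightarrow> int \<times> int \<Rightarrow> int \<times> int" where
  "index_act A B C D = (\<lambda>(c, d). let c' = c * A + d * C; d' = c * B + d * D in if c' > 0 then (c', d') else (- c', - d'))"

lemma index_act_not_dvd:
  assumes "A * D - B * C = 1" "int p dvd C" "\<not> int p dvd c"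
  shows "\<not> int p dvd c * A + d * C"
proof
  assume "int p dvd c * A + d * C"
  then have "int p dvd c * A" using assms(2) by (metis dvd_add_left_iff dvd_mult)
  then have "int p dvd A" using assms(3) prime_p by (simp add: prime_dvd_mult_iff)
  then have "int p dvd A * D - B * C" using assms(2) by (intro dvd_diff dvd_mult dvd_mult2)
  then show False using assms(1) prime_p by (simp add: not_prime_unit)
qed

lemma index_act_in_E_index:
  assumes M: "A * D - B * C = 1" "int p dvd C" and x: "x \<in> E_index p"
  shows "index_act A B C D x \<in> E_index p"
proof -
  obtain c d where cd: "x = (c, d)" by (cases x)
  define c' d' where c': "c' = c * A + d * C" "d' = c * B + d * D"
  have x': "c > 0" "coprime c d" "\<not> int p dvd c" using x by (auto simp: cd E_index_iff)
  have nd: "\<not> int p dvd c'" unfolding c' by (rule index_act_not_dvd[OF M x'(3)])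
  have inv: "c = c' * D - d' * C" "d = d' * A - c' * B"
  proof -
    have "c' * D - d' * C = c * (A * D - B * C)" "d' * A - c' * B = d * (A * D - B * C)"
      by (simp_all add: c' algebra_simps)
    then show "c = c' * D - d' * C" "d = d' * A - c' * B" using M(1) by simp_all
  qed
  have "coprime c' d'"
  proof (rule coprimeI)
    fix e assume "e dvd c'" "e dvd d'"
    then have "e dvd c" "e dvd d" unfolding inv by (simp_all add: dvd_diff)
    with x'(2) show "is_unit e" by (meson coprime_def)
  qed
  moreover have "c' \<noteq> 0" using nd by auto
  ultimately show ?thesis using nd
    by (auto simp: index_act_def cd Let_def E_index_iff simp flip: c')
qed

lemma index_act_inverse:
  assumes M: "A * D - B * C = 1" "int p dvd C" and x: "x \<in> E_index p"
  shows "index_act D (- B) (- C) A (index_act A B C D x) = x"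
proof -
  obtain c d where cd: "x = (c, d)" by (cases x)
  define c' d' where c': "c' = c * A + d * C" "d' = c * B + d * D"
  have c: "c > 0" using x by (auto simp: cd E_index_iff)
  have "c' * D - d' * C = c * (A * D - B * C)" "d' * A - c' * B = d * (A * D - B * C)"
    by (simp_all add: c' algebra_simps)
  then have inv: "c' * D - d' * C = c" "d' * A - c' * B = d" using M(1) by simp_all
  have "c' \<noteq> 0" using index_act_not_dvd[OF M, of c d] x by (auto simp: cd E_index_iff c')
  show ?thesis
  proof (cases "c' > 0")
    case True
    then have "index_act A B C D x = (c', d')" by (simp add: index_act_def cd c')
    then show ?thesis using inv c by (simp add: index_act_def cd algebra_simps)
  next
    case False
    then have "index_act A B C D x = (- c', - d')" by (simp add: index_act_def cd c')
    moreover have "- c' * D + - d' * - C = - c" "- c' * - B + - d' * A = - d" using inv by (simp_all add: algebra_simps)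
    ultimately show ?thesis using c by (simp add: index_act_def cd)
  qed
qed

lemma bij_betw_index_act:
  assumes M: "A * D - B * C = 1" "int p dvd C"
  shows "bij_betw (index_act A B C D) (E_index p) (E_index p)"
proof (rule bij_betw_byWitness[where f' = "index_act D (- B) (- C) A"])
  have M': "D * A - (- B) * (- C) = 1" "int p dvd - C" using M by (simp_all add: mult.commute)
  show "\<forall>x\<in>E_index p. index_act D (- B) (- C) A (index_act A B C D x) = x"
    using index_act_inverse[OF M] by blast
  show "\<forall>x\<in>E_index p. index_act A B C D (index_act D (- B) (- C) A x) = x"
    using index_act_inverse[OF M'] by simp
  show "index_act A B C D ` E_index p \<subseteq> E_index p" using index_act_in_E_index[OF M] by blast
  show "index_act D (- B) (- C) A ` E_index p \<subseteq> E_index p" using index_act_in_E_index[OF M'] by blast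
qed

text \<open>Right multiplication by a matrix of Gamma_0(p) sends the lower row (c, d) to (c', d')
  and preserves the congruence on a + c because p divides C. So each summand at the transformed
  point is a summand at \<tau>, up to the choice of the upper row.\<close>

lemma ratio_series_invariant:
  assumes M: "A * D - B * C = 1" "int p dvd C" and t: "Im \<tau> > 0"
  shows "ratio_series ((of_int A * \<tau> + of_int B) / (of_int C * \<tau> + of_int D)) = ratio_series \<tau>"
proof -
  let ?g = "\<lambda>x. case x of (c, d) \<Rightarrow> 1 / eta_quot_cusp (act c d \<tau>)"
  define \<tau>' where "\<tau>' = (of_int A * \<tau> + of_int B) / (of_int C * \<tau> + of_int D)"
  have nz: "of_int C * \<tau> + of_int D \<noteq> 0" by (rule moebius_denom_nonzero[OF M(1) t])
  have "(case x of (c, d) \<Rightarrow> 1 / eta_quot_cusp (act c d \<tau>')) = ?g (index_act A B C D x)" if x: "x \<in> E_index p" for x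
  proof -
    obtain c d where cd: "x = (c, d)" by (cases x)
    note ch = choice[OF x[unfolded cd]]
    define c' d' where c': "c' = c * A + d * C" "d' = c * B + d * D"
    define A' B' where A': "A' = a (c, d) * A + b (c, d) * C" "B' = a (c, d) * B + b (c, d) * D"
    have nd: "\<not> int p dvd c'" unfolding c' using index_act_not_dvd[OF M, of c d] x by (auto simp: cd E_index_iff)
    have "A' * d' - B' * c' = (a (c, d) * d - b (c, d) * c) * (A * D - B * C)" by (simp add: A' c' algebra_simps)
    then have det: "A' * d' - B' * c' = 1" using ch M by simp
    have "A' + c' = (a (c, d) + c) * A + (b (c, d) + d) * C" by (simp add: A' c' algebra_simps)
    then have pd: "int p dvd A' + c'" using ch(2) M(2) by simp
    have act': "act c d \<tau>' = (of_int A' * \<tau> + of_int B') / (of_int c' * \<tau> + of_int d')"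
    proof -
      have "(x * (P / Q) + y) / (u * (P / Q) + v) = (x * P + y * Q) / (u * P + v * Q)" if "Q \<noteq> 0" for x y u v P Q :: complex
      proof -
        have "(x * (P / Q) + y) = (x * P + y * Q) / Q" "(u * (P / Q) + v) = (u * P + v * Q) / Q" using that by (simp_all add: field_simps)
        then show ?thesis using that by simp
      qed
      from this[OF nz] have "act c d \<tau>' = (of_int (a (c, d)) * (of_int A * \<tau> + of_int B) + of_int (b (c, d)) * (of_int C * \<tau> + of_int D)) / 
          (of_int c * (of_int A * \<tau> + of_int B) + of_int d * (of_int C * \<tau> + of_int D))"
        unfolding act_def \<tau>'_def by blast
      also have "\<dots> = (of_int A' * \<tau> + of_int B') / (of_int c' * \<tau> + of_int d')"
        by (simp add: A' c' algebra_simps)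
      finally show ?thesis .
    qed
    note inE = index_act_in_E_index[OF M x]
    show ?thesis
    proof (cases "c' > 0")
      case True
      then have ia: "index_act A B C D x = (c', d')" by (simp add: index_act_def cd c')
      note ch' = choice[OF inE[unfolded ia]]
      show ?thesis unfolding ia[unfolded cd] cd prod.case act' act_def[of c' d']
        using eta_quot_cusp_cong[OF det ch'(1) pd ch'(2) nd t] by (simp only:)
    next
      \<comment> \<open>\<open>index_act\<close> has flipped the sign of the row to keep c positive;
        negating the whole matrix leaves its action unchanged.\<close>
      case False
      then have ia: "index_act A B C D x = (- c', - d')" by (simp add: index_act_def cd c')
      note ch' = choice[OF inE[unfolded ia]]
      have det2: "(- A') * (- d') - (- B') * (- c') = 1" using det by simp
      have pd2: "int p dvd - A' + - c'" using pd by (metis dvd_minus_iff minus_add_distrib)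
      have nd2: "\<not> int p dvd - c'" using nd by simp
      have "act c d \<tau>' = (of_int (- A') * \<tau> + of_int (- B')) / (of_int (- c') * \<tau> + of_int (- d'))"
      proof -
        have "of_int (- A') * \<tau> + of_int (- B') = - (of_int A' * \<tau> + of_int B')"
          "of_int (- c') * \<tau> + of_int (- d') = - (of_int c' * \<tau> + of_int d')" by simp_all
        then show ?thesis unfolding act' by (simp only: minus_divide_divide)
      qed
      then have act2: "act c d \<tau>' = (of_int (- A') * \<tau> + of_int (- B')) / (of_int (- c') * \<tau> + of_int (- d'))" .
      show ?thesis unfolding ia[unfolded cd] cd prod.case act2 act_def[of "- c'" "- d'"]
        using eta_quot_cusp_cong[OF det2 ch'(1) pd2 ch'(2) nd2 t] by (simp only:)
    qed
  qed
  then have "ratio_series \<tau>' = (\<Sum>\<^sub>\<infinity>x\<in>E_index p. ?g (index_act A B C D x))"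
    unfolding ratio_series_def by (intro infsum_cong) auto
  also have "\<dots> = ratio_series \<tau>"
    unfolding ratio_series_def by (rule infsum_reindex_bij_betw[OF bij_betw_index_act[OF M]])
  finally show ?thesis unfolding \<tau>'_def .
qed

end

section \<open>Limits at i infinity\<close>

definition im_top :: "complex filter" where "im_top = filtercomap Im at_top"

text \<open>Series in q have limits uniformly in Re \<tau>, but the lattice sums are controlled only
  for bounded real part, so their limits are taken in a strip.\<close>

definition im_top_strip :: "real \<Rightarrow> complex filter" where
  "im_top_strip R = inf im_top (principal {\<tau>. \<bar>Re \<tau>\<bar> \<le> R})"

lemma eventually_im_top: "eventually P im_top \<longleftrightarrow> (\<exists>Y. \<forall>\<tau>. Im \<tau> \<ge> Y \<longrightarrow> P \<tau>)"
  unfolding im_top_def eventually_filtercomap eventually_at_top_linorder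
  by (metis (no_types, lifting) mem_Collect_eq)

lemma eventually_im_top_strip: "eventually P (im_top_strip R) \<longleftrightarrow> (\<exists>Y. \<forall>\<tau>. Im \<tau> \<ge> Y \<and> \<bar>Re \<tau>\<bar> \<le> R \<longrightarrow> P \<tau>)"
  unfolding im_top_strip_def eventually_inf_principal eventually_im_top by auto

lemma im_top_strip_le: "im_top_strip R \<le> im_top"
  by (simp add: im_top_strip_def)

lemma im_top_strip_neq_bot: "R \<ge> 0 \<Longrightarrow> im_top_strip R \<noteq> bot"
  unfolding trivial_limit_def eventually_im_top_strip by (metis abs_zero complex.sel order_refl)

lemma eventually_im_top_gt: "eventually (\<lambda>\<tau>. Im \<tau> > c) im_top"
  unfolding eventually_im_top by (rule exI[of _ "c + 1"]) auto

lemma filterlim_Im: "filterlim Im at_top im_top"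
  unfolding im_top_def by (rule filterlim_filtercomap)

lemma e2pi_tendsto_0: "(e2pi \<longlongrightarrow> 0) im_top"
proof (rule tendsto_norm_zero_cancel)
  have "filterlim (\<lambda>y. - 2 * pi * y) at_bot at_top"
    by (rule filterlim_tendsto_neg_mult_at_bot[OF tendsto_const _ filterlim_ident]) simp
  then have "((\<lambda>y. exp (- 2 * pi * y)) \<longlongrightarrow> 0) at_top"
    by (rule filterlim_compose[OF exp_at_bot])
  from filterlim_compose[OF this filterlim_Im] show "((\<lambda>\<tau>. norm (e2pi \<tau>)) \<longlongrightarrow> 0) im_top"
    by (simp add: norm_e2pi)
qed

lemma filterlim_im_top_scale:
  assumes "s > 0" shows "filterlim (\<lambda>\<tau>. of_real s * \<tau>) im_top im_top"
  unfolding filterlim_iff eventually_im_top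
proof (intro allI impI, elim exE)
  fix P Y assume Y: "\<forall>\<tau>. Y \<le> Im \<tau> \<longrightarrow> P \<tau>"
  show "\<exists>Y. \<forall>\<tau>. Y \<le> Im \<tau> \<longrightarrow> P (of_real s * \<tau>)"
    by (rule exI[of _ "Y / s"]) (use Y assms in \<open>auto simp: field_simps\<close>)
qed

lemma log_euler_e2pi_tendsto_0:
  assumes "s > 0" shows "((\<lambda>\<tau>. log_euler (e2pi (of_real s * \<tau>))) \<longlongrightarrow> 0) im_top"
proof -
  have "isCont log_euler 0"
    using log_euler_series(3)[of 0] by (auto intro: DERIV_isCont)
  then have nhds: "(log_euler \<longlongrightarrow> log_euler 0) (nhds 0)" by (simp only: isCont_def tendsto_at_iff_tendsto_nhds)
  have "((\<lambda>\<tau>. e2pi (of_real s * \<tau>)) \<longlongrightarrow> 0) im_top"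
    by (rule filterlim_compose[OF e2pi_tendsto_0 filterlim_im_top_scale[OF assms]])
  from filterlim_compose[OF nhds this] show ?thesis by simp
qed

lemma norm_powr_of_real: "norm (z powr of_real x) = norm z powr x" for z :: complex
  by (cases "z = 0") (auto simp: powr_def)

section \<open>Convergence, holomorphy and decay of the series\<close>

locale eta_eisenstein_weight = eta_eisenstein +
  assumes weight_gt_2: "weight > 2" and order_le_1: "r * ((real p)\<^sup>2 - 1) / 24 \<le> 1"
begin

definition eis_sum :: "complex \<Rightarrow> complex" where
  "eis_sum \<tau> = (\<Sum>\<^sub>\<infinity>(c, d)\<in>E_index p. eis_term c d \<tau>)"

lemma norm_eis_term: "norm (eis_term c d \<tau>) = norm (of_int c * \<tau> + of_int d) powr (- weight)"
  using norm_powr_of_real[of "of_int c * \<tau> + of_int d" "- weight"]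
  by (simp add: eis_term_def norm_mult norm_e2pi)

lemma E_index_pos: "(c, d) \<in> E_index p \<Longrightarrow> c > 0" by (simp add: E_index_def)

lemma eis_term_holomorphic: "(c, d) \<in> E_index p \<Longrightarrow> eis_term c d holomorphic_on upper_half"
  unfolding eis_term_def
  by (intro holomorphic_intros) (auto dest: E_index_pos simp: complex_nonpos_Reals_iff)

lemma eis_term_bound:
  assumes "y0 > 0" "R \<ge> 0"
  obtains K where "\<And>c d \<tau>. (c, d) \<in> E_index p \<Longrightarrow> Im \<tau> \<ge> y0 \<Longrightarrow> \<bar>Re \<tau>\<bar> \<le> R \<Longrightarrow>
     norm (eis_term c d \<tau>) \<le> K * of_int (max \<bar>c\<bar> \<bar>d\<bar>) powr (- weight)"
proof -
  obtain \<delta> where \<delta>: "\<delta> > 0" "\<And>\<tau> (c::int) (d::int). y0 \<le> Im \<tau> \<Longrightarrow> \<bar>Re \<tau>\<bar> \<le> R \<Longrightarrow> \<delta> * of_int (max \<bar>c\<bar> \<bar>d\<bar>) \<le> norm (of_int c * \<tau> + of_int d)"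
    using lattice_lower_bound[OF assms] by blast
  show ?thesis
  proof (rule that[of "\<delta> powr (- weight)"])
    fix c d \<tau> assume cd: "(c, d) \<in> E_index p" and t: "Im \<tau> \<ge> y0" "\<bar>Re \<tau>\<bar> \<le> R"
    define M where "M = real_of_int (max \<bar>c\<bar> \<bar>d\<bar>)"
    have "max \<bar>c\<bar> \<bar>d\<bar> \<ge> 1" using E_index_pos[OF cd] by linarith
    then have M: "M \<ge> 1" unfolding M_def by linarith
    have "norm (eis_term c d \<tau>) \<le> (\<delta> * M) powr (- weight)"
      unfolding norm_eis_term
    proof (rule powr_mono2')
      show "\<delta> * M \<le> norm (of_int c * \<tau> + of_int d)" unfolding M_def by (rule \<delta>(2)[OF t])
    qed (use \<delta>(1) M weight_gt_2 in auto)
    then show "norm (eis_term c d \<tau>) \<le> \<delta> powr (- weight) * of_int (max \<bar>c\<bar> \<bar>d\<bar>) powr (- weight)"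
      using M \<delta>(1) by (simp add: powr_mult M_def)
  qed
qed

lemma lattice_summable_weight: "(\<lambda>(c, d). K * real_of_int (max \<bar>c\<bar> \<bar>d\<bar>) powr (- s)) summable_on A" if "s > 2"
  using summable_on_cmult_right[OF summable_on_subset[OF summable_on_lattice_powr[OF that], of A], of K]
  by (simp add: case_prod_unfold)

lemma eis_term_summable: "Im \<tau> > 0 \<Longrightarrow> (\<lambda>(c, d). eis_term c d \<tau>) summable_on E_index p"
proof -
  assume t: "Im \<tau> > 0"
  obtain K where K: "\<And>c d \<tau>'. (c, d) \<in> E_index p \<Longrightarrow> Im \<tau>' \<ge> Im \<tau> \<Longrightarrow> \<bar>Re \<tau>'\<bar> \<le> \<bar>Re \<tau>\<bar> \<Longrightarrow>
     norm (eis_term c d \<tau>') \<le> K * of_int (max \<bar>c\<bar> \<bar>d\<bar>) powr (- weight)"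
    using eis_term_bound[OF t abs_ge_zero] by blast
  show ?thesis
    by (rule abs_summable_summable, rule summable_on_comparison_test[OF lattice_summable_weight[OF weight_gt_2, of K]])
       (use K[OF _ order_refl order_refl] in \<open>auto split: prod.splits\<close>)
qed

lemma eis_sum_holomorphic: "eis_sum holomorphic_on upper_half"
proof -
  have "\<exists>\<rho>>0. eis_sum holomorphic_on ball z \<rho>" if z: "Im z > 0" for z
  proof -
    define \<rho> where "\<rho> = Im z / 2"
    have \<rho>: "\<rho> > 0" using z by (simp add: \<rho>_def)
    have cb: "Im w \<ge> \<rho> \<and> \<bar>Re w\<bar> \<le> \<bar>Re z\<bar> + \<rho>" if "w \<in> cball z \<rho>" for w
      using that abs_Im_le_cmod[of "z - w"] abs_Re_le_cmod[of "z - w"] by (auto simp: dist_norm \<rho>_def)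
    obtain K where K: "\<And>c d \<tau>. (c, d) \<in> E_index p \<Longrightarrow> Im \<tau> \<ge> \<rho> \<Longrightarrow> \<bar>Re \<tau>\<bar> \<le> \<bar>Re z\<bar> + \<rho> \<Longrightarrow>
       norm (eis_term c d \<tau>) \<le> K * of_int (max \<bar>c\<bar> \<bar>d\<bar>) powr (- weight)"
      using eis_term_bound[OF \<rho>, of "\<bar>Re z\<bar> + \<rho>"] \<rho> by (metis abs_ge_zero add_nonneg_nonneg less_imp_le)
    have ul: "uniform_limit (cball z \<rho>) (\<lambda>X w. \<Sum>x\<in>X. case x of (c, d) \<Rightarrow> eis_term c d w) eis_sum (finite_subsets_at_top (E_index p))"
      unfolding eis_sum_def
      by (rule Weierstrass_m_test_general[OF _ lattice_summable_weight[OF weight_gt_2, of K]])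
         (use K cb in \<open>auto split: prod.splits\<close>)
    have sub: "cball z \<rho> \<subseteq> upper_half" using cb \<rho> by fastforce
    have hol: "(\<lambda>w. \<Sum>x\<in>X. case x of (c, d) \<Rightarrow> eis_term c d w) holomorphic_on upper_half" if "X \<subseteq> E_index p" for X
      using that by (intro holomorphic_on_sum) (auto split: prod.splits intro: eis_term_holomorphic)
    have ev: "\<forall>\<^sub>F X in finite_subsets_at_top (E_index p). continuous_on (cball z \<rho>) (\<lambda>w. \<Sum>x\<in>X. case x of (c, d) \<Rightarrow> eis_term c d w)
        \<and> (\<lambda>w. \<Sum>x\<in>X. case x of (c, d) \<Rightarrow> eis_term c d w) holomorphic_on ball z \<rho>"
    proof (rule eventually_finite_subsets_at_top_weakI)
      fix X assume "finite X" "X \<subseteq> E_index p"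
      from hol[OF this(2)] show "continuous_on (cball z \<rho>) (\<lambda>w. \<Sum>x\<in>X. case x of (c, d) \<Rightarrow> eis_term c d w)
        \<and> (\<lambda>w. \<Sum>x\<in>X. case x of (c, d) \<Rightarrow> eis_term c d w) holomorphic_on ball z \<rho>"
        using sub ball_subset_cball[of z \<rho>] by (meson holomorphic_on_imp_continuous_on holomorphic_on_subset order_trans)
    qed
    have "eis_sum holomorphic_on ball z \<rho>"
      using holomorphic_uniform_limit[OF ev ul] by auto
    with \<rho> show ?thesis by blast
  qed
  then have "eis_sum field_differentiable at z" if "Im z > 0" for z
    using that by (meson centre_in_ball holomorphic_on_imp_differentiable_at open_ball)
  then show ?thesis
    by (intro holomorphic_onI field_differentiable_at_within[where S = upper_half]) auto
qed

lemma log_eta_holomorphic: "log_eta holomorphic_on upper_half"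
  by (rule holomorphic_onI, rule field_differentiable_at_within)
     (auto simp: field_differentiable_def intro: log_eta_has_field_derivative)

lemma eta_quot_holomorphic: "eta_quot holomorphic_on upper_half"
proof -
  have "(log_eta \<circ> (\<lambda>\<tau>. of_nat p * \<tau>)) holomorphic_on upper_half"
    by (rule holomorphic_on_compose_gen[OF _ log_eta_holomorphic]) (use p_pos in \<open>auto intro!: holomorphic_intros\<close>)
  then have "(\<lambda>\<tau>. log_eta (of_nat p * \<tau>)) holomorphic_on upper_half" by (simp add: o_def)
  then show ?thesis unfolding eta_quot_def
    by (intro holomorphic_intros log_eta_holomorphic)
qed

lemma ratio_series_eq: "Im \<tau> > 0 \<Longrightarrow> ratio_series \<tau> = exp log_const * eis_sum \<tau> / eta_quot \<tau>"
  using eis_sum_eq[of \<tau>] eta_quot_nonzero(1)[of \<tau>] by (simp add: eis_sum_def exp_minus field_simps)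

lemma ratio_series_holomorphic: "ratio_series holomorphic_on upper_half"
proof -
  have "(\<lambda>\<tau>. exp log_const * eis_sum \<tau> / eta_quot \<tau>) holomorphic_on upper_half"
    by (intro holomorphic_intros eis_sum_holomorphic eta_quot_holomorphic) (simp add: eta_quot_nonzero)
  then show ?thesis
    by (rule holomorphic_transform) (simp add: ratio_series_eq)
qed

text \<open>Stated for an arbitrary index set and arbitrary dominated terms because it serves twice:
  for the series at infinity, and at the cusp 0 for the terms other than (1, 0), after inversion has
  exchanged the roles of c and d.\<close>

lemma lattice_sum_decay:
  assumes "R \<ge> 0"
  obtains g where "(g \<longlongrightarrow> 0) im_top" 
    "\<And>X f \<tau>. 1 \<le> Im \<tau> \<Longrightarrow> \<bar>Re \<tau>\<bar> \<le> R \<Longrightarrow>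
      (\<And>c d. (c, d) \<in> X \<Longrightarrow> norm (f (c, d) :: complex) \<le> norm (of_int c * \<tau> + of_int d) powr (- weight) \<and> c \<noteq> 0) \<Longrightarrow> norm (infsum f X) \<le> g \<tau>"
proof -
  obtain K where K: "K > 0" "\<And>\<tau> (c::int) (d::int). 1 \<le> Im \<tau> \<Longrightarrow> \<bar>Re \<tau>\<bar> \<le> R \<Longrightarrow> c \<noteq> 0 \<Longrightarrow>
     norm (of_int c * \<tau> + of_int d) powr (- weight) \<le> K * Im \<tau> powr (- ((weight - 2) / 2)) * of_int (max \<bar>c\<bar> \<bar>d\<bar>) powr (- ((weight + 2) / 2))"
    using lattice_decay[OF weight_gt_2 assms] by blast
  define Z where "Z = (\<Sum>\<^sub>\<infinity>(c::int, d::int). real_of_int (max \<bar>c\<bar> \<bar>d\<bar>) powr (- ((weight + 2) / 2)))"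
  define g where "g \<tau> = K * Im \<tau> powr (- ((weight - 2) / 2)) * Z" for \<tau>
  have s: "(weight + 2) / 2 > 2" using weight_gt_2 by simp
  show ?thesis
  proof (rule that[of g])
    have "((\<lambda>\<tau>. Im \<tau> powr (- ((weight - 2) / 2))) \<longlongrightarrow> 0) im_top"
      using weight_gt_2 by (intro tendsto_neg_powr filterlim_Im) auto
    then have "((\<lambda>\<tau>. K * Im \<tau> powr (- ((weight - 2) / 2)) * Z) \<longlongrightarrow> K * 0 * Z) im_top"
      by (intro tendsto_intros)
    then show "(g \<longlongrightarrow> 0) im_top" by (simp add: g_def[abs_def])
  next
    fix X :: "(int \<times> int) set" and f :: "int \<times> int \<Rightarrow> complex" and \<tau>
    assume t: "1 \<le> Im \<tau>" "\<bar>Re \<tau>\<bar> \<le> R"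
      and f: "\<And>c d. (c, d) \<in> X \<Longrightarrow> norm (f (c, d)) \<le> norm (of_int c * \<tau> + of_int d) powr (- weight) \<and> c \<noteq> 0"
    define B where "B = K * Im \<tau> powr (- ((weight - 2) / 2))"
    let ?u = "\<lambda>(c::int, d::int). B * real_of_int (max \<bar>c\<bar> \<bar>d\<bar>) powr (- ((weight + 2) / 2))"
    have le: "norm (f x) \<le> ?u x" if "x \<in> X" for x
      using f[of "fst x" "snd x"] K(2)[OF t, of "fst x" "snd x"] that unfolding B_def by (cases x) auto
    have sm: "?u summable_on A" for A by (rule lattice_summable_weight[OF s])
    have "norm (infsum f X) \<le> infsum ?u X"
      by (rule norm_infsum_le[OF has_sum_infsum has_sum_infsum le])
         (use summable_on_comparison_test[OF sm le] in \<open>auto intro: abs_summable_summable sm\<close>)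
    also have "\<dots> \<le> infsum ?u UNIV"
      by (rule infsum_mono_neutral[OF sm sm]) (use K(1) in \<open>auto simp: B_def\<close>)
    also have "\<dots> = B * Z"
      unfolding Z_def by (subst infsum_cmult_right'[symmetric]) (simp add: case_prod_unfold)
    finally show "norm (infsum f X) \<le> g \<tau>" by (simp add: g_def B_def)
  qed
qed

text \<open>All indices have c > 0, so there is no constant term.\<close>

lemma eis_sum_tendsto_0:
  assumes "R \<ge> 0" shows "(eis_sum \<longlongrightarrow> 0) (im_top_strip R)"
proof -
  obtain g where g: "(g \<longlongrightarrow> 0) im_top" 
    "\<And>X f \<tau>. 1 \<le> Im \<tau> \<Longrightarrow> \<bar>Re \<tau>\<bar> \<le> R \<Longrightarrow>
      (\<And>c d. (c, d) \<in> X \<Longrightarrow> norm (f (c, d) :: complex) \<le> norm (of_int c * \<tau> + of_int d) powr (- weight) \<and> c \<noteq> 0) \<Longrightarrow> norm (infsum f X) \<le> g \<tau>"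
    using lattice_sum_decay[OF assms] by metis
  have "norm (eis_sum \<tau>) \<le> g \<tau>" if "1 \<le> Im \<tau>" "\<bar>Re \<tau>\<bar> \<le> R" for \<tau>
    unfolding eis_sum_def by (rule g(2)[OF that]) (auto simp: norm_eis_term dest: E_index_pos)
  then have "\<forall>\<^sub>F \<tau> in im_top_strip R. norm (eis_sum \<tau>) \<le> g \<tau>"
    unfolding eventually_im_top_strip by blast
  then show ?thesis
    by (rule Lim_null_comparison[OF _ tendsto_mono[OF im_top_strip_le g(1)]])
qed

lemma ratio_series_add_int: "Im \<tau> > 0 \<Longrightarrow> ratio_series (\<tau> + of_int m) = ratio_series \<tau>"
  using ratio_series_invariant[of 1 1 m 0 \<tau>] by simp

text \<open>With N the order of \<open>eta_quot\<close>, q / f is q^(1 - N) times a factor tending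
  to 1. Since N <= 1 the power of q stays bounded, and the decay of the series does the rest, even
  in the borderline case N = 1.\<close>

lemma ratio_series_e2pi_tendsto_0:
  "((\<lambda>\<tau>. e2pi \<tau> * ratio_series \<tau>) \<longlongrightarrow> 0) (im_top_strip 1)"
proof -
  define N where "N = r * ((real p)\<^sup>2 - 1) / 24"
  define Y where "Y \<tau> = exp (- of_real r * (of_nat p * log_euler (e2pi (of_real (real p) * \<tau>)) - log_euler (e2pi (of_real 1 * \<tau>))))" for \<tau>
  have "(Y \<longlongrightarrow> exp (- of_real r * (of_nat p * 0 - 0))) im_top"
    unfolding Y_def[abs_def] using p_pos by (intro tendsto_intros log_euler_e2pi_tendsto_0) auto
  then have Y: "(Y \<longlongrightarrow> 1) (im_top_strip 1)" using tendsto_mono[OF im_top_strip_le] by simp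
  have "((\<lambda>\<tau>. norm (exp log_const * (Y \<tau> * eis_sum \<tau>))) \<longlongrightarrow> norm (exp log_const * (1 * 0))) (im_top_strip 1)"
    by (intro tendsto_intros Y eis_sum_tendsto_0) auto
  then have lim: "((\<lambda>\<tau>. norm (exp log_const * (Y \<tau> * eis_sum \<tau>))) \<longlongrightarrow> 0) (im_top_strip 1)" by simp
  have "norm (e2pi \<tau> * ratio_series \<tau>) \<le> norm (exp log_const * (Y \<tau> * eis_sum \<tau>))" if t: "Im \<tau> \<ge> 1" for \<tau>
  proof -
    have t': "Im \<tau> > 0" "Im (of_nat p * \<tau>) > 0" using t p_pos by auto
    have "e2pi \<tau> = e2pi (of_real (1 - N) * \<tau>) * e2pi (of_real N * \<tau>)"
      by (simp add: algebra_simps flip: e2pi_add)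
    moreover have "e2pi (of_real N * \<tau>) / eta_quot \<tau> = Y \<tau>"
      unfolding eta_quot_def Y_def e2pi_def log_eta_conv_log_euler[OF t'(1)] log_eta_conv_log_euler[OF t'(2)]
      by (simp add: N_def field_simps power2_eq_square flip: exp_diff) (simp add: diff_divide_distrib)
    moreover have "e2pi \<tau> * ratio_series \<tau> = e2pi \<tau> / eta_quot \<tau> * (exp log_const * eis_sum \<tau>)"
      unfolding ratio_series_eq[OF t'(1)] by simp
    ultimately have "e2pi \<tau> * ratio_series \<tau> = e2pi (of_real (1 - N) * \<tau>) * (exp log_const * (Y \<tau> * eis_sum \<tau>))"
      by (metis (no_types, lifting) mult.assoc mult.left_commute times_divide_eq_right)
    moreover have "norm (e2pi (of_real (1 - N) * \<tau>)) \<le> 1"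
      using order_le_1 t by (simp add: norm_e2pi N_def)
    ultimately show ?thesis
      by (simp only: norm_mult) (metis mult_left_le_one_le norm_ge_zero norm_mult)
  qed
  then have "\<forall>\<^sub>F \<tau> in im_top_strip 1. norm (e2pi \<tau> * ratio_series \<tau>) \<le> norm (exp log_const * (Y \<tau> * eis_sum \<tau>))"
    unfolding eventually_im_top_strip by blast
  then show ?thesis by (rule Lim_null_comparison[OF _ lim])
qed

end

section \<open>Behaviour at the cusps\<close>

lemma e2pi_Ln: "x \<noteq> 0 \<Longrightarrow> e2pi (Ln x / (2 * of_real pi * \<i>)) = x"
  by (simp add: e2pi_def)

lemma Im_Ln_divide: "x \<noteq> 0 \<Longrightarrow> Im (Ln x / (2 * of_real pi * \<i>)) = - ln (norm x) / (2 * pi)"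
  by (simp add: Im_divide power2_eq_square)

lemma Re_Ln_divide: "Re (Ln x / (2 * of_real pi * \<i>)) = Im (Ln x) / (2 * pi)"
  by (simp add: Re_divide power2_eq_square)

lemma Im_Ln_divide_pos: "x \<noteq> 0 \<Longrightarrow> norm x < 1 \<Longrightarrow> Im (Ln x / (2 * of_real pi * \<i>)) > 0"
  unfolding Im_Ln_divide by (simp add: ln_less_zero divide_neg_pos)

text \<open>The principal branch keeps the real part of Ln x / (2 \<pi> i) within [-1/2, 1/2], so a
  limit in a strip is enough to control q -> 0.\<close>

lemma filterlim_Ln_divide: "filterlim (\<lambda>x. Ln x / (2 * of_real pi * \<i>)) (im_top_strip 1) (at 0)"
  unfolding filterlim_iff eventually_im_top_strip
proof (intro allI impI, elim exE)
  fix P Y assume Y: "\<forall>\<tau>. Y \<le> Im \<tau> \<and> \<bar>Re \<tau>\<bar> \<le> 1 \<longrightarrow> P \<tau>"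
  have "P (Ln x / (2 * of_real pi * \<i>))" if x: "x \<noteq> 0" "norm x < exp (- 2 * pi * Y)" for x
  proof (rule Y[rule_format], intro conjI)
    have "ln (norm x) < - 2 * pi * Y" using x by (metis exp_less_cancel_iff exp_ln zero_less_norm_iff)
    then show "Y \<le> Im (Ln x / (2 * of_real pi * \<i>))" unfolding Im_Ln_divide[OF x(1)] by (simp add: field_simps)
    have "\<bar>Im (Ln x)\<bar> \<le> pi" using Im_Ln_le_pi[OF x(1)] mpi_less_Im_Ln[OF x(1)] by linarith
    then show "\<bar>Re (Ln x / (2 * of_real pi * \<i>))\<bar> \<le> 1" unfolding Re_Ln_divide by (simp add: field_simps)
  qed
  then show "\<forall>\<^sub>F x in at 0. P (Ln x / (2 * of_real pi * \<i>))"
    unfolding eventually_at by (intro exI[of _ "exp (- 2 * pi * Y)"]) (auto simp: dist_norm)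
qed

text \<open>
  A \<open>1\<close>-periodic holomorphic function is a function of \<open>q\<close> on the punctured disc; the growth
  condition makes the puncture removable.
\<close>
lemma periodic_holomorphic_limit:
  assumes hol: "h holomorphic_on upper_half"
    and per: "\<And>\<tau> m. Im \<tau> > 0 \<Longrightarrow> h (\<tau> + of_int m) = h \<tau>"
    and lim: "((\<lambda>\<tau>. e2pi \<tau> * h \<tau>) \<longlongrightarrow> 0) (im_top_strip 1)"
  obtains L where "(h \<longlongrightarrow> L) im_top"
proof -
  let ?l = "\<lambda>x. Ln x / (2 * of_real pi * \<i>)"
  define \<phi> where "\<phi> x = h (?l x)" for x
  \<comment> \<open>The principal logarithm is cut along the negative axis, so the punctured disc is
    covered by two slit discs. On the second the branch Ln (- x) + \<pi> i is used, which changes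
    the argument of h by an integer only.\<close>
  let ?A = "ball 0 1 \<inter> - \<real>\<^sub>\<le>\<^sub>0 :: complex set" and ?B = "ball 0 1 \<inter> - \<real>\<^sub>\<ge>\<^sub>0 :: complex set"
  have opA: "open ?A" and opB: "open ?B"
    by (auto intro!: open_Int open_Compl closed_nonpos_Reals_complex closed_nonneg_Reals_complex)
  have "(h \<circ> ?l) holomorphic_on ?A"
  proof (rule holomorphic_on_compose_gen[OF _ hol])
    show "?l holomorphic_on ?A" by (auto intro!: holomorphic_intros)
    show "?l ` ?A \<subseteq> upper_half"
    proof
      fix y assume "y \<in> ?l ` ?A"
      then obtain x where x: "y = ?l x" "x \<in> ?A" by blast
      then have "x \<noteq> 0" "norm x < 1" by auto
      from Im_Ln_divide_pos[OF this] show "y \<in> upper_half" by (simp only: x(1) mem_Collect_eq)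
    qed
  qed
  then have A: "\<phi> holomorphic_on ?A" by (simp add: \<phi>_def[abs_def] o_def)
  let ?l2 = "\<lambda>x. (Ln (- x) + of_real pi * \<i>) / (2 * of_real pi * \<i>)"
  have l2: "?l2 x = ?l x + of_int (if Im x \<le> 0 \<and> \<not> (Re x < 0 \<and> Im x = 0) then 1 else 0)" if "x \<noteq> 0" for x
    using Ln_minus[OF that] by (simp add: field_simps)
  have l2im: "Im (?l2 x) > 0" if "x \<in> ?B" for x
  proof -
    from that have x: "x \<noteq> 0" "norm x < 1" by auto
    have "Im (?l2 x) = Im (?l x)" unfolding l2[OF x(1)] by simp
    with Im_Ln_divide_pos[OF x] show ?thesis by simp
  qed
  have "(h \<circ> ?l2) holomorphic_on ?B"
  proof (rule holomorphic_on_compose_gen[OF _ hol])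
    have "- x \<notin> \<real>\<^sub>\<le>\<^sub>0" if "x \<in> ?B" for x
      using that by (auto simp: complex_nonpos_Reals_iff complex_nonneg_Reals_iff)
    then show "?l2 holomorphic_on ?B" by (auto intro!: holomorphic_intros)
    show "?l2 ` ?B \<subseteq> upper_half" using l2im by blast
  qed
  then have B: "\<phi> holomorphic_on ?B"
  proof (rule holomorphic_transform)
    fix x assume "x \<in> ?B"
    then have x: "x \<noteq> 0" "norm x < 1" by auto
    show "(h \<circ> ?l2) x = \<phi> x"
      unfolding o_def l2[OF x(1)] \<phi>_def by (rule per[OF Im_Ln_divide_pos[OF x]])
  qed
  have "?A \<union> ?B = ball 0 1 - {0}"
    by (auto simp: complex_nonpos_Reals_iff complex_nonneg_Reals_iff complex_eq_iff)
  then have hol\<phi>: "\<phi> holomorphic_on ball 0 1 - {0}"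
    using holomorphic_on_Un[OF A B opA opB] by simp
  have "((\<lambda>x. e2pi (?l x) * h (?l x)) \<longlongrightarrow> 0) (at 0)"
    by (rule filterlim_compose[OF lim filterlim_Ln_divide])
  \<comment> \<open>Riemann's criterion for a removable singularity at q = 0; the factor x is
    e(\<tau>).\<close>
  then have "((\<lambda>x. (x - 0) * \<phi> x) \<longlongrightarrow> 0) (at 0)"
    by (rule Lim_transform_eventually) (auto simp: eventually_at e2pi_Ln \<phi>_def intro!: exI[of _ 1])
  then obtain g where g: "g holomorphic_on ball 0 1" "\<And>z. z \<in> ball 0 1 - {0} \<Longrightarrow> g z = \<phi> z"
    using holomorphic_on_extend_lim[OF hol\<phi>] by (auto simp: interior_open)
  have "h \<tau> = g (e2pi \<tau>)" if t: "Im \<tau> > 0" for \<tau>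
  proof -
    have nz: "e2pi \<tau> \<noteq> 0" by (simp add: e2pi_def)
    have "exp (Ln (e2pi \<tau>)) = exp (2 * of_real pi * \<i> * \<tau>)" using nz by (simp add: e2pi_def)
    then obtain n :: int where "Ln (e2pi \<tau>) = 2 * of_real pi * \<i> * \<tau> + (of_int (2 * n) * of_real pi) * \<i>"
      unfolding exp_eq by auto
    then have "?l (e2pi \<tau>) = \<tau> + of_int n" by (simp add: field_simps)
    then have "\<phi> (e2pi \<tau>) = h \<tau>" unfolding \<phi>_def using per[OF t] by simp
    then show ?thesis using g(2)[of "e2pi \<tau>"] nz norm_e2pi_less_1[OF t] by simp
  qed
  then have ev: "\<forall>\<^sub>F \<tau> in im_top. g (e2pi \<tau>) = h \<tau>"
    using eventually_im_top_gt[of 0] by (auto elim!: eventually_mono)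
  have "isCont g 0"
    using g(1) by (intro continuous_on_interior[OF holomorphic_on_imp_continuous_on]) (auto simp: interior_open)
  then have "(g \<longlongrightarrow> g 0) (nhds 0)" by (simp only: isCont_def tendsto_at_iff_tendsto_nhds)
  from filterlim_compose[OF this e2pi_tendsto_0] have "((\<lambda>\<tau>. g (e2pi \<tau>)) \<longlongrightarrow> g 0) im_top" .
  then have "(h \<longlongrightarrow> g 0) im_top" using ev by (rule Lim_transform_eventually)
  then show ?thesis by (rule that)
qed

lemma eventually_im_top_strip_common:
  assumes "finite I" "\<And>i. i \<in> I \<Longrightarrow> eventually (P i) (im_top_strip R)"
  shows "eventually (\<lambda>\<tau>. \<forall>i\<in>I. P i \<tau>) (im_top_strip R)"
  using assms by (simp add: eventually_ball_finite)

context eta_eisenstein_weight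
begin

lemma one_zero_in_E_index: "(1, 0) \<in> E_index p"
  using p_pos by (simp add: E_index_def)

text \<open>At -1 / \<tau> the eta quotient grows like |\<tau>|^k, and relative to this the index
  (c, d) contributes a multiple of |d \<tau> - c|^-k. The terms with d \<noteq> 0 die out together,
  and coprimality leaves only (1, 0), whose summand is 1 / F(\<tau> - 1) because a is -1 modulo
  p.\<close>

lemma ratio_series_cusp_0:
  assumes R: "R \<ge> 0"
  shows "((\<lambda>\<tau>. ratio_series (- 1 / \<tau>)) \<longlongrightarrow> exp (- (of_real (pi * r / 12) * \<i>))) (im_top_strip R)"
proof -
  define U where "U \<tau> = exp (of_real r * (of_nat p * log_euler (e2pi (of_real (1 / real p) * \<tau>)) - log_euler (e2pi (of_real 1 * \<tau>))))" for \<tau>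
  have "(U \<longlongrightarrow> exp (of_real r * (of_nat p * 0 - 0))) im_top"
    unfolding U_def[abs_def] using p_pos by (intro tendsto_intros log_euler_e2pi_tendsto_0) auto
  then have U: "(U \<longlongrightarrow> 1) (im_top_strip R)" using tendsto_mono[OF im_top_strip_le] by simp
  have logs: "of_nat p * log_eta (\<tau> / of_nat p) - log_eta \<tau> = 
     of_nat p * log_euler (e2pi (of_real (1 / real p) * \<tau>)) - log_euler (e2pi (of_real 1 * \<tau>))" if "Im \<tau> > 0" for \<tau>
  proof -
    have "Im (\<tau> / of_nat p) > 0" using that p_pos by simp
    then show ?thesis using that p_pos by (simp add: log_eta_conv_log_euler field_simps)
  qed
  define C where "C = norm (exp log_const) * real p powr (real p * r / 2)"
  have eta: "norm (eta_quot (- 1 / \<tau>)) = norm (U \<tau>) * norm \<tau> powr weight * real p powr (- (real p * r / 2))" if t: "Im \<tau> > 0" for \<tau>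
  proof -
    have nz: "\<tau> \<noteq> 0" using t by auto
    have t': "Im (\<tau> / of_nat p) > 0" using t p_pos by simp
    have e1: "of_nat p * (- 1 / \<tau>) = - 1 / (\<tau> / of_nat p)" by simp
    have e2: "Ln (- \<i> * (\<tau> / of_nat p)) = Ln (- \<i> * \<tau>) - of_real (ln (real p))"
      using Ln_divide_of_real[of "real p" "- \<i> * \<tau>"] p_pos nz by simp
    have "of_real r * (of_nat p * log_eta (of_nat p * (- 1 / \<tau>)) - log_eta (- 1 / \<tau>)) = 
      of_real r * (of_nat p * log_eta (\<tau> / of_nat p) - log_eta \<tau>) + of_real weight * Ln (- \<i> * \<tau>) - of_real (real p * r / 2 * ln (real p))"
      unfolding e1 log_eta_S[OF t] log_eta_S[OF t'] e2 by (simp add: weight_def algebra_simps add_divide_distrib diff_divide_distrib)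
    then have "eta_quot (- 1 / \<tau>) = U \<tau> * exp (of_real weight * Ln (- \<i> * \<tau>)) / exp (of_real (real p * r / 2 * ln (real p)))"
      unfolding eta_quot_def logs[OF t] U_def by (simp add: exp_add exp_diff)
    moreover have "norm (exp (of_real weight * Ln (- \<i> * \<tau>))) = norm \<tau> powr weight"
      using nz by (simp add: powr_def norm_mult)
    moreover have "norm (exp (of_real (real p * r / 2 * ln (real p)) :: complex)) = real p powr (real p * r / 2)"
      using p_pos by (simp add: powr_def)
    ultimately show ?thesis by (simp only: norm_mult norm_divide norm_inverse powr_minus divide_inverse)
  qed
  obtain g where g: "(g \<longlongrightarrow> 0) im_top" 
    "\<And>X f \<tau>. 1 \<le> Im \<tau> \<Longrightarrow> \<bar>Re \<tau>\<bar> \<le> R \<Longrightarrow>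
      (\<And>c d. (c, d) \<in> X \<Longrightarrow> norm (f (c, d) :: complex) \<le> norm (of_int c * \<tau> + of_int d) powr (- weight) \<and> c \<noteq> 0) \<Longrightarrow> norm (infsum f X) \<le> g \<tau>"
    using lattice_sum_decay[OF R] by metis
  define X where "X = (\<lambda>(c, d). (d, - c)) ` (E_index p - {(1, 0)})"
  define rest where "rest \<tau> = (\<Sum>\<^sub>\<infinity>(c, d)\<in>E_index p - {(1, 0)}. 1 / eta_quot_cusp (act c d (- 1 / \<tau>)))" for \<tau>
  have split: "ratio_series (- 1 / \<tau>) = 1 / eta_quot_cusp (act 1 0 (- 1 / \<tau>)) + rest \<tau>" if t: "Im \<tau> > 0" for \<tau>
  proof -
    have t': "Im (- 1 / \<tau>) > 0" by (rule Im_minus_inverse_pos[OF t])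
    let ?f = "\<lambda>(c, d). 1 / eta_quot_cusp (act c d (- 1 / \<tau>))"
    have "(\<lambda>x. exp log_const / eta_quot (- 1 / \<tau>) * (case x of (c, d) \<Rightarrow> eis_term c d (- 1 / \<tau>))) summable_on E_index p"
      by (rule summable_on_cmult_right[OF eis_term_summable[OF t']])
    then have "?f summable_on E_index p"
      by (rule summable_on_cong[THEN iffD1, rotated]) (auto simp: inverse_cusp_eq[OF _ t'] simp del: divide_minus_left)
    then have "?f summable_on (E_index p - {(1, 0)})" by (rule summable_on_subset) auto
    from infsum_insert[OF this, of "(1, 0)"] show ?thesis
      using one_zero_in_E_index unfolding ratio_series_def rest_def by (simp add: insert_absorb)
  qed
  have rest_bound: "norm (rest \<tau>) \<le> C / norm (U \<tau>) * g \<tau>" if t: "1 \<le> Im \<tau>" "\<bar>Re \<tau>\<bar> \<le> R" for \<tau>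
  proof -
    have t0: "Im \<tau> > 0" using t by simp
    have t': "Im (- 1 / \<tau>) > 0" by (rule Im_minus_inverse_pos[OF t0])
    have nz: "\<tau> \<noteq> 0" using t by auto
    define B where "B = norm \<tau> powr weight"
    have B: "B > 0" using nz by (simp add: B_def)
    define f where "f = (\<lambda>(d, c). eis_term (- c) d (- 1 / \<tau>) / of_real B)"
    have fb: "norm (f (d, c)) \<le> norm (of_int d * \<tau> + of_int c) powr (- weight) \<and> d \<noteq> 0" if "(d, c) \<in> X" for d c
    proof
      from that have cd: "(- c, d) \<in> E_index p" "(- c, d) \<noteq> (1, 0)" by (auto simp: X_def)
      have "of_int (- c) * (- 1 / \<tau>) + of_int d = (of_int d * \<tau> + of_int c) / \<tau>"
        using nz by (simp add: field_simps)
      then have "norm (eis_term (- c) d (- 1 / \<tau>)) = norm (of_int d * \<tau> + of_int c) powr (- weight) * B"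
        unfolding norm_eis_term by (simp add: norm_divide powr_divide powr_minus B_def field_simps)
      then show "norm (f (d, c)) \<le> norm (of_int d * \<tau> + of_int c) powr (- weight)"
        using B by (simp add: f_def norm_divide)
      show "d \<noteq> 0" using cd by (auto simp: E_index_def)
    qed
    have "rest \<tau> = (\<Sum>\<^sub>\<infinity>x\<in>E_index p - {(1, 0)}. exp log_const / eta_quot (- 1 / \<tau>) * of_real B * f (case x of (c, d) \<Rightarrow> (d, - c)))"
      unfolding rest_def using B by (intro infsum_cong) (auto simp: inverse_cusp_eq[OF _ t'] f_def simp del: divide_minus_left)
    also have "\<dots> = exp log_const / eta_quot (- 1 / \<tau>) * of_real B * (\<Sum>\<^sub>\<infinity>x\<in>E_index p - {(1, 0)}. f (case x of (c, d) \<Rightarrow> (d, - c)))"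
      by (rule infsum_cmult_right')
    also have "(\<Sum>\<^sub>\<infinity>x\<in>E_index p - {(1, 0)}. f (case x of (c, d) \<Rightarrow> (d, - c))) = infsum f X"
      unfolding X_def by (subst infsum_reindex) (auto simp: inj_on_def o_def)
    finally have "norm (rest \<tau>) = norm (exp log_const) / norm (eta_quot (- 1 / \<tau>)) * B * norm (infsum f X)"
      using B by (simp add: norm_mult norm_divide)
    also have "\<dots> = C / norm (U \<tau>) * norm (infsum f X)"
      unfolding eta[OF t0] C_def B_def[symmetric] using B p_pos by (simp add: powr_minus field_simps)
    also have "\<dots> \<le> C / norm (U \<tau>) * g \<tau>"
      by (intro mult_left_mono g(2)[OF t fb]) (auto simp: C_def)
    finally show ?thesis .
  qed
  have "((\<lambda>\<tau>. C / norm (U \<tau>) * g \<tau>) \<longlongrightarrow> C / norm (1 :: complex) * 0) (im_top_strip R)"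
    by (intro tendsto_intros U tendsto_mono[OF im_top_strip_le g(1)]) auto
  then have lim: "((\<lambda>\<tau>. C / norm (U \<tau>) * g \<tau>) \<longlongrightarrow> 0) (im_top_strip R)" by simp
  have ev: "\<forall>\<^sub>F \<tau> in im_top_strip R. norm (rest \<tau>) \<le> C / norm (U \<tau>) * g \<tau>"
    unfolding eventually_im_top_strip using rest_bound by blast
  have rest0: "(rest \<longlongrightarrow> 0) (im_top_strip R)" by (rule Lim_null_comparison[OF ev lim])
  have first: "1 / eta_quot_cusp (act 1 0 (- 1 / \<tau>)) = exp (- (of_real (pi * r / 12) * \<i>)) / U \<tau>" if t: "Im \<tau> > 0" for \<tau>
  proof -
    note ch = choice[OF one_zero_in_E_index]
    have nz: "\<tau> \<noteq> 0" using t by auto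
    have bm: "b (1, 0) = - 1" using ch(1) by simp
    obtain j where j: "a (1, 0) + 1 = int p * j" using ch(2) by (elim dvdE) auto
    have "a (1, 0) = - 1 + int p * j" using j by simp
    then have a': "of_int (a (1, 0)) = (- 1 + of_int (int p * j) :: complex)" by (simp only: of_int_add of_int_minus of_int_1)
    have "act 1 0 (- 1 / \<tau>) = \<tau> + of_int (a (1, 0))"
      using nz by (simp add: act_def bm field_simps)
    also have "\<dots> = (\<tau> + of_int (- 1)) + of_int (int p * j)" unfolding a' by simp
    finally have "eta_quot_cusp (act 1 0 (- 1 / \<tau>)) = eta_quot_cusp (\<tau> + of_int (- 1))"
      using eta_quot_cusp_periodic[of "\<tau> + of_int (- 1)" j] t by simp
    \<comment> \<open>\<open>log_eta\<close> drops by \<pi> i / 12 under \<tau> -> \<tau> - 1 and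
      carries the factor -r; this is the source of the limit.\<close>
    also have "\<dots> = exp (of_real r * (of_nat p * log_eta (\<tau> / of_nat p) - log_eta \<tau>) + of_real (pi * r / 12) * \<i>)"
      unfolding eta_quot_cusp_def log_eta_add_int[OF t] by (simp add: algebra_simps)
    also have "\<dots> = U \<tau> * exp (of_real (pi * r / 12) * \<i>)"
      unfolding logs[OF t] exp_add U_def ..
    finally show ?thesis by (simp add: exp_minus field_simps)
  qed
  have "((\<lambda>\<tau>. exp (- (of_real (pi * r / 12) * \<i>)) / U \<tau> + rest \<tau>) \<longlongrightarrow> exp (- (of_real (pi * r / 12) * \<i>)) / 1 + 0) (im_top_strip R)"
    by (intro tendsto_intros U rest0) auto
  then have "((\<lambda>\<tau>. exp (- (of_real (pi * r / 12) * \<i>)) / U \<tau> + rest \<tau>) \<longlongrightarrow> exp (- (of_real (pi * r / 12) * \<i>))) (im_top_strip R)"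
    by simp
  then show ?thesis
  proof (rule Lim_transform_eventually)
    show "\<forall>\<^sub>F \<tau> in im_top_strip R. exp (- (of_real (pi * r / 12) * \<i>)) / U \<tau> + rest \<tau> = ratio_series (- 1 / \<tau>)"
      unfolding eventually_im_top_strip by (rule exI[of _ 1]) (use split first in fastforce)
  qed
qed

text \<open>The cosets of Gamma_0(p) in the modular group are represented by the identity and by the
  translations by j = 0, ..., p - 1 followed by inversion.\<close>

lemma cusp_representative:
  assumes z: "Im z > 0"
  obtains \<tau> where "\<bar>Re \<tau>\<bar> \<le> 1 / 2" "Im \<tau> \<ge> 1 / 2"
    "ratio_series z = ratio_series \<tau> \<or> (\<exists>j<p. ratio_series z = ratio_series (- 1 / (\<tau> + of_nat j)))"
proof -
  obtain A B C D :: int and \<tau> where M: "A * D - B * C = 1" and \<tau>: "\<bar>Re \<tau>\<bar> \<le> 1 / 2" "Im \<tau> \<ge> 1 / 2"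
    and zM: "z = (of_int A * \<tau> + of_int B) / (of_int C * \<tau> + of_int D)"
    using modular_reduction[OF z] by metis
  have t: "Im \<tau> > 0" using \<tau> by simp
  show ?thesis
  proof (cases "int p dvd C")
    case True
    from ratio_series_invariant[OF M True t] show ?thesis using that \<tau> zM by blast
  next
    case False
    then have "coprime (int p) C" using prime_p by (simp add: prime_imp_coprime)
    then obtain u v where uv: "u * int p + v * C = 1" by (metis bezout_int coprime_iff_gcd_eq_1)
    \<comment> \<open>v inverts C modulo p, so D and j C agree modulo p, and the matrix with lower
      row (-(D - j C), C) lies in Gamma_0(p).\<close>
    define j where "j = (v * D) mod int p"
    have j: "0 \<le> j" "j < int p" using p_pos by (auto simp: j_def)
    have "int p dvd v * D - j" unfolding j_def by (simp add: dvd_minus_mod)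
    then have "int p dvd C * (v * D - j) + u * D * int p" by simp
    moreover have "C * (v * D - j) + u * D * int p = (u * int p + v * C) * D - j * C" by (simp add: algebra_simps)
    ultimately have pd: "int p dvd D - j * C" using uv by simp
    define A' B' C' D' where A': "A' = - (B - j * A)" "B' = A" "C' = - (D - j * C)" "D' = C"
    have M': "A' * D' - B' * C' = 1" using M by (simp add: A' algebra_simps)
    have pC: "int p dvd C'" using pd unfolding A' by (simp only: dvd_minus_iff)
    define w where "w = \<tau> + of_int j"
    have "Im w > 0" using t by (simp add: w_def)
    then have w: "Im w > 0" "w \<noteq> 0" by auto
    have "(of_int A' * (- 1 / w) + of_int B') / (of_int C' * (- 1 / w) + of_int D') = z"
    proof -
      have "of_int A' * (- 1 / w) + of_int B' = (of_int A * \<tau> + of_int B) / w"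
        "of_int C' * (- 1 / w) + of_int D' = (of_int C * \<tau> + of_int D) / w"
        using w(2) by (simp_all add: A' w_def field_simps)
      then show ?thesis unfolding zM using w(2) by simp
    qed
    then have "ratio_series z = ratio_series (- 1 / w)"
      using ratio_series_invariant[OF M' pC Im_minus_inverse_pos[OF w(1)]] by simp
    moreover have "w = \<tau> + of_nat (nat j)" "nat j < p" using j by (auto simp: w_def)
    ultimately show ?thesis using that \<tau> by blast
  qed
qed

text \<open>By the coset representatives, |G| on the whole half-plane is governed by p + 1 functions
  on one half-strip, each tending to 0 at its top. A nonzero value of G would therefore force |G| to
  have a maximum at an interior point.\<close>

theorem ratio_series_constant:
  assumes "Im \<tau> > 0" shows "ratio_series \<tau> = exp (- (of_real (pi * r / 12) * \<i>))"
proof -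
  define h0 where "h0 = exp (- (of_real (pi * r / 12) * \<i>))"
  obtain L where L: "(ratio_series \<longlongrightarrow> L) im_top"
    using periodic_holomorphic_limit[OF ratio_series_holomorphic ratio_series_add_int ratio_series_e2pi_tendsto_0] by blast
  define G where "G z = (ratio_series z - h0) * (ratio_series z - L)" for z
  have holG: "G holomorphic_on upper_half"
    unfolding G_def by (intro holomorphic_intros ratio_series_holomorphic)
  have contG: "continuous_on upper_half G" by (rule holomorphic_on_imp_continuous_on[OF holG])
  \<comment> \<open>Indices i < p describe approaches to the cusp 0, and i = p stands for the cusp
    at infinity.\<close>
  define \<sigma> where "\<sigma> i z = (if i < p then - 1 / (z + of_nat i) else z)" for i and z :: complex
  have \<sigma>_im: "Im (\<sigma> i z) > 0" if "Im z > 0" for i z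
    using that Im_minus_inverse_pos[of "z + of_nat i"] by (simp add: \<sigma>_def del: divide_minus_left)
  have "(G \<longlongrightarrow> (L - h0) * (L - L)) im_top" unfolding G_def by (intro tendsto_intros L)
  then have G_inf: "(G \<longlongrightarrow> 0) (im_top_strip (1 / 2))" using tendsto_mono[OF im_top_strip_le] by simp
  have G_0: "((\<lambda>z. G (- 1 / (z + of_nat i))) \<longlongrightarrow> 0) (im_top_strip (1 / 2))" if "i < p" for i
  proof -
    have "filterlim (\<lambda>z. z + of_nat i) (im_top_strip (real p + 1)) (im_top_strip (1 / 2))"
      unfolding filterlim_iff eventually_im_top_strip
    proof (intro allI impI, elim exE)
      fix P Y assume "\<forall>\<tau>. Y \<le> Im \<tau> \<and> \<bar>Re \<tau>\<bar> \<le> real p + 1 \<longrightarrow> P \<tau>"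
      then show "\<exists>Y. \<forall>\<tau>. Y \<le> Im \<tau> \<and> \<bar>Re \<tau>\<bar> \<le> 1 / 2 \<longrightarrow> P (\<tau> + of_nat i)"
        using that by (intro exI[of _ Y]) auto
    qed
    from filterlim_compose[OF ratio_series_cusp_0[of "real p + 1"] this]
    have lim: "((\<lambda>z. ratio_series (- 1 / (z + of_nat i))) \<longlongrightarrow> h0) (im_top_strip (1 / 2))" by (simp add: h0_def)
    have "((\<lambda>z. G (- 1 / (z + of_nat i))) \<longlongrightarrow> (h0 - h0) * (h0 - L)) (im_top_strip (1 / 2))"
      unfolding G_def by (intro tendsto_intros lim)
    then show ?thesis by simp
  qed
  have G_lim: "((\<lambda>z. G (\<sigma> i z)) \<longlongrightarrow> 0) (im_top_strip (1 / 2))" for i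
    using G_0[of i] G_inf by (cases "i < p") (simp_all add: \<sigma>_def)
  have reduce: "\<exists>i\<le>p. \<exists>\<tau>. \<bar>Re \<tau>\<bar> \<le> 1 / 2 \<and> Im \<tau> \<ge> 1 / 2 \<and> G z = G (\<sigma> i \<tau>)" if z: "Im z > 0" for z
  proof -
    obtain \<tau> where \<tau>: "\<bar>Re \<tau>\<bar> \<le> 1 / 2" "Im \<tau> \<ge> 1 / 2"
      "ratio_series z = ratio_series \<tau> \<or> (\<exists>j<p. ratio_series z = ratio_series (- 1 / (\<tau> + of_nat j)))"
      using cusp_representative[OF z] by blast
    from \<tau>(3) have "\<exists>i\<le>p. ratio_series z = ratio_series (\<sigma> i \<tau>)"
      unfolding \<sigma>_def by (metis less_imp_le order_refl less_irrefl)
    with \<tau>(1,2) show ?thesis unfolding G_def by (metis (no_types, lifting))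
  qed
  have G0: "G z0 = 0" if z0: "Im z0 > 0" for z0
  proof (rule ccontr)
    assume "G z0 \<noteq> 0"
    define e where "e = norm (G z0)"
    have e: "e > 0" using \<open>G z0 \<noteq> 0\<close> by (simp add: e_def)
    have "\<forall>\<^sub>F z in im_top_strip (1 / 2). norm (G (\<sigma> i z)) < e" for i
      using tendstoD[OF G_lim e, of i] by (simp add: dist_norm)
    then have "\<forall>\<^sub>F z in im_top_strip (1 / 2). \<forall>i\<in>{..p}. norm (G (\<sigma> i z)) < e"
      by (intro eventually_im_top_strip_common) auto
    then obtain Y0 where Y0: "\<And>z i. Y0 \<le> Im z \<Longrightarrow> \<bar>Re z\<bar> \<le> 1 / 2 \<Longrightarrow> i \<le> p \<Longrightarrow> norm (G (\<sigma> i z)) < e"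
      unfolding eventually_im_top_strip by auto
    define Y where "Y = max 1 Y0"
    define K where "K = cbox (Complex (- 1 / 2) (1 / 2)) (Complex (1 / 2) Y)"
    have K: "z \<in> K \<longleftrightarrow> \<bar>Re z\<bar> \<le> 1 / 2 \<and> 1 / 2 \<le> Im z \<and> Im z \<le> Y" for z
      by (auto simp: K_def in_cbox_complex_iff)
    have "compact K" by (simp add: K_def)
    moreover have "Complex 0 1 \<in> K" by (simp add: K Y_def)
    ultimately have "\<exists>x\<in>K. \<forall>y\<in>K. norm (G (\<sigma> i y)) \<le> norm (G (\<sigma> i x))" for i
    proof (intro continuous_attains_sup)
      have "continuous_on K (\<sigma> i)"
      proof (cases "i < p")
        case True
        have "z + of_nat i \<noteq> 0" if "z \<in> K" for z using that by (auto simp: K complex_eq_iff)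
        then have "continuous_on K (\<lambda>z. - 1 / (z + of_nat i))" by (intro continuous_intros) auto
        then show ?thesis using True by (simp add: \<sigma>_def[abs_def])
      qed (simp add: \<sigma>_def[abs_def])
      moreover have "\<sigma> i ` K \<subseteq> upper_half" using \<sigma>_im by (auto simp: K)
      ultimately show "continuous_on K (\<lambda>z. norm (G (\<sigma> i z)))"
        by (intro continuous_on_norm continuous_on_compose2[OF contG])
    qed auto
    then obtain x where x: "\<And>i. x i \<in> K" "\<And>i y. y \<in> K \<Longrightarrow> norm (G (\<sigma> i y)) \<le> norm (G (\<sigma> i (x i)))" by metis
    define S where "S = (\<lambda>i. norm (G (\<sigma> i (x i)))) ` {..p}"
    have S: "finite S" "S \<noteq> {}" by (auto simp: S_def)
    obtain i0 where "norm (G (\<sigma> i0 (x i0))) = Max S" using Max_in[OF S] unfolding S_def by force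
    then have i0: "norm (G (\<sigma> i (x i))) \<le> norm (G (\<sigma> i0 (x i0)))" if "i \<le> p" for i
      using that Max_ge[OF S(1), of "norm (G (\<sigma> i (x i)))"] by (auto simp: S_def)
    define z1 where "z1 = \<sigma> i0 (x i0)"
    have z1: "Im z1 > 0" unfolding z1_def using x(1)[of i0] by (intro \<sigma>_im) (simp add: K)
    \<comment> \<open>Above height Y0 all p + 1 branches stay below e; below it the representative
      lies in the compact box K. As |G| equals e at z0, the point z1 is a global maximum.\<close>
    have low: "norm (G z) < e \<or> norm (G z) \<le> norm (G z1)" if zpos: "Im z > 0" for z
    proof -
      obtain i \<tau> where i: "i \<le> p" "\<bar>Re \<tau>\<bar> \<le> 1 / 2" "Im \<tau> \<ge> 1 / 2" "G z = G (\<sigma> i \<tau>)"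
        using reduce[OF zpos] by blast
      show ?thesis
      proof (cases "Im \<tau> \<ge> Y0")
        case True
        then show ?thesis using Y0[of \<tau> i] i by simp
      next
        case False
        then have "\<tau> \<in> K" using i by (auto simp: K Y_def)
        then show ?thesis using x(2)[of \<tau> i] i0[OF i(1)] i(4) by (simp add: z1_def)
      qed
    qed
    have "e \<le> norm (G z1)" using low[OF z0] by (auto simp: e_def)
    then have max: "norm (G z) \<le> norm (G z1)" if "Im z > 0" for z using low[OF that] by linarith
    have "G constant_on upper_half"
      by (rule maximum_modulus_principle[OF holG open_halfspace_Im_gt convex_connected[OF convex_halfspace_Im_gt] open_halfspace_Im_gt order_refl])
         (use z1 max in auto)
    then obtain k where k: "\<And>z. Im z > 0 \<Longrightarrow> G z = k" by (auto simp: constant_on_def)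
    have "Im (Complex 0 Y) > 0" by (simp add: Y_def)
    \<comment> \<open>Near infinity |G| is below e, against the constant value k of G, whose norm at
      z0 is e.\<close>
    have "norm (G (\<sigma> p (Complex 0 Y))) < e" by (rule Y0) (auto simp: Y_def)
    then show False using k[OF z0] k[OF \<open>Im (Complex 0 Y) > 0\<close>] by (simp add: \<sigma>_def e_def)
  qed
  \<comment> \<open>G = 0 only says that each value of \<open>ratio_series\<close> is h0 or L;
    continuity on a connected set excludes a mixture, and the limit at the cusp 0 then selects
    h0.\<close>
  have "ratio_series constant_on upper_half"
  proof (rule continuous_finite_range_constant)
    show "connected upper_half" by (rule convex_connected[OF convex_halfspace_Im_gt])
    show "continuous_on upper_half ratio_series" by (rule holomorphic_on_imp_continuous_on[OF ratio_series_holomorphic])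
    have "ratio_series ` upper_half \<subseteq> {h0, L}" using G0 by (auto simp: G_def)
    then show "finite (ratio_series ` upper_half)" by (rule finite_subset) auto
  qed
  then obtain k where k: "\<And>z. Im z > 0 \<Longrightarrow> ratio_series z = k" by (auto simp: constant_on_def)
  have "\<forall>\<^sub>F \<tau> in im_top_strip 0. ratio_series (- 1 / \<tau>) = k"
    unfolding eventually_im_top_strip
    by (rule exI[of _ 1]) (auto intro!: k Im_minus_inverse_pos simp del: divide_minus_left)
  then have "((\<lambda>\<tau>. ratio_series (- 1 / \<tau>)) \<longlongrightarrow> k) (im_top_strip 0)"
    by (rule tendsto_eventually)
  then have "k = h0"
    using tendsto_unique[OF im_top_strip_neq_bot _ ratio_series_cusp_0] by (simp add: h0_def)
  with k[OF assms] show ?thesis by (simp add: h0_def)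
qed

text \<open>The phases combine to -r (1/24 + p (p/24 - 1/8)) - r/24 = -r (p - 1) (p - 2) / 24, where
  -r/24 on the left is the contribution of \<open>ratio_series\<close>; the total vanishes for p =
  2. The real part of \<open>log_const\<close> yields the power of p.\<close>

corollary eis_sum_eq_eta_quot:
  assumes "Im \<tau> > 0"
  shows "eis_sum \<tau> = of_real (real p powr (real p * r / 2)) * e2pi (of_real (- (r * (real p - 1) * (real p - 2) / 24))) * eta_quot \<tau>"
proof -
  have "eis_sum \<tau> = exp (- log_const) * exp (- (of_real (pi * r / 12) * \<i>)) * eta_quot \<tau>"
    unfolding eis_sum_def eis_sum_eq[OF assms] ratio_series_constant[OF assms] by simp
  also have "exp (- log_const) * exp (- (of_real (pi * r / 12) * \<i>)) = exp (- log_const + - (of_real (pi * r / 12) * \<i>))"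
    by (simp only: exp_add)
  also have "- log_const + - (of_real (pi * r / 12) * \<i>) =
     (of_real (real p * r / 2 * ln (real p)) + 2 * of_real pi * \<i> * of_real (- (r * (real p - 1) * (real p - 2) / 24)))"
    unfolding log_const_def by (simp add: field_simps)
  also have "exp \<dots> = of_real (real p powr (real p * r / 2)) * e2pi (of_real (- (r * (real p - 1) * (real p - 2) / 24)))"
    unfolding exp_add exp_of_real e2pi_def using p_pos by (simp add: powr_def mult_ac)
  finally show ?thesis .
qed

end

section \<open>Specialisation to p = 2 and p = 3\<close>

lemma of_rat_complex_conv_real: "(of_rat q :: complex) = of_real (of_rat q)"
  by (cases q) (simp add: of_rat_rat)

context eta_eisenstein_weight
begin

lemma eisenstein_E1_conv_eta_power:
  assumes t: "Im \<tau> > 0" and r: "r = of_rat \<rho>" and k: "of_rat k = weight"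
  shows "eisenstein_E1 a b k p (- \<rho>) (of_nat p * \<rho>) \<tau> =
     of_real (real p powr (real p * r / 2)) * e2pi (of_real (- (r * (real p - 1) * (real p - 2) / 24)))
       * eta_power (- \<rho>) \<tau> * eta_power (of_nat p * \<rho>) (of_nat p * \<tau>)"
proof -
  have "E_phase p (- \<rho>) (of_nat p * \<rho>) (a (c, d)) (b (c, d)) c d = phase c d" for c d
    by (simp add: E_phase_def phase_def eta_phase_def Let_def of_rat_mult of_rat_minus flip: r)
  then have "eisenstein_E1 a b k p (- \<rho>) (of_nat p * \<rho>) \<tau> = eis_sum \<tau>"
    by (simp add: eisenstein_E1_def eis_sum_def eis_term_def of_rat_complex_conv_real k)
  moreover have "eta_power (- \<rho>) \<tau> * eta_power (of_nat p * \<rho>) (of_nat p * \<tau>) = eta_quot \<tau>"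
    by (simp add: eta_power_def eta_quot_def of_rat_complex_conv_real of_rat_mult of_rat_minus algebra_simps flip: exp_add r)
  ultimately show ?thesis using eis_sum_eq_eta_quot[OF t] by (simp add: mult.assoc)
qed

end

theorem theorem7p2:
  fixes \<tau> :: complex and n :: rat and a b :: "int \<times> int \<Rightarrow> int"
  assumes "Im \<tau> > 0"
  shows "(1 / 2 < n \<and> n \<le> 1 \<and> admissible_choice 2 a b \<longrightarrow>
           eisenstein_E1 a b (4 * n) 2 (- 8 * n) (16 * n) \<tau> =
             2 powr of_rat (8 * n) * eta_power (- 8 * n) \<tau> * eta_power (16 * n) (2 * \<tau>)) \<and>
         (2 / 3 < n \<and> n \<le> 1 \<and> admissible_choice 3 a b \<longrightarrow>
           eisenstein_E1 a b (3 * n) 3 (- 3 * n) (9 * n) \<tau> =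
             of_real (3 powr of_rat (9 * n / 2)) * e2pi (- of_rat n / 4)
               * eta_power (- 3 * n) \<tau> * eta_power (9 * n) (3 * \<tau>))"
proof (intro conjI impI; elim conjE)
  assume n: "1 / 2 < n" "n \<le> 1" and ab: "admissible_choice 2 a b"
  define x :: real where "x = of_rat n"
  have x: "1 / 2 < x" "x \<le> 1"
    using n of_rat_less[of "1 / 2" n, where 'a = real] of_rat_less_eq[of n 1, where 'a = real]
    by (simp_all add: x_def of_rat_divide)
  \<comment> \<open>r = 8 n makes the order r (p^2 - 1) / 24 equal to n and the weight (p - 1) r / 2
    equal to 4 n.\<close>
  interpret eta_eisenstein 2 "8 * x" a b
    by unfold_locales (use ab in auto)
  interpret eta_eisenstein_weight 2 "8 * x" a b
    by unfold_locales (use x in \<open>simp_all add: weight_def power2_eq_square\<close>)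
  have "eisenstein_E1 a b (4 * n) 2 (- (8 * n)) (of_nat 2 * (8 * n)) \<tau> = 
     of_real (real 2 powr (real 2 * (8 * x) / 2)) * e2pi (of_real (- ((8 * x) * (real 2 - 1) * (real 2 - 2) / 24)))
       * eta_power (- (8 * n)) \<tau> * eta_power (of_nat 2 * (8 * n)) (of_nat 2 * \<tau>)"
    by (rule eisenstein_E1_conv_eta_power[OF assms]) (unfold weight_def, simp_all add: x_def of_rat_mult)
  moreover have "(2 :: complex) powr of_rat (8 * n) = of_real (2 powr (8 * x))"
    using powr_of_real[of 2 "8 * x"] by (simp add: x_def of_rat_complex_conv_real of_rat_mult)
  ultimately show "eisenstein_E1 a b (4 * n) 2 (- 8 * n) (16 * n) \<tau> =
      2 powr of_rat (8 * n) * eta_power (- 8 * n) \<tau> * eta_power (16 * n) (2 * \<tau>)"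
    by (simp add: e2pi_def)
next
  assume n: "2 / 3 < n" "n \<le> 1" and ab: "admissible_choice 3 a b"
  define x :: real where "x = of_rat n"
  have x: "2 / 3 < x" "x \<le> 1"
    using n of_rat_less[of "2 / 3" n, where 'a = real] of_rat_less_eq[of n 1, where 'a = real]
    by (simp_all add: x_def of_rat_divide)
  \<comment> \<open>Here r = 3 n has order n and weight 3 n, and r (p - 1) (p - 2) / 24 becomes n /
    4.\<close>
  interpret eta_eisenstein 3 "3 * x" a b
    by unfold_locales (use ab in auto)
  interpret eta_eisenstein_weight 3 "3 * x" a b
    by unfold_locales (use x in \<open>simp_all add: weight_def power2_eq_square\<close>)
  have "eisenstein_E1 a b (3 * n) 3 (- (3 * n)) (of_nat 3 * (3 * n)) \<tau> = 
     of_real (real 3 powr (real 3 * (3 * x) / 2)) * e2pi (of_real (- ((3 * x) * (real 3 - 1) * (real 3 - 2) / 24)))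
       * eta_power (- (3 * n)) \<tau> * eta_power (of_nat 3 * (3 * n)) (of_nat 3 * \<tau>)"
    by (rule eisenstein_E1_conv_eta_power[OF assms]) (unfold weight_def, simp_all add: x_def of_rat_mult)
  moreover have eqs: "of_rat (9 * n / 2) = 9 * x / 2" "(of_rat n :: complex) = of_real x"
    by (simp_all add: x_def of_rat_complex_conv_real of_rat_mult of_rat_divide)
  ultimately show "eisenstein_E1 a b (3 * n) 3 (- 3 * n) (9 * n) \<tau> =
      of_real (3 powr of_rat (9 * n / 2)) * e2pi (- of_rat n / 4)
        * eta_power (- 3 * n) \<tau> * eta_power (9 * n) (3 * \<tau>)"
    unfolding eqs by simp
qed

end
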